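(* Let $M$ be the standard Hopf surface $\mathbb{S}^1\times\mathbb{S}^3$, let $h$ be an arbitrary Hermitian metric on $M$, and let $(N,g)$ be a Riemannian manifold with non-positive complex sectional curvature. Then there is no non-constant Hermitian harmonic map from $(M,h)$ to $(N,g)$.
   Context: Maps are smooth. The standard Hopf surface is the compact complex surface $(\mathbb{C}^2\setminus\{0\})/\langle z\mapsto \tfrac12 z\rangle$, the quotient of $\mathbb{C}^2\setminus\{0\}$ by the infinite cyclic group generated by $z\mapsto\frac12 z$; it is diffeomorphic to $\mathbb{S}^1\times\mathbb{S}^3$. Hermitian harmonic: a smooth map $f:(M,h)\to(N,g)$ is Hermitian harmonic if, in local holomorphic coordinates $\{z^\alpha\}$ on $M$ and local coordinates $\{y^i\}$ on $N$, with $\Gamma^i_{jk}$ the Christoffel symbols of $g$ evaluated along $f$ and $e_i=f^*(\partial/\partial y^i)$, $$h^{\alpha\bar\beta}\left(\frac{\partial^2 f^i}{\partial z^\alpha\partial\bar z^\beta}+\Gamma^i_{jk}\frac{\partial f^j}{\partial\bar z^\beta}\frac{\partial f^k}{\partial z^\alpha}\right)\otimes e_i=0.$$ Non-positive complex sectional curvature: for $(N,g)$ with Levi-Civita connection $\nabla$, put $R(X,Y)Z=\nabla_X\nabla_YZ-\nabla_Y\nabla_XZ-\nabla_{[X,Y]}Z$ and $R(X,Y,Z,W)=g(R(X,Y)Z,W)$, extended $\mathbb{C}$-multilinearly to $T_{\mathbb{C}}N=TN\otimes\mathbb{C}$. $(N,g)$ has non-positive complex sectional curvature if $R(Z,\bar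 W,W,\bar Z)\le 0$ for all $Z,W\in T_{\mathbb{C}}N$ (at the same point). *)

theory Defs
  imports "HOL-Analysis.Analysis"
begin

section \<open>Smoothness on open sets of Euclidean spaces\<close>

text \<open>Intended for open \<open>S\<close> in a finite-dimensional space: \<open>C^k\<close> is iterated Frechet
  differentiability in every constant direction.\<close>

primrec Ck_on :: "nat \<Rightarrow> 'a::euclidean_space set \<Rightarrow> ('a \<Rightarrow> 'b::real_normed_vector) \<Rightarrow> bool" where
  "Ck_on 0 S f \<longleftrightarrow> continuous_on S f"
| "Ck_on (Suc k) S f \<longleftrightarrow>
     (\<forall>x\<in>S. f differentiable (at x)) \<and>
     (\<forall>v. Ck_on k S (\<lambda>x. frechet_derivative f (at x) v))"

definition smooth_on :: "'a::euclidean_space set \<Rightarrow> ('a \<Rightarrow> 'b::real_normed_vector) \<Rightarrow> bool" where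
  "smooth_on S f \<longleftrightarrow> (\<forall>k. Ck_on k S f)"

section \<open>Manifolds\<close>

text \<open>A chart is a pair of its domain and its coordinate map; the value of the coordinate map
  outside the domain is irrelevant. An atlas need not be maximal.\<close>

type_synonym ('p, 'e) chart = "'p set \<times> ('p \<Rightarrow> 'e)"

definition chart_image :: "('p, 'e) chart \<Rightarrow> 'e set" where
  "chart_image c = snd c ` fst c"

definition chart_inv :: "('p, 'e) chart \<Rightarrow> 'e \<Rightarrow> 'p" where
  "chart_inv c = inv_into (fst c) (snd c)"

definition is_chart :: "'p topology \<Rightarrow> ('p, 'e::euclidean_space) chart \<Rightarrow> bool" where
  "is_chart X c \<longleftrightarrow>
     openin X (fst c) \<and> open (chart_image c) \<and>
     homeomorphic_map (subtopology X (fst c)) (top_of_set (chart_image c)) (snd c)"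

definition transition :: "('p, 'e) chart \<Rightarrow> ('p, 'e) chart \<Rightarrow> 'e \<Rightarrow> 'e" where
  "transition c d = snd d \<circ> chart_inv c"

definition smooth_manifold :: "'p topology \<Rightarrow> ('p, 'e::euclidean_space) chart set \<Rightarrow> bool" where
  "smooth_manifold X A \<longleftrightarrow>
     Hausdorff_space X \<and> second_countable X \<and>
     (\<forall>c\<in>A. is_chart X c) \<and> \<Union>(fst ` A) = topspace X \<and>
     (\<forall>c\<in>A. \<forall>d\<in>A. smooth_on (snd c ` (fst c \<inter> fst d)) (transition c d))"

definition local_rep :: "('p, 'e) chart \<Rightarrow> ('q, 'd) chart \<Rightarrow> ('p \<Rightarrow> 'q) \<Rightarrow> 'e \<Rightarrow> 'd" where
  "local_rep c d f = snd d \<circ> f \<circ> chart_inv c"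

definition smooth_map ::
  "'p topology \<Rightarrow> ('p, 'e::euclidean_space) chart set \<Rightarrow>
   'q topology \<Rightarrow> ('q, 'd::euclidean_space) chart set \<Rightarrow> ('p \<Rightarrow> 'q) \<Rightarrow> bool" where
  "smooth_map X A Y B f \<longleftrightarrow>
     continuous_map X Y f \<and>
     (\<forall>c\<in>A. \<forall>d\<in>B. smooth_on (snd c ` {p \<in> fst c. f p \<in> fst d}) (local_rep c d f))"

section \<open>Riemannian metrics and complex sectional curvature\<close>

text \<open>A metric is given by its coefficient matrices in the charts of the atlas, subject to the
  transformation law of a covariant 2-tensor.\<close>

definition gform :: "real^'n^'n \<Rightarrow> real^'n \<Rightarrow> real^'n \<Rightarrow> real" where
  "gform G v w = (\<Sum>i\<in>UNIV. \<Sum>j\<in>UNIV. G$i$j * v$i * w$j)"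

definition riemannian_metric ::
  "('q, real^'n) chart set \<Rightarrow> (('q, real^'n) chart \<Rightarrow> real^'n \<Rightarrow> real^'n^'n) \<Rightarrow> bool" where
  "riemannian_metric B g \<longleftrightarrow>
     (\<forall>c\<in>B. smooth_on (chart_image c) (g c) \<and>
        (\<forall>y\<in>chart_image c. transpose (g c y) = g c y \<and> (\<forall>v. v \<noteq> 0 \<longrightarrow> gform (g c y) v v > 0))) \<and>
     (\<forall>c\<in>B. \<forall>d\<in>B. \<forall>q \<in> fst c \<inter> fst d. \<forall>v w.
        gform (g c (snd c q)) v w =
        gform (g d (snd d q))
          (frechet_derivative (transition c d) (at (snd c q)) v)
          (frechet_derivative (transition c d) (at (snd c q)) w))"

text \<open>In the following \<open>G\<close> is the coefficient matrix of the metric in some chart, as a function of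
  the coordinates, and vector fields are given by their components in that chart.\<close>

definition pd :: "'n \<Rightarrow> (real^'n \<Rightarrow> real) \<Rightarrow> real^'n \<Rightarrow> real" where
  "pd j u y = frechet_derivative u (at y) (axis j 1)"

definition christoffel :: "(real^'n \<Rightarrow> real^'n^'n) \<Rightarrow> real^'n \<Rightarrow> 'n \<Rightarrow> 'n \<Rightarrow> 'n \<Rightarrow> real" where
  "christoffel G y i j k =
     (\<Sum>l\<in>UNIV. matrix_inv (G y) $ i $ l *
        (pd j (\<lambda>x. G x $ k $ l) y + pd k (\<lambda>x. G x $ j $ l) y - pd l (\<lambda>x. G x $ j $ k) y)) / 2"

definition nabla ::
  "(real^'n \<Rightarrow> real^'n^'n) \<Rightarrow> (real^'n \<Rightarrow> real^'n) \<Rightarrow> (real^'n \<Rightarrow> real^'n) \<Rightarrow> real^'n \<Rightarrow> real^'n" where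
  "nabla G X Y = (\<lambda>y. \<chi> i.
     frechet_derivative (\<lambda>x. Y x $ i) (at y) (X y) +
     (\<Sum>j\<in>UNIV. \<Sum>k\<in>UNIV. christoffel G y i j k * X y $ j * Y y $ k))"

definition lie_bracket :: "(real^'n \<Rightarrow> real^'n) \<Rightarrow> (real^'n \<Rightarrow> real^'n) \<Rightarrow> real^'n \<Rightarrow> real^'n" where
  "lie_bracket X Y = (\<lambda>y. frechet_derivative Y (at y) (X y) - frechet_derivative X (at y) (Y y))"

definition curvature_op ::
  "(real^'n \<Rightarrow> real^'n^'n) \<Rightarrow> (real^'n \<Rightarrow> real^'n) \<Rightarrow> (real^'n \<Rightarrow> real^'n) \<Rightarrow> (real^'n \<Rightarrow> real^'n) \<Rightarrow>
   real^'n \<Rightarrow> real^'n" where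
  "curvature_op G X Y Z = (\<lambda>y.
     nabla G X (nabla G Y Z) y - nabla G Y (nabla G X Z) y - nabla G (lie_bracket X Y) Z y)"

text \<open>The curvature is tensorial, so its value on vectors at \<open>y\<close> may be computed by extending them
  to vector fields with constant components.\<close>

definition riem ::
  "(real^'n \<Rightarrow> real^'n^'n) \<Rightarrow> real^'n \<Rightarrow> real^'n \<Rightarrow> real^'n \<Rightarrow> real^'n \<Rightarrow> real^'n \<Rightarrow> real" where
  "riem G y a b c d = gform (G y) (curvature_op G (\<lambda>_. a) (\<lambda>_. b) (\<lambda>_. c) y) d"

definition riem_complex ::
  "(real^'n \<Rightarrow> real^'n^'n) \<Rightarrow> real^'n \<Rightarrow> complex^'n \<Rightarrow> complex^'n \<Rightarrow> complex^'n \<Rightarrow> complex^'n \<Rightarrow> complex"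
  where
  "riem_complex G y a b c d =
     (\<Sum>i\<in>UNIV. \<Sum>j\<in>UNIV. \<Sum>k\<in>UNIV. \<Sum>l\<in>UNIV.
        complex_of_real (riem G y (axis i 1) (axis j 1) (axis k 1) (axis l 1)) *
        a$i * b$j * c$k * d$l)"

definition cnj_vec :: "complex^'n \<Rightarrow> complex^'n" where
  "cnj_vec v = (\<chi> i. cnj (v$i))"

text \<open>By the symmetries of the curvature tensor \<open>R(Z, cnj W, W, cnj Z)\<close> is real, so \<open>Re\<close> only
  serves to have a real number to compare with \<open>0\<close>.\<close>

definition nonpos_complex_sectional_curvature ::
  "('q, real^'n) chart set \<Rightarrow> (('q, real^'n) chart \<Rightarrow> real^'n \<Rightarrow> real^'n^'n) \<Rightarrow> bool" where
  "nonpos_complex_sectional_curvature B g \<longleftrightarrow>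
     (\<forall>c\<in>B. \<forall>y\<in>chart_image c. \<forall>Z W.
        Re (riem_complex (g c) y Z (cnj_vec W) W (cnj_vec Z)) \<le> 0)"

section \<open>Hermitian metrics and Hermitian harmonic maps\<close>

text \<open>\<open>H$\<alpha>$\<beta>\<close> is the coefficient of the metric with holomorphic index \<open>\<alpha>\<close> and antiholomorphic
  index \<open>\<beta>\<close>. The Jacobians in the transformation law are complex linear when the atlas is
  holomorphic.\<close>

definition hform :: "complex^'m^'m \<Rightarrow> complex^'m \<Rightarrow> complex^'m \<Rightarrow> complex" where
  "hform H v w = (\<Sum>\<alpha>\<in>UNIV. \<Sum>\<beta>\<in>UNIV. H$\<alpha>$\<beta> * v$\<alpha> * cnj (w$\<beta>))"

definition hermitian_metric ::
  "('p, complex^'m) chart set \<Rightarrow> (('p, complex^'m) chart \<Rightarrow> complex^'m \<Rightarrow> complex^'m^'m) \<Rightarrow> bool" where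
  "hermitian_metric A h \<longleftrightarrow>
     (\<forall>c\<in>A. smooth_on (chart_image c) (h c) \<and>
        (\<forall>z\<in>chart_image c.
           (\<forall>\<alpha> \<beta>. h c z $ \<beta> $ \<alpha> = cnj (h c z $ \<alpha> $ \<beta>)) \<and>
           (\<forall>v. v \<noteq> 0 \<longrightarrow> Re (hform (h c z) v v) > 0))) \<and>
     (\<forall>c\<in>A. \<forall>d\<in>A. \<forall>p \<in> fst c \<inter> fst d. \<forall>v w.
        hform (h c (snd c p)) v w =
        hform (h d (snd d p))
          (frechet_derivative (transition c d) (at (snd c p)) v)
          (frechet_derivative (transition c d) (at (snd c p)) w))"

text \<open>The inverse metric satisfies \<open>\<Sum>\<beta>. hinv H \<alpha> \<beta> * H$\<gamma>$\<beta> = (if \<alpha> = \<gamma> then 1 else 0)\<close>, whence the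
  swapped indices.\<close>

definition hinv :: "complex^'m^'m \<Rightarrow> 'm \<Rightarrow> 'm \<Rightarrow> complex" where
  "hinv H \<alpha> \<beta> = matrix_inv H $ \<beta> $ \<alpha>"

definition d_z :: "'m \<Rightarrow> (complex^'m \<Rightarrow> complex) \<Rightarrow> complex^'m \<Rightarrow> complex" where
  "d_z \<alpha> u z =
     (frechet_derivative u (at z) (axis \<alpha> 1) - \<i> * frechet_derivative u (at z) (axis \<alpha> \<i>)) / 2"

definition d_zbar :: "'m \<Rightarrow> (complex^'m \<Rightarrow> complex) \<Rightarrow> complex^'m \<Rightarrow> complex" where
  "d_zbar \<alpha> u z =
     (frechet_derivative u (at z) (axis \<alpha> 1) + \<i> * frechet_derivative u (at z) (axis \<alpha> \<i>)) / 2"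

text \<open>The equation is tensorial, hence it is enough to require it in the charts of the given
  atlases. Since the \<open>e_i\<close> form a frame, it is stated for each component \<open>i\<close>.\<close>

definition hermitian_harmonic ::
  "'p topology \<Rightarrow> ('p, complex^'m) chart set \<Rightarrow>
   (('p, complex^'m) chart \<Rightarrow> complex^'m \<Rightarrow> complex^'m^'m) \<Rightarrow>
   'q topology \<Rightarrow> ('q, real^'n) chart set \<Rightarrow>
   (('q, real^'n) chart \<Rightarrow> real^'n \<Rightarrow> real^'n^'n) \<Rightarrow> ('p \<Rightarrow> 'q) \<Rightarrow> bool" where
  "hermitian_harmonic X A h Y B g f \<longleftrightarrow>
     smooth_map X A Y B f \<and>
     (\<forall>c\<in>A. \<forall>d\<in>B. \<forall>p\<in>fst c. f p \<in> fst d \<longrightarrow>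
        (let z = snd c p;
             F = local_rep c d f;
             F' = (\<lambda>i x. complex_of_real (F x $ i))
         in \<forall>i. (\<Sum>\<alpha>\<in>UNIV. \<Sum>\<beta>\<in>UNIV. hinv (h c z) \<alpha> \<beta> *
                 (d_z \<alpha> (d_zbar \<beta> (F' i)) z +
                  (\<Sum>j\<in>UNIV. \<Sum>k\<in>UNIV. complex_of_real (christoffel (g d) (F z) i j k) *
                     d_zbar \<beta> (F' j) z * d_z \<alpha> (F' k) z))) = 0))"

section \<open>The standard Hopf surface\<close>

text \<open>Points of the Hopf surface are the orbits of nonzero vectors under the group generated by
  multiplication by \<open>1/2\<close>.\<close>

definition hopf_proj :: "complex^2 \<Rightarrow> (complex^2) set" where
  "hopf_proj z = range (\<lambda>k::int. ((1/2::real) powi k) *\<^sub>R z)"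

definition hopf_topology :: "(complex^2) set topology" where
  "hopf_topology =
     topology (\<lambda>U. U \<subseteq> hopf_proj ` (- {0}) \<and> open {z. z \<noteq> 0 \<and> hopf_proj z \<in> U})"

text \<open>The complex structure is the one making the projection locally biholomorphic: the charts are
  the inverses of its restrictions to open sets on which it is injective.\<close>

definition hopf_atlas :: "((complex^2) set, complex^2) chart set" where
  "hopf_atlas =
     {(hopf_proj ` W, inv_into W hopf_proj) | W. open W \<and> 0 \<notin> W \<and> inj_on hopf_proj W}"

lemma openin_hopf_topology:
  "openin hopf_topology U \<longleftrightarrow>
     U \<subseteq> hopf_proj ` (- {0}) \<and> open {z. z \<noteq> 0 \<and> hopf_proj z \<in> U}"
proof -
  have "istopology (\<lambda>U. U \<subseteq> hopf_proj ` (- {0}) \<and> open {z. z \<noteq> 0 \<and> hopf_proj z \<in> U})"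
    unfolding istopology_def
  proof (intro conjI allI impI)
    fix S T :: "(complex^2) set set"
    assume S: "S \<subseteq> hopf_proj ` (- {0}) \<and> open {z. z \<noteq> 0 \<and> hopf_proj z \<in> S}"
      and T: "T \<subseteq> hopf_proj ` (- {0}) \<and> open {z. z \<noteq> 0 \<and> hopf_proj z \<in> T}"
    show "S \<inter> T \<subseteq> hopf_proj ` (- {0})" using S by blast
    have "{z. z \<noteq> 0 \<and> hopf_proj z \<in> S \<inter> T} =
        {z. z \<noteq> 0 \<and> hopf_proj z \<in> S} \<inter> {z. z \<noteq> 0 \<and> hopf_proj z \<in> T}" by blast
    then show "open {z. z \<noteq> 0 \<and> hopf_proj z \<in> S \<inter> T}" using S T by auto
  next
    fix K :: "(complex^2) set set set"
    assume K: "\<forall>U\<in>K. U \<subseteq> hopf_proj ` (- {0}) \<and> open {z. z \<noteq> 0 \<and> hopf_proj z \<in> U}"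
    then show "\<Union>K \<subseteq> hopf_proj ` (- {0})" by blast
    have "{z. z \<noteq> 0 \<and> hopf_proj z \<in> \<Union>K} = (\<Union>U\<in>K. {z. z \<noteq> 0 \<and> hopf_proj z \<in> U})" by blast
    then show "open {z. z \<noteq> 0 \<and> hopf_proj z \<in> \<Union>K}" using K by auto
  qed
  then show ?thesis by (simp add: hopf_topology_def)
qed

lemma topspace_hopf_topology: "topspace hopf_topology = hopf_proj ` (- {0})"
proof
  show "topspace hopf_topology \<subseteq> hopf_proj ` (- {0})"
    using openin_topspace openin_hopf_topology by blast
  have "{z::complex^2. z \<noteq> 0 \<and> hopf_proj z \<in> hopf_proj ` (- {0})} = - {0}" by blast
  then have "openin hopf_topology (hopf_proj ` (- {0}))"
    by (simp add: openin_hopf_topology open_Compl)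
  then show "hopf_proj ` (- {0}) \<subseteq> topspace hopf_topology" by (rule openin_subset)
qed

lemma quotient_map_hopf_proj: "quotient_map (top_of_set (- {0})) hopf_topology hopf_proj"
proof -
  have "openin (top_of_set (- {0})) {z \<in> - {0}. hopf_proj z \<in> U} \<longleftrightarrow>
      open {z. z \<noteq> 0 \<and> hopf_proj z \<in> U}" for U
    by (subst openin_open_eq) (auto simp: open_Compl)
  then show ?thesis
    unfolding quotient_map_def
    by (auto simp: topspace_hopf_topology openin_hopf_topology)
qed

end

theory Submission
  imports Defs
begin

text \<open>Lift \<open>f\<close> to \<open>\<complex>\<^sup>2 - {0}\<close> and put \<open>\<eta>\<^bsub>\<alpha>\<beta>\<^esub> = g(\<partial>\<^sub>\<alpha>f, \<partial>\<^sub>\<beta>f)\<close>,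
  where the second index stands for an antiholomorphic direction. In complex dimension two
  \<open>dd\<^sup>c\<eta>\<close> is a top degree form. The Siu--Sampson formula writes its coefficient as a curvature
  term plus a quadratic form in the mixed Hessian of \<open>f\<close>; the former is nonnegative by the
  curvature assumption, and the latter is positive definite on the Hessians that are trace-free
  with respect to some (arbitrary) Hermitian metric. The coefficient is the divergence of
  functions homogeneous of degree -3 under \<open>z \<mapsto> z/2\<close>, so its integral over the Hopf surface
  vanishes; hence the mixed Hessian vanishes in the coordinate directions.

  Consequently, on each complex line \<open>p + \<complex> e\<^sub>k\<close> avoiding the origin, the energy density
  \<open>g(\<partial>\<^sub>kf, \<partial>\<^sub>kf)\<close> (second factor conjugated) is subharmonic. Being homogeneous of degree -2 it
  tends to 0 at infinity, so it vanishes by the maximum principle, and \<open>f\<close> is constant.\<close>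

section \<open>Calculus of smooth functions\<close>

text \<open>As \<open>h\<close> is arbitrary, integrating a Bochner identity for the
  \<open>h\<close>-trace would leave torsion terms of no definite sign. So nothing is integrated
  against \<open>h\<close>: harmonicity enters only pointwise, as a trace condition on the mixed
  Hessian with some positive definite matrix, and the integrated form is built from \<open>g\<close>
  and the complex structure alone. Hence the role of complex dimension two.

  The degrees come from the invariance of the lift under z -> z/2: each derivative lowers the degree
  by one. In real dimension four, degree -3 is the one at which the fluxes through the spheres of
  radius r and 2r agree. Integration over the quotient is replaced by integration over the punctured
  plane against a compactly supported weight whose dilates by powers of 2 sum to 1.

  The vanishing of the mixed Hessian alone does not make the map constant. The energy is unbounded
  near the origin, which is why it is studied on lines that miss the origin, where decay at infinity
  replaces compactness. The remaining points, which lie on a coordinate axis, follow by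
  continuity.\<close>

abbreviation dird :: "'a::real_normed_vector \<Rightarrow> ('a \<Rightarrow> 'b::real_normed_vector) \<Rightarrow> 'a \<Rightarrow> 'b" where
  "dird v f x \<equiv> frechet_derivative f (at x) v"

lemma frechet_derivative_cong_open:
  assumes "open S" "x \<in> S" "\<And>y. y \<in> S \<Longrightarrow> f y = g y"
  shows "frechet_derivative f (at x) = frechet_derivative g (at x)"
proof -
  have "(f has_derivative D) (at x) \<longleftrightarrow> (g has_derivative D) (at x)" for D
    using assms has_derivative_transform_within_open[of f D x UNIV S g]
      has_derivative_transform_within_open[of g D x UNIV S f] by auto
  then show ?thesis by (simp add: frechet_derivative_def)
qed

lemma differentiable_cong_open:
  assumes "open S" "x \<in> S" "\<And>y. y \<in> S \<Longrightarrow> f y = g y" "f differentiable (at x)"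
  shows "g differentiable (at x)"
  using assms has_derivative_transform_within_open[of f _ x UNIV S g]
  unfolding differentiable_def by blast

lemma has_derivative_frechetD: "(f has_derivative D) (at x) \<Longrightarrow> frechet_derivative f (at x) = D"
  by (metis frechet_derivative_at)

lemma Ck_on_cong:
  assumes "open S" "\<And>x. x \<in> S \<Longrightarrow> f x = g x" "Ck_on k S f"
  shows "Ck_on k S g"
  using assms(2,3)
proof (induction k arbitrary: f g)
  case 0
  then show ?case using continuous_on_cong[of S S f g] by simp
next
  case (Suc k)
  have "Ck_on k S (\<lambda>x. dird v g x)" for v
    by (rule Suc.IH[of "\<lambda>x. dird v f x"])
      (use Suc.prems frechet_derivative_cong_open[OF assms(1), of _ f g] in auto)
  then show ?case
    using Suc.prems differentiable_cong_open[OF assms(1), of _ f g] by auto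
qed

lemma Ck_on_Suc_imp: "Ck_on (Suc k) S f \<Longrightarrow> Ck_on k S f"
proof (induction k arbitrary: f)
  case 0
  then have "continuous (at x within S) f" if "x \<in> S" for x
    using that by (simp add: continuous_at_imp_continuous_at_within differentiable_imp_continuous_within)
  then show ?case by (simp add: continuous_on_eq_continuous_within)
next
  case (Suc k)
  then show ?case by (metis Ck_on.simps(2))
qed

lemma Ck_on_subset: "Ck_on k S f \<Longrightarrow> T \<subseteq> S \<Longrightarrow> Ck_on k T f"
  by (induction k arbitrary: f) (auto intro: continuous_on_subset)

lemma Ck_on_local:
  assumes "\<And>x. x \<in> S \<Longrightarrow> \<exists>T. open T \<and> x \<in> T \<and> Ck_on k T f"
  shows "Ck_on k S f"
  using assms
proof (induction k arbitrary: f)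
  case 0
  then have "continuous (at x within S) f" if "x \<in> S" for x
    using that by (metis Ck_on.simps(1) continuous_at_imp_continuous_at_within
        continuous_on_eq_continuous_at)
  then show ?case by (simp add: continuous_on_eq_continuous_within)
next
  case (Suc k)
  have "Ck_on k S (\<lambda>x. dird v f x)" for v
    by (rule Suc.IH) (use Suc.prems in \<open>fastforce\<close>)
  moreover have "f differentiable (at x)" if "x \<in> S" for x
    using Suc.prems[OF that] by auto
  ultimately show ?case by simp
qed

lemma Ck_on_const: "Ck_on k S (\<lambda>_. c)"
proof (induction k arbitrary: c)
  case (Suc k)
  have "frechet_derivative (\<lambda>_::'a. c::'b) (at x) = (\<lambda>_. 0)" for x
    by (rule has_derivative_frechetD) simp
  then show ?case using Suc by simp
qed simp

lemma Ck_on_bounded_linear: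
  assumes L: "bounded_linear L" and S: "open S" and "Ck_on k S f"
  shows "Ck_on k S (\<lambda>x. L (f x))"
  using assms(3)
proof (induction k arbitrary: f)
  case 0
  then show ?case by (simp add: bounded_linear.continuous_on[OF L])
next
  case (Suc k)
  have D: "((\<lambda>x. L (f x)) has_derivative (\<lambda>v. L (dird v f x))) (at x)" if "x \<in> S" for x
  proof (rule bounded_linear.has_derivative[OF L])
    show "(f has_derivative (\<lambda>v. dird v f x)) (at x)"
      using Suc.prems that frechet_derivative_works[of f "at x"] by simp
  qed
  have "Ck_on k S (\<lambda>x. dird v (\<lambda>x. L (f x)) x)" for v
  proof (rule Ck_on_cong[OF S])
    show "Ck_on k S (\<lambda>x. L (dird v f x))"
      using Suc by simp
  qed (simp add: has_derivative_frechetD[OF D])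
  then show ?case using D by (auto simp: differentiable_def)
qed

lemma Ck_on_add:
  assumes S: "open S" and "Ck_on k S f" "Ck_on k S g"
  shows "Ck_on k S (\<lambda>x. f x + g x)"
  using assms(2,3)
proof (induction k arbitrary: f g)
  case 0
  then show ?case by (simp add: continuous_on_add)
next
  case (Suc k)
  have D: "((\<lambda>x. f x + g x) has_derivative (\<lambda>v. dird v f x + dird v g x)) (at x)"
    if "x \<in> S" for x
    using Suc.prems that by (auto simp: frechet_derivative_works intro!: has_derivative_add)
  have "Ck_on k S (\<lambda>x. dird v (\<lambda>x. f x + g x) x)" for v
    by (rule Ck_on_cong[OF S, of "\<lambda>x. dird v f x + dird v g x"])
      (use Suc D in \<open>auto simp: has_derivative_frechetD[OF D]\<close>)
  then show ?case using D by (auto simp: differentiable_def)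
qed

lemma Ck_on_sum:
  assumes S: "open S" and "\<And>i. i \<in> I \<Longrightarrow> Ck_on k S (f i)"
  shows "Ck_on k S (\<lambda>x. \<Sum>i\<in>I. f i x)"
  using assms(2)
  by (induction I rule: infinite_finite_induct) (auto intro: Ck_on_const Ck_on_add[OF S])

lemma Ck_on_bilinear:
  assumes B: "bounded_bilinear B" and S: "open S" and "Ck_on k S f" "Ck_on k S g"
  shows "Ck_on k S (\<lambda>x. B (f x) (g x))"
  using assms(3,4)
proof (induction k arbitrary: f g)
  case 0
  then show ?case by (simp add: bounded_bilinear.continuous_on[OF B])
next
  case (Suc k)
  have D: "((\<lambda>x. B (f x) (g x)) has_derivative (\<lambda>v. B (f x) (dird v g x) + B (dird v f x) (g x))) (at x)"
    if "x \<in> S" for x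
    using Suc.prems that by (auto simp: frechet_derivative_works intro!: bounded_bilinear.FDERIV[OF B])
  have "Ck_on k S (\<lambda>x. dird v (\<lambda>x. B (f x) (g x)) x)" for v
  proof (rule Ck_on_cong[OF S])
    show "Ck_on k S (\<lambda>x. B (f x) (dird v g x) + B (dird v f x) (g x))"
      using Suc.prems Ck_on_Suc_imp[OF Suc.prems(1)] Ck_on_Suc_imp[OF Suc.prems(2)]
      by (intro Ck_on_add[OF S] Suc.IH) simp_all
  qed (simp add: has_derivative_frechetD[OF D])
  then show ?case using D by (auto simp: differentiable_def)
qed

lemma Ck_on_compose:
  fixes f :: "'a::euclidean_space \<Rightarrow> 'c::euclidean_space"
  assumes S: "open S" and T: "open T" "f ` S \<subseteq> T" and "Ck_on k S f" "Ck_on k T g"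
  shows "Ck_on k S (\<lambda>x. g (f x))"
  using assms(4,5)
proof (induction k arbitrary: g)
  case 0
  then show ?case using T(2) by (auto intro: continuous_on_compose2)
next
  case (Suc k)
  have D: "((\<lambda>x. g (f x)) has_derivative (\<lambda>v. dird (dird v f x) g (f x))) (at x)"
    if "x \<in> S" for x
  proof -
    have "(f has_derivative (\<lambda>v. dird v f x)) (at x)"
      using Suc.prems that by (auto simp: frechet_derivative_works)
    moreover have "(g has_derivative (\<lambda>v. dird v g (f x))) (at (f x))"
      using Suc.prems that T(2) by (auto simp: frechet_derivative_works)
    ultimately show ?thesis by (rule has_derivative_compose)
  qed
  \<comment> \<open>\<open>Ck_on\<close> differentiates in constant directions only, whereas the
    chain rule produces the moving direction \<open>dird v f x\<close>. Expanding it in the basis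
    gives products of its coefficients with derivatives of \<open>g\<close> in constant
    directions.\<close>
  have E: "dird v (\<lambda>x. g (f x)) x = (\<Sum>b\<in>Basis. (dird v f x \<bullet> b) *\<^sub>R dird b g (f x))"
    if "x \<in> S" for x v
  proof -
    have "linear (frechet_derivative g (at (f x)))"
      using Suc.prems(2) that T(2) by (auto intro!: linear_frechet_derivative)
    then have "dird (\<Sum>b\<in>Basis. (dird v f x \<bullet> b) *\<^sub>R b) g (f x) =
        (\<Sum>b\<in>Basis. (dird v f x \<bullet> b) *\<^sub>R dird b g (f x))"
      by (simp add: linear_sum linear_scale)
    then have "dird (dird v f x) g (f x) = (\<Sum>b\<in>Basis. (dird v f x \<bullet> b) *\<^sub>R dird b g (f x))"
      by (simp add: euclidean_representation)
    then show ?thesis by (simp add: has_derivative_frechetD[OF D[OF that]])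
  qed
  have "Ck_on k S (\<lambda>x. dird v (\<lambda>x. g (f x)) x)" for v
  proof (rule Ck_on_cong[OF S])
    show "Ck_on k S (\<lambda>x. \<Sum>b\<in>Basis. (dird v f x \<bullet> b) *\<^sub>R dird b g (f x))"
    proof (rule Ck_on_sum[OF S], rule Ck_on_bilinear[OF bounded_bilinear_scaleR S])
      fix b :: 'c
      show "Ck_on k S (\<lambda>x. dird v f x \<bullet> b)"
        using Suc.prems by (intro Ck_on_bounded_linear[OF bounded_linear_inner_left S]) simp
      show "Ck_on k S (\<lambda>x. dird b g (f x))"
        using Suc.prems by (intro Suc.IH Ck_on_Suc_imp[of k S f]) simp_all
    qed
  qed (simp add: E)
  then show ?case using D by (auto simp: differentiable_def)
qed

lemma Ck_on_inverse:
  fixes f :: "'a::euclidean_space \<Rightarrow> real"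
  assumes S: "open S" and nz: "\<And>x. x \<in> S \<Longrightarrow> f x \<noteq> 0" and "Ck_on k S f"
  shows "Ck_on k S (\<lambda>x. inverse (f x))"
  using assms(3)
proof (induction k)
  case 0
  then show ?case using nz by (simp add: continuous_on_inverse)
next
  case (Suc k)
  have IH: "Ck_on k S (\<lambda>x. inverse (f x))"
    using Suc Ck_on_Suc_imp by blast
  have D: "((\<lambda>x. inverse (f x)) has_derivative
      (\<lambda>v. - (inverse (f x) * dird v f x * inverse (f x)))) (at x)"
    if "x \<in> S" for x
    using Suc.prems that nz by (auto simp: frechet_derivative_works intro!: has_derivative_inverse)
  have "Ck_on k S (\<lambda>x. dird v (\<lambda>x. inverse (f x)) x)" for v
  proof (rule Ck_on_cong[OF S])
    have "Ck_on k S (\<lambda>x. dird v f x)"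
      using Suc.prems by simp
    then show "Ck_on k S (\<lambda>x. - (inverse (f x) * dird v f x * inverse (f x)))"
      by (intro Ck_on_bounded_linear[OF bounded_linear_minus[OF bounded_linear_ident] S]
          Ck_on_bilinear[OF bounded_bilinear_mult S] IH)
  qed (simp add: has_derivative_frechetD[OF D])
  then show ?case using D by (auto simp: differentiable_def)
qed

lemma bounded_linear_axis: "bounded_linear (axis i :: 'b::euclidean_space \<Rightarrow> 'b^'n)"
proof -
  have "linear (axis i :: 'b \<Rightarrow> 'b^'n)"
    by (rule linearI) (simp_all add: vec_eq_iff axis_def)
  then show ?thesis
    by (simp only: linear_conv_bounded_linear)
qed

lemma Ck_on_vec:
  fixes f :: "'a::euclidean_space \<Rightarrow> 'b::euclidean_space^'n"
  assumes S: "open S" and "\<And>i. Ck_on k S (\<lambda>x. f x $ i)"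
  shows "Ck_on k S f"
proof -
  have "f x = (\<Sum>i\<in>UNIV. axis i (f x $ i))" for x
    by (simp add: vec_eq_iff) (simp add: axis_def cong: if_cong)
  then have eq: "f = (\<lambda>x. \<Sum>i\<in>UNIV. axis i (f x $ i))"
    by (rule ext)
  have "Ck_on k S (\<lambda>x. \<Sum>i\<in>UNIV. axis i (f x $ i))"
    by (intro Ck_on_sum[OF S] Ck_on_bounded_linear[OF bounded_linear_axis S] assms(2))
  then show ?thesis by (subst eq)
qed

lemma smooth_on_dird: "smooth_on S f \<Longrightarrow> smooth_on S (\<lambda>x. dird v f x)"
  unfolding smooth_on_def by (metis Ck_on.simps(2))

lemma smooth_on_differentiable: "smooth_on S f \<Longrightarrow> x \<in> S \<Longrightarrow> f differentiable (at x)"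
  unfolding smooth_on_def by (metis Ck_on.simps(2))

lemma smooth_on_has_derivative:
  "smooth_on S f \<Longrightarrow> x \<in> S \<Longrightarrow> (f has_derivative (\<lambda>v. dird v f x)) (at x)"
  using smooth_on_differentiable frechet_derivative_works by blast

lemma smooth_on_linear: "smooth_on S f \<Longrightarrow> x \<in> S \<Longrightarrow> linear (\<lambda>v. dird v f x)"
  by (rule has_derivative_linear[OF smooth_on_has_derivative])

lemma smooth_on_continuous: "smooth_on S f \<Longrightarrow> continuous_on S f"
  unfolding smooth_on_def by (metis Ck_on.simps(1))

lemma smooth_on_cong:
  "open S \<Longrightarrow> (\<And>x. x \<in> S \<Longrightarrow> f x = g x) \<Longrightarrow> smooth_on S f \<Longrightarrow> smooth_on S g"
  unfolding smooth_on_def using Ck_on_cong by blast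

lemma smooth_on_subset: "smooth_on S f \<Longrightarrow> T \<subseteq> S \<Longrightarrow> smooth_on T f"
  unfolding smooth_on_def using Ck_on_subset by blast

lemma smooth_on_local:
  assumes "\<And>x. x \<in> S \<Longrightarrow> \<exists>T. open T \<and> x \<in> T \<and> smooth_on T f"
  shows "smooth_on S f"
  unfolding smooth_on_def
proof (intro allI Ck_on_local)
  fix k x assume "x \<in> S"
  then show "\<exists>T. open T \<and> x \<in> T \<and> Ck_on k T f"
    using assms smooth_on_def by blast
qed

lemma smooth_on_const: "smooth_on S (\<lambda>_. c)"
  unfolding smooth_on_def by (simp add: Ck_on_const)

lemma smooth_on_bounded_linear:
  "bounded_linear L \<Longrightarrow> open S \<Longrightarrow> smooth_on S f \<Longrightarrow> smooth_on S (\<lambda>x. L (f x))"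
  unfolding smooth_on_def by (simp add: Ck_on_bounded_linear)

lemma smooth_on_add:
  "open S \<Longrightarrow> smooth_on S f \<Longrightarrow> smooth_on S g \<Longrightarrow> smooth_on S (\<lambda>x. f x + g x)"
  unfolding smooth_on_def by (simp add: Ck_on_add)

lemma smooth_on_sum:
  "open S \<Longrightarrow> (\<And>i. i \<in> I \<Longrightarrow> smooth_on S (f i)) \<Longrightarrow> smooth_on S (\<lambda>x. \<Sum>i\<in>I. f i x)"
  unfolding smooth_on_def by (simp add: Ck_on_sum)

lemma smooth_on_bilinear:
  "bounded_bilinear B \<Longrightarrow> open S \<Longrightarrow> smooth_on S f \<Longrightarrow> smooth_on S g \<Longrightarrow>
    smooth_on S (\<lambda>x. B (f x) (g x))"
  unfolding smooth_on_def by (simp add: Ck_on_bilinear)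

lemmas smooth_on_mult = smooth_on_bilinear[OF bounded_bilinear_mult]

lemma smooth_on_diff:
  assumes "open S" "smooth_on S f" "smooth_on S g"
  shows "smooth_on S (\<lambda>x. f x - g x)"
  using smooth_on_add[OF assms(1,2)
      smooth_on_bounded_linear[OF bounded_linear_minus[OF bounded_linear_ident] assms(1,3)]]
  by simp

lemma smooth_on_prod:
  fixes f :: "'i \<Rightarrow> 'a::euclidean_space \<Rightarrow> real"
  assumes S: "open S" and "\<And>i. i \<in> I \<Longrightarrow> smooth_on S (f i)"
  shows "smooth_on S (\<lambda>x. \<Prod>i\<in>I. f i x)"
  using assms(2)
proof (induction I rule: infinite_finite_induct)
  case (insert i I)
  then show ?case using smooth_on_mult[OF S, of "f i" "\<lambda>x. \<Prod>i\<in>I. f i x"] by simp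
qed (simp_all add: smooth_on_const)

lemma smooth_on_compose:
  fixes f :: "'a::euclidean_space \<Rightarrow> 'c::euclidean_space"
  shows "open S \<Longrightarrow> open T \<Longrightarrow> f ` S \<subseteq> T \<Longrightarrow> smooth_on S f \<Longrightarrow> smooth_on T g \<Longrightarrow>
    smooth_on S (\<lambda>x. g (f x))"
  unfolding smooth_on_def by (simp add: Ck_on_compose)

lemma smooth_on_inverse:
  fixes f :: "'a::euclidean_space \<Rightarrow> real"
  shows "open S \<Longrightarrow> (\<And>x. x \<in> S \<Longrightarrow> f x \<noteq> 0) \<Longrightarrow> smooth_on S f \<Longrightarrow>
    smooth_on S (\<lambda>x. inverse (f x))"
  unfolding smooth_on_def by (simp add: Ck_on_inverse)

lemma smooth_on_component: "open S \<Longrightarrow> smooth_on S f \<Longrightarrow> smooth_on S (\<lambda>x. f x $ i)"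
  by (rule smooth_on_bounded_linear[OF bounded_linear_vec_nth])

lemma smooth_on_vec:
  fixes f :: "'a::euclidean_space \<Rightarrow> 'b::euclidean_space^'n"
  shows "open S \<Longrightarrow> (\<And>i. smooth_on S (\<lambda>x. f x $ i)) \<Longrightarrow> smooth_on S f"
  unfolding smooth_on_def by (simp add: Ck_on_vec)

lemma smooth_on_det:
  fixes A :: "'a::euclidean_space \<Rightarrow> real^'n^'n"
  assumes S: "open S" and A: "\<And>i j. smooth_on S (\<lambda>x. A x $ i $ j)"
  shows "smooth_on S (\<lambda>x. det (A x))"
  unfolding det_def
  by (intro smooth_on_sum[OF S] smooth_on_mult[OF S] smooth_on_const smooth_on_prod[OF S] A)

lemma
  fixes A :: "'a::semiring_1^'n^'m"
  assumes "invertible A"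
  shows matrix_inv_right: "A ** matrix_inv A = mat 1"
    and matrix_inv_left: "matrix_inv A ** A = mat 1"
  using someI_ex[OF assms[unfolded invertible_def]] unfolding matrix_inv_def by blast+

text \<open>Cramer's rule writes each entry of the inverse as a quotient of determinants, that is,
  of polynomials in the entries of \<open>A\<close>, with nonvanishing denominator.\<close>

lemma smooth_on_matrix_inv:
  fixes A :: "'a::euclidean_space \<Rightarrow> real^'n^'n"
  assumes S: "open S" and A: "smooth_on S A" and inv: "\<And>x. x \<in> S \<Longrightarrow> invertible (A x)"
  shows "smooth_on S (\<lambda>x. matrix_inv (A x) $ i $ j)"
proof (rule smooth_on_cong[OF S])
  let ?M = "\<lambda>x. \<chi> r c. if c = i then axis j 1 $ r else A x $ r $ c"
  have A': "smooth_on S (\<lambda>x. A x $ i $ j)" for i j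
    by (intro smooth_on_component[OF S] A)
  have nz: "det (A x) \<noteq> 0" if "x \<in> S" for x
    using inv[OF that] by (simp add: invertible_det_nz)
  have "smooth_on S (\<lambda>x. ?M x $ r $ c)" for r c
    by (cases "c = i") (simp_all add: A' smooth_on_const)
  then show "smooth_on S (\<lambda>x. det (?M x) * inverse (det (A x)))"
    by (intro smooth_on_mult[OF S] smooth_on_det[OF S] smooth_on_inverse[OF S] A' nz)
  fix x assume x: "x \<in> S"
  have "A x *v (matrix_inv (A x) *v axis j 1) = axis j 1"
    by (simp add: matrix_vector_mul_assoc matrix_inv_right inv[OF x])
  then have "matrix_inv (A x) *v axis j 1 = (\<chi> k. det (\<chi> r c. if c = k then axis j 1 $ r else A x $ r $ c) / det (A x))"
    using cramer[OF nz[OF x], of "matrix_inv (A x) *v axis j 1" "axis j 1"] by simp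
  then have "(matrix_inv (A x) *v axis j 1) $ i = det (?M x) / det (A x)"
    by simp
  moreover have "(matrix_inv (A x) *v axis j 1) $ i = matrix_inv (A x) $ i $ j"
    by (simp add: matrix_vector_mul_component inner_axis)
  ultimately show "det (?M x) * inverse (det (A x)) = matrix_inv (A x) $ i $ j"
    by (simp add: divide_inverse)
qed

section \<open>Symmetry of second derivatives\<close>

lemma has_vector_derivative_line:
  assumes "smooth_on S f" "y + s *\<^sub>R v \<in> S"
  shows "((\<lambda>s. f (y + s *\<^sub>R v)) has_vector_derivative dird v f (y + s *\<^sub>R v)) (at s)"
proof -
  have "((\<lambda>s. y + s *\<^sub>R v) has_derivative (\<lambda>h. h *\<^sub>R v)) (at s)"
    by (auto intro!: derivative_eq_intros)
  from has_derivative_compose[OF this smooth_on_has_derivative[OF assms]]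
  show ?thesis
    by (simp add: has_vector_derivative_def linear_scale[OF smooth_on_linear[OF assms]])
qed

text \<open>Two mean value steps: one along \<open>v\<close> for the increment of \<open>f\<close>
  over \<open>h\<close> times \<open>w\<close>, then one along \<open>w\<close> for the derivative
  of \<open>f\<close> in direction \<open>v\<close>.\<close>

lemma second_difference:
  fixes f :: "'a::euclidean_space \<Rightarrow> real"
  assumes f: "smooth_on S f" and h: "0 < h"
    and sub: "\<And>s t. 0 \<le> s \<Longrightarrow> s \<le> h \<Longrightarrow> 0 \<le> t \<Longrightarrow> t \<le> h \<Longrightarrow> x + s *\<^sub>R v + t *\<^sub>R w \<in> S"
  shows "\<exists>s t. 0 < s \<and> s < h \<and> 0 < t \<and> t < h \<and>
    f (x + h *\<^sub>R v + h *\<^sub>R w) - f (x + h *\<^sub>R v) - f (x + h *\<^sub>R w) + f x =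
      h * h * dird w (dird v f) (x + s *\<^sub>R v + t *\<^sub>R w)"
proof -
  have line: "((\<lambda>s. f' (y + s *\<^sub>R u)) has_real_derivative dird u f' (y + s *\<^sub>R u)) (at s)"
    if "smooth_on S f'" "y + s *\<^sub>R u \<in> S" for f' :: "'a \<Rightarrow> real" and y u s
    using has_vector_derivative_line[OF that] by (simp add: has_real_derivative_iff_has_vector_derivative)
  have 1: "((\<lambda>s. f (x + h *\<^sub>R w + s *\<^sub>R v) - f (x + s *\<^sub>R v)) has_real_derivative
      dird v f (x + h *\<^sub>R w + s *\<^sub>R v) - dird v f (x + s *\<^sub>R v)) (at s)" if "0 \<le> s" "s \<le> h" for s
    using sub[of s h] sub[of s 0] that h
    by (intro DERIV_diff line[OF f]) (simp_all add: algebra_simps)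
  obtain s where s: "0 < s" "s < h"
    and e1: "f (x + h *\<^sub>R w + h *\<^sub>R v) - f (x + h *\<^sub>R v) - (f (x + h *\<^sub>R w + 0 *\<^sub>R v) - f (x + 0 *\<^sub>R v)) =
      (h - 0) * (dird v f (x + h *\<^sub>R w + s *\<^sub>R v) - dird v f (x + s *\<^sub>R v))"
    using MVT2[OF h 1] by blast
  have 2: "((\<lambda>t. dird v f (x + s *\<^sub>R v + t *\<^sub>R w)) has_real_derivative
      dird w (\<lambda>x. dird v f x) (x + s *\<^sub>R v + t *\<^sub>R w)) (at t)" if "0 \<le> t" "t \<le> h" for t
    using sub[of s t] that s by (intro line[OF smooth_on_dird[OF f]]) simp
  obtain t where t: "0 < t" "t < h"
    and e2: "dird v f (x + s *\<^sub>R v + h *\<^sub>R w) - dird v f (x + s *\<^sub>R v + 0 *\<^sub>R w) =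
      (h - 0) * dird w (\<lambda>x. dird v f x) (x + s *\<^sub>R v + t *\<^sub>R w)"
    using MVT2[OF h 2] by blast
  show ?thesis
    by (intro exI[of _ s] exI[of _ t]) (use s t e1 e2 in \<open>simp add: algebra_simps\<close>)
qed

text \<open>The second difference over a small parallelogram is symmetric in \<open>v\<close> and
  \<open>w\<close>, so the two mixed derivatives share a value at points close to \<open>x\<close>.
  Continuity of both then forces equality at \<open>x\<close>.\<close>

lemma dird_commute_real:
  fixes f :: "'a::euclidean_space \<Rightarrow> real"
  assumes S: "open S" and x: "x \<in> S" and f: "smooth_on S f"
  shows "dird v (dird w f) x = dird w (dird v f) x"
proof (rule ccontr)
  let ?A = "dird w (\<lambda>x. dird v f x)" and ?B = "dird v (\<lambda>x. dird w f x)"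
  \<comment> \<open>Half of the supposed gap: numbers closer than \<open>e\<close> to the two
    different values cannot coincide.\<close>
  define e where "e = \<bar>?A x - ?B x\<bar> / 2"
  assume "\<not> ?thesis"
  then have e: "e > 0" by (simp add: e_def)
  have cont: "isCont ?A x" "isCont ?B x"
    using smooth_on_continuous[OF smooth_on_dird[OF smooth_on_dird[OF f]]] S x
    by (auto simp: continuous_on_eq_continuous_at)
  obtain d1 where d1: "d1 > 0" "\<And>y. dist y x < d1 \<Longrightarrow> dist (?A y) (?A x) < e"
    using cont(1) e unfolding continuous_at_eps_delta by blast
  obtain d2 where d2: "d2 > 0" "\<And>y. dist y x < d2 \<Longrightarrow> dist (?B y) (?B x) < e"
    using cont(2) e unfolding continuous_at_eps_delta by blast
  obtain d3 where d3: "d3 > 0" "ball x d3 \<subseteq> S"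
    using S x open_contains_ball by blast
  define d where "d = min d1 (min d2 d3)"
  have d: "d > 0" "d \<le> d1" "d \<le> d2" "d \<le> d3" using d1 d2 d3 by (auto simp: d_def)
  \<comment> \<open>The parallelogram spanned by \<open>h\<close> times \<open>v\<close> and
    \<open>w\<close> then stays within distance \<open>d / 2\<close> of \<open>x\<close>; the
    summand 1 keeps the denominator positive when both directions vanish.\<close>
  define h where "h = d / (2 * (norm v + norm w + 1))"
  have h: "h > 0" using d(1) by (simp add: h_def add_nonneg_pos)
  have near: "dist (x + s *\<^sub>R v + t *\<^sub>R w) x < d" if "0 \<le> s" "s \<le> h" "0 \<le> t" "t \<le> h" for s t
  proof -
    have "dist (x + s *\<^sub>R v + t *\<^sub>R w) x \<le> s * norm v + t * norm w"
      using norm_triangle_ineq[of "s *\<^sub>R v" "t *\<^sub>R w"] that by (simp add: dist_norm add.assoc)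
    also have "\<dots> \<le> h * norm v + h * norm w"
      using that by (intro add_mono mult_right_mono) auto
    also have "\<dots> \<le> h * (norm v + norm w + 1)"
      using h by (simp add: algebra_simps)
    also have "\<dots> = d / 2"
      using add_nonneg_pos[of "norm v + norm w" 1] by (simp add: h_def divide_simps)
    also have "\<dots> < d" using d by simp
    finally show ?thesis .
  qed
  have sub: "x + s *\<^sub>R v + t *\<^sub>R w \<in> S" "x + t *\<^sub>R w + s *\<^sub>R v \<in> S"
    if "0 \<le> s" "s \<le> h" "0 \<le> t" "t \<le> h" for s t
  proof -
    show "x + s *\<^sub>R v + t *\<^sub>R w \<in> S"
      using near[OF that] d d3(2) by (auto simp: dist_commute)
    then show "x + t *\<^sub>R w + s *\<^sub>R v \<in> S" by (simp add: add_ac)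
  qed
  obtain s t where 1: "0 < s" "s < h" "0 < t" "t < h"
    "f (x + h *\<^sub>R v + h *\<^sub>R w) - f (x + h *\<^sub>R v) - f (x + h *\<^sub>R w) + f x =
      h * h * ?A (x + s *\<^sub>R v + t *\<^sub>R w)"
    using second_difference[OF f h sub(1)] by blast
  obtain s' t' where 2: "0 < s'" "s' < h" "0 < t'" "t' < h"
    "f (x + h *\<^sub>R w + h *\<^sub>R v) - f (x + h *\<^sub>R w) - f (x + h *\<^sub>R v) + f x =
      h * h * ?B (x + s' *\<^sub>R w + t' *\<^sub>R v)"
    using second_difference[OF f h sub(2)] by blast
  have "h * h * ?A (x + s *\<^sub>R v + t *\<^sub>R w) = h * h * ?B (x + s' *\<^sub>R w + t' *\<^sub>R v)"
    unfolding 1(5)[symmetric] 2(5)[symmetric] by (simp add: algebra_simps)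
  then have eq: "?A (x + s *\<^sub>R v + t *\<^sub>R w) = ?B (x + s' *\<^sub>R w + t' *\<^sub>R v)"
    using h by simp
  have A: "dist (?A (x + s *\<^sub>R v + t *\<^sub>R w)) (?A x) < e"
    using near[of s t] 1 d by (intro d1(2)) auto
  have B: "dist (?B (x + s' *\<^sub>R w + t' *\<^sub>R v)) (?B x) < e"
    using near[of t' s'] 2 d by (intro d2(2)) (auto simp: add_ac)
  have tri: "\<bar>a - b\<bar> < 2 * e"
    if "a' = b'" "dist a' a < e" "dist b' b < e" for a a' b b' :: real
    using that by (simp add: dist_real_def)
  have "\<bar>?A x - ?B x\<bar> < 2 * e"
    by (rule tri[OF eq A B])
  then show False by (simp add: e_def)
qed

lemma dird_bounded_linear:
  assumes "bounded_linear L" "smooth_on S f" "x \<in> S"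
  shows "dird v (\<lambda>x. L (f x)) x = L (dird v f x)"
  using has_derivative_frechetD[OF bounded_linear.has_derivative[OF assms(1)
        smooth_on_has_derivative[OF assms(2,3)]]] by (rule fun_cong)

lemma dird_commute:
  fixes f :: "'a::euclidean_space \<Rightarrow> 'b::euclidean_space"
  assumes S: "open S" and x: "x \<in> S" and f: "smooth_on S f"
  shows "dird v (dird w f) x = dird w (dird v f) x"
proof (rule euclidean_eqI)
  fix b :: 'b
  have L: "bounded_linear (\<lambda>x. x \<bullet> b)" by (rule bounded_linear_inner_left)
  have "dird v (dird w f) x \<bullet> b = dird v (dird w (\<lambda>x. f x \<bullet> b)) x" for v w
  proof -
    have "dird v (dird w f) x \<bullet> b = dird v (\<lambda>x. dird w f x \<bullet> b) x"
      using dird_bounded_linear[OF L smooth_on_dird[OF f] x] by simp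
    also have "\<dots> = dird v (dird w (\<lambda>x. f x \<bullet> b)) x"
      using frechet_derivative_cong_open[OF S x, of "\<lambda>x. dird w f x \<bullet> b" "dird w (\<lambda>x. f x \<bullet> b)"]
        dird_bounded_linear[OF L f] by simp
    finally show ?thesis .
  qed
  then show "dird v (dird w f) x \<bullet> b = dird w (dird v f) x \<bullet> b"
    using dird_commute_real[OF S x smooth_on_bounded_linear[OF L S f]] by simp
qed

section \<open>Connection and curvature along a map\<close>

definition complexify :: "real^'n \<Rightarrow> complex^'n" where
  "complexify x = (\<chi> i. complex_of_real (x $ i))"

text \<open>Bilinear and not sesquilinear, in agreement with \<open>riem_complex\<close>; conjugates
  are written explicitly with \<open>cnj_vec\<close>.\<close>

definition bil :: "('n::finite \<Rightarrow> 'n \<Rightarrow> real) \<Rightarrow> complex^'n \<Rightarrow> complex^'n \<Rightarrow> complex" where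
  "bil T a b = (\<Sum>j\<in>UNIV. \<Sum>k\<in>UNIV. complex_of_real (T j k) * a $ j * b $ k)"

lemma axis_nth: "axis i a $ j = (if j = i then a else 0)"
  by (simp add: axis_def)

lemma sum_sum_delta:
  fixes f :: "'n::finite \<Rightarrow> 'm::finite \<Rightarrow> 'a::comm_monoid_add"
  shows "(\<Sum>p\<in>UNIV. \<Sum>q\<in>UNIV. if p = i then f p q else 0) = (\<Sum>q\<in>UNIV. f i q)"
  by (subst sum.swap) simp

lemma bil_add_left: "bil T (a + b) c = bil T a c + bil T b c"
  by (simp add: bil_def algebra_simps sum.distrib)

lemma bil_add_right: "bil T a (b + c) = bil T a b + bil T a c"
  by (simp add: bil_def algebra_simps sum.distrib)

lemma bil_scale_left: "bil T (r *s a) c = r * bil T a c"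
  by (simp add: bil_def sum_distrib_left algebra_simps)

lemma bil_scale_right: "bil T a (r *s c) = r * bil T a c"
  by (simp add: bil_def sum_distrib_left algebra_simps)

lemma bil_diff_left: "bil T (a - b) c = bil T a c - bil T b c"
  by (simp add: bil_def algebra_simps sum_subtractf)

lemma bil_diff_right: "bil T a (b - c) = bil T a b - bil T a c"
  by (simp add: bil_def algebra_simps sum_subtractf)

lemma bil_zero_left: "bil T 0 c = 0"
  by (simp add: bil_def)

lemma bil_zero_right: "bil T a 0 = 0"
  by (simp add: bil_def)

lemma bil_commute: "(\<And>j k. T j k = T k j) \<Longrightarrow> bil T a b = bil T b a"
  unfolding bil_def by (subst sum.swap) (simp add: mult_ac)

lemma bil_cnj: "cnj (bil T a b) = bil T (cnj_vec a) (cnj_vec b)"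
  by (simp add: bil_def cnj_vec_def)

lemma bil_sum_left: "bil T (\<Sum>i\<in>I. f i) c = (\<Sum>i\<in>I. bil T (f i) c)"
  by (induction I rule: infinite_finite_induct) (simp_all add: bil_zero_left bil_add_left)

lemma bil_sum_right: "bil T a (\<Sum>i\<in>I. f i) = (\<Sum>i\<in>I. bil T a (f i))"
  by (induction I rule: infinite_finite_induct) (simp_all add: bil_zero_right bil_add_right)

lemmas bil_simps = bil_add_left bil_add_right bil_scale_left bil_scale_right
  bil_diff_left bil_diff_right bil_zero_left bil_zero_right

lemma has_derivative_bil:
  assumes "\<And>j k. ((\<lambda>x. T x j k) has_derivative T' j k) (at x)"
    and "(A has_derivative A') (at x)" "(B has_derivative B') (at x)"
  shows "((\<lambda>x. bil (T x) (A x) (B x)) has_derivative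
    (\<lambda>v. bil (\<lambda>j k. T' j k v) (A x) (B x) + bil (T x) (A' v) (B x) + bil (T x) (A x) (B' v))) (at x)"
proof -
  have A: "((\<lambda>x. A x $ j) has_derivative (\<lambda>v. A' v $ j)) (at x)" for j
    by (rule bounded_linear.has_derivative[OF bounded_linear_vec_nth assms(2)])
  have B: "((\<lambda>x. B x $ j) has_derivative (\<lambda>v. B' v $ j)) (at x)" for j
    by (rule bounded_linear.has_derivative[OF bounded_linear_vec_nth assms(3)])
  have T: "((\<lambda>x. complex_of_real (T x j k)) has_derivative (\<lambda>v. complex_of_real (T' j k v))) (at x)" for j k
    by (rule bounded_linear.has_derivative[OF bounded_linear_of_real assms(1)])
  have "((\<lambda>x. bil (T x) (A x) (B x)) has_derivative
    (\<lambda>v. \<Sum>j\<in>UNIV. \<Sum>k\<in>UNIV. (of_real (T x j k) * A x $ j) * B' v $ k +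
      (of_real (T x j k) * A' v $ j + of_real (T' j k v) * A x $ j) * B x $ k)) (at x)"
    unfolding bil_def
    by (intro has_derivative_sum has_derivative_mult A B T)
  moreover have "(\<lambda>v. \<Sum>j\<in>UNIV. \<Sum>k\<in>UNIV. (of_real (T x j k) * A x $ j) * B' v $ k +
      (of_real (T x j k) * A' v $ j + of_real (T' j k v) * A x $ j) * B x $ k) =
    (\<lambda>v. bil (\<lambda>j k. T' j k v) (A x) (B x) + bil (T x) (A' v) (B x) + bil (T x) (A x) (B' v))"
    by (simp add: bil_def sum.distrib algebra_simps)
  ultimately show ?thesis by simp
qed

lemma smooth_on_bil:
  assumes S: "open S" and "\<And>j k. smooth_on S (\<lambda>x. T x j k)" "smooth_on S A" "smooth_on S B"
  shows "smooth_on S (\<lambda>x. bil (T x) (A x) (B x))"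
proof -
  have "smooth_on S (\<lambda>x. complex_of_real (T x j k) * A x $ j * B x $ k)" for j k
    by (rule smooth_on_mult[OF S smooth_on_mult[OF S]])
      (rule smooth_on_bounded_linear[OF bounded_linear_of_real S assms(2)]
        smooth_on_component[OF S assms(3)] smooth_on_component[OF S assms(4)])+
  then show ?thesis
    unfolding bil_def by (intro smooth_on_sum[OF S])
qed

lemma bounded_linear_complexify: "bounded_linear complexify"
proof -
  have "linear (complexify :: real^'n \<Rightarrow> complex^'n)"
    by (rule linearI) (simp_all add: complexify_def vec_eq_iff complex_eq_iff)
  then show ?thesis by (simp only: linear_conv_bounded_linear)
qed

lemma bounded_linear_scale: "bounded_linear (\<lambda>x::complex^'n. r *s x)"
proof -
  have "linear (\<lambda>x::complex^'n. r *s x)"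
    by (rule linearI) (simp_all add: vec_eq_iff scaleR_conv_of_real algebra_simps)
  then show ?thesis by (simp only: linear_conv_bounded_linear)
qed

section \<open>Christoffel symbols and curvature on complex vectors\<close>

definition Gam :: "(real^'n \<Rightarrow> real^'n^'n) \<Rightarrow> real^'n \<Rightarrow> complex^'n \<Rightarrow> complex^'n \<Rightarrow> complex^'n" where
  "Gam G y a b = (\<chi> i. bil (christoffel G y i) a b)"

definition dGam ::
  "(real^'n \<Rightarrow> real^'n^'n) \<Rightarrow> real^'n \<Rightarrow> complex^'n \<Rightarrow> complex^'n \<Rightarrow> complex^'n \<Rightarrow> complex^'n" where
  "dGam G y a b c =
     (\<chi> m. \<Sum>i\<in>UNIV. a $ i * bil (\<lambda>j k. pd i (\<lambda>y. christoffel G y m j k) y) b c)"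

text \<open>The coordinate formula of the curvature operator: for fields with constant components
  the Lie bracket vanishes, and only derivatives and products of Christoffel symbols remain.\<close>

definition RC ::
  "(real^'n \<Rightarrow> real^'n^'n) \<Rightarrow> real^'n \<Rightarrow> complex^'n \<Rightarrow> complex^'n \<Rightarrow> complex^'n \<Rightarrow> complex^'n" where
  "RC G y a b c =
     dGam G y a b c - dGam G y b a c + Gam G y a (Gam G y b c) - Gam G y b (Gam G y a c)"

abbreviation gC :: "real^'n^'n \<Rightarrow> complex^'n \<Rightarrow> complex^'n \<Rightarrow> complex" where
  "gC M \<equiv> bil (\<lambda>i j. M $ i $ j)"

lemma RC_swap: "RC G y a b c = - RC G y b a c"
  by (simp add: RC_def)

lemma Gam_linear:
  "Gam G y (a + b) c = Gam G y a c + Gam G y b c"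
  "Gam G y a (b + c) = Gam G y a b + Gam G y a c"
  "Gam G y (r *s a) c = r *s Gam G y a c"
  "Gam G y a (r *s c) = r *s Gam G y a c"
  by (simp_all add: Gam_def vec_eq_iff bil_simps)

lemma dGam_linear:
  "dGam G y (a + b) c d = dGam G y a c d + dGam G y b c d"
  "dGam G y a (b + c) d = dGam G y a b d + dGam G y a c d"
  "dGam G y a b (c + d) = dGam G y a b c + dGam G y a b d"
  "dGam G y (r *s a) c d = r *s dGam G y a c d"
  "dGam G y a (r *s c) d = r *s dGam G y a c d"
  "dGam G y a c (r *s d) = r *s dGam G y a c d"
  by (simp_all add: dGam_def vec_eq_iff bil_simps sum.distrib sum_distrib_left algebra_simps)

lemma RC_linear:
  "RC G y (a + b) c d = RC G y a c d + RC G y b c d"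
  "RC G y a (b + c) d = RC G y a b d + RC G y a c d"
  "RC G y a b (c + d) = RC G y a b c + RC G y a b d"
  "RC G y (r *s a) c d = r *s RC G y a c d"
  "RC G y a (r *s c) d = r *s RC G y a c d"
  "RC G y a c (r *s d) = r *s RC G y a c d"
  by (simp_all add: RC_def Gam_linear dGam_linear vec_eq_iff algebra_simps)

lemma curvature_op_axis:
  fixes G :: "real^'n \<Rightarrow> real^'n^'n"
  shows "complexify (curvature_op G (\<lambda>_. axis i 1) (\<lambda>_. axis j 1) (\<lambda>_. axis k 1) y) =
     RC G y (axis i 1) (axis j 1) (axis k 1)"
proof -
  have const: "frechet_derivative (\<lambda>_. c) (at y) = (\<lambda>_. 0)" for c :: "'b::real_normed_vector" and y :: "real^'n"
    by (rule has_derivative_frechetD) simp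
  have n1: "nabla G (\<lambda>_. axis j 1) (\<lambda>_. axis k 1) = (\<lambda>y. \<chi> m. christoffel G y m j k)" for j k
    by (simp add: nabla_def const axis_nth mult_delta_left mult_delta_right)
  have n2: "nabla G (\<lambda>_. axis i 1) (\<lambda>y. \<chi> m. christoffel G y m j k) y =
      (\<chi> m. pd i (\<lambda>y. christoffel G y m j k) y + (\<Sum>q\<in>UNIV. christoffel G y m i q * christoffel G y q j k))" for i j k
    by (simp add: nabla_def pd_def axis_nth mult_delta_left mult_delta_right sum_sum_delta vec_eq_iff)
  have n0: "nabla G (lie_bracket (\<lambda>_. axis i 1) (\<lambda>_. axis j 1)) (\<lambda>_. axis k 1) y = 0"
    by (simp add: nabla_def lie_bracket_def const vec_eq_iff)
  have g1: "bil T (axis j 1) (axis k 1) = of_real (T j k)" for T :: "'n \<Rightarrow> 'n \<Rightarrow> real" and j k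
    by (simp add: bil_def axis_nth mult_delta_left mult_delta_right)
  have g2: "bil T (axis j 1) c = (\<Sum>k\<in>UNIV. of_real (T j k) * c $ k)" for T :: "'n \<Rightarrow> 'n \<Rightarrow> real" and j c
    by (simp add: bil_def axis_nth mult_delta_left mult_delta_right sum_sum_delta)
  have g3: "(\<Sum>p\<in>UNIV. axis i (1::complex) $ p * f p) = f i" for f i
    by (simp add: axis_nth mult_delta_left mult_delta_right)
  show ?thesis
    by (simp add: vec_eq_iff complexify_def curvature_op_def n0 n1 n2 RC_def dGam_def Gam_def g1 g2 g3 axis_nth mult_delta_left mult_delta_right)
qed

lemma RC_sum:
  "RC G y (\<Sum>i\<in>I. f i) b c = (\<Sum>i\<in>I. RC G y (f i) b c)"
  "RC G y a (\<Sum>i\<in>I. f i) c = (\<Sum>i\<in>I. RC G y a (f i) c)"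
  "RC G y a b (\<Sum>i\<in>I. f i) = (\<Sum>i\<in>I. RC G y a b (f i))"
proof -
  have z: "RC G y 0 b c = 0" "RC G y a 0 c = 0" "RC G y a b 0 = 0" for a b c
    using RC_linear(4)[of G y 0 0 b c] RC_linear(5)[of G y a 0 0 c] RC_linear(6)[of G y a b 0 0]
    by simp_all
  show "RC G y (\<Sum>i\<in>I. f i) b c = (\<Sum>i\<in>I. RC G y (f i) b c)"
    "RC G y a (\<Sum>i\<in>I. f i) c = (\<Sum>i\<in>I. RC G y a (f i) c)"
    "RC G y a b (\<Sum>i\<in>I. f i) = (\<Sum>i\<in>I. RC G y a b (f i))"
    by (induction I rule: infinite_finite_induct; simp add: z RC_linear)+
qed

text \<open>Both sides are complex multilinear, so it suffices to compare them on coordinate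
  vectors, where \<open>curvature_op_axis\<close> applies.\<close>

lemma gC_RC: "gC (G y) (RC G y a b c) d = riem_complex G y a b c d"
proof -
  have ax: "gC M x (axis l 1) = (\<Sum>m\<in>UNIV. of_real (M $ m $ l) * x $ m)" for M :: "real^'n^'n" and x l
    unfolding bil_def by (simp add: axis_nth mult_delta_left mult_delta_right)
  have riem: "complex_of_real (riem G y (axis i 1) (axis j 1) (axis k 1) (axis l 1)) =
      gC (G y) (RC G y (axis i 1) (axis j 1) (axis k 1)) (axis l 1)" for i j k l
    unfolding curvature_op_axis[symmetric] ax riem_def gform_def
    by (simp add: complexify_def axis_nth mult_delta_left mult_delta_right)
  have "gC (G y) (RC G y a b c) d =
      gC (G y) (RC G y (\<Sum>i\<in>UNIV. a $ i *s axis i 1) (\<Sum>j\<in>UNIV. b $ j *s axis j 1)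
        (\<Sum>k\<in>UNIV. c $ k *s axis k 1)) (\<Sum>l\<in>UNIV. d $ l *s axis l 1)"
    by (simp only: basis_expansion)
  also have "\<dots> = riem_complex G y a b c d"
    unfolding riem_complex_def riem
    \<comment> \<open>Opening one argument at a time keeps the sums nested in the order of
      \<open>riem_complex_def\<close>.\<close>
    unfolding RC_sum(1) bil_sum_left
    unfolding RC_sum(2) bil_sum_left
    unfolding RC_sum(3) bil_sum_left
    unfolding bil_sum_right RC_linear bil_simps
    by (simp add: mult_ac)
  finally show ?thesis .
qed

section \<open>The Levi-Civita connection in one chart\<close>

locale metric_chart =
  fixes V :: "(real^'n) set" and G :: "real^'n \<Rightarrow> real^'n^'n"
  assumes open_V: "open V" and smooth_G: "smooth_on V G"
    and sym_G: "y \<in> V \<Longrightarrow> G y $ i $ j = G y $ j $ i"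
    and pos_G: "y \<in> V \<Longrightarrow> v \<noteq> 0 \<Longrightarrow> gform (G y) v v > 0"
begin

lemma invertible_G:
  assumes "y \<in> V"
  shows "invertible (G y)"
proof -
  have "v = 0" if "G y *v v = 0" for v
  proof (rule ccontr)
    assume "v \<noteq> 0"
    have "gform (G y) v v = v \<bullet> (G y *v v)"
      by (simp add: gform_def matrix_vector_mult_def inner_vec_def sum_distrib_left mult_ac)
    then show False using pos_G[OF assms \<open>v \<noteq> 0\<close>] that by simp
  qed
  then show ?thesis
    by (simp add: invertible_left_inverse matrix_left_invertible_ker)
qed

lemma smooth_G_component: "smooth_on V (\<lambda>y. G y $ i $ j)"
  by (intro smooth_on_component[OF open_V] smooth_G)

lemma smooth_christoffel: "smooth_on V (\<lambda>y. christoffel G y i j k)"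
proof -
  have d: "smooth_on V (\<lambda>y. dird v (\<lambda>x. G x $ r $ s) y)" for v r s
    by (rule smooth_on_dird[OF smooth_G_component])
  have "smooth_on V (\<lambda>y. matrix_inv (G y) $ i $ l *
      (dird (axis j 1) (\<lambda>x. G x $ k $ l) y + dird (axis k 1) (\<lambda>x. G x $ j $ l) y
        - dird (axis l 1) (\<lambda>x. G x $ j $ k) y))" for l
    by (rule smooth_on_mult[OF open_V smooth_on_matrix_inv[OF open_V smooth_G invertible_G]
        smooth_on_diff[OF open_V smooth_on_add[OF open_V d d] d]])
  then have "smooth_on V (\<lambda>y. (\<Sum>l\<in>UNIV. matrix_inv (G y) $ i $ l *
      (dird (axis j 1) (\<lambda>x. G x $ k $ l) y + dird (axis k 1) (\<lambda>x. G x $ j $ l) y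
        - dird (axis l 1) (\<lambda>x. G x $ j $ k) y)) * inverse 2)"
    by (intro smooth_on_mult[OF open_V smooth_on_sum[OF open_V] smooth_on_const])
  then show ?thesis
    unfolding christoffel_def pd_def divide_inverse .
qed

lemma pd_G_commute: "y \<in> V \<Longrightarrow> pd l (\<lambda>x. G x $ j $ k) y = pd l (\<lambda>x. G x $ k $ j) y"
  unfolding pd_def by (rule fun_cong[OF frechet_derivative_cong_open[OF open_V]]) (simp_all add: sym_G[of _ j k])

lemma christoffel_commute: "y \<in> V \<Longrightarrow> christoffel G y i j k = christoffel G y i k j"
  unfolding christoffel_def by (simp add: pd_G_commute[of y _ j k] add.commute)

lemma Gam_commute: "y \<in> V \<Longrightarrow> Gam G y a b = Gam G y b a"
  unfolding Gam_def using bil_commute[of "christoffel G y _"] christoffel_commute by (simp add: vec_eq_iff)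

lemma gC_commute: "y \<in> V \<Longrightarrow> gC (G y) a b = gC (G y) b a"
  using sym_G by (intro bil_commute)

text \<open>Lowering the upper index cancels the inverse matrix in \<open>christoffel\<close> and
  leaves the Koszul formula for coordinate fields.\<close>

lemma lowered_christoffel:
  assumes y: "y \<in> V"
  shows "(\<Sum>m\<in>UNIV. G y $ m $ l * christoffel G y m j k) =
    (pd j (\<lambda>x. G x $ k $ l) y + pd k (\<lambda>x. G x $ j $ l) y - pd l (\<lambda>x. G x $ j $ k) y) / 2"
proof -
  let ?c = "\<lambda>l. pd j (\<lambda>x. G x $ k $ l) y + pd k (\<lambda>x. G x $ j $ l) y - pd l (\<lambda>x. G x $ j $ k) y"
  have inv: "(\<Sum>m\<in>UNIV. G y $ l $ m * matrix_inv (G y) $ m $ r) = (if l = r then 1 else 0)" for r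
    using matrix_inv_right[OF invertible_G[OF y]]
    by (simp add: vec_eq_iff matrix_matrix_mult_def mat_def)
  have "(\<Sum>m\<in>UNIV. G y $ m $ l * christoffel G y m j k) =
      (\<Sum>m\<in>UNIV. \<Sum>r\<in>UNIV. (G y $ l $ m * matrix_inv (G y) $ m $ r) * ?c r) / 2"
    unfolding christoffel_def sym_G[OF y, of _ l]
    by (simp add: sum_divide_distrib sum_distrib_left mult.assoc)
  also have "\<dots> = (\<Sum>r\<in>UNIV. (\<Sum>m\<in>UNIV. G y $ l $ m * matrix_inv (G y) $ m $ r) * ?c r) / 2"
    by (subst sum.swap) (simp add: sum_distrib_right)
  also have "\<dots> = ?c l / 2"
    unfolding inv by (simp add: mult_delta_left)
  finally show ?thesis .
qed

text \<open>In the sum of the two lowered symbols the derivatives in directions \<open>i\<close> and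
  \<open>j\<close> cancel by the symmetry of \<open>G\<close>. This is the vanishing of the
  covariant derivative of the metric, in components.\<close>

lemma pd_metric:
  assumes y: "y \<in> V"
  shows "pd k (\<lambda>x. G x $ i $ j) y =
    (\<Sum>m\<in>UNIV. G y $ m $ j * christoffel G y m k i) + (\<Sum>m\<in>UNIV. G y $ i $ m * christoffel G y m k j)"
proof -
  have "(\<Sum>m\<in>UNIV. G y $ i $ m * christoffel G y m k j) = (\<Sum>m\<in>UNIV. G y $ m $ i * christoffel G y m k j)"
    using sym_G[OF y] by simp
  then show ?thesis
    unfolding lowered_christoffel[OF y] using pd_G_commute[OF y] by (simp add: field_simps)
qed

lemma metric_compatible:
  assumes y: "y \<in> V"
  shows "bil (\<lambda>i j. dird a (\<lambda>y. G y $ i $ j) y) b c =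
    gC (G y) (Gam G y (complexify a) b) c + gC (G y) b (Gam G y (complexify a) c)"
proof -
  have lin: "dird a (\<lambda>y. G y $ i $ j) y = (\<Sum>k\<in>UNIV. a $ k * pd k (\<lambda>y. G y $ i $ j) y)" for i j
  proof -
    have "linear (\<lambda>v. dird v (\<lambda>y. G y $ i $ j) y)"
      by (rule smooth_on_linear[OF smooth_G_component y])
    then have "dird (\<Sum>k\<in>UNIV. a $ k *\<^sub>R axis k 1) (\<lambda>y. G y $ i $ j) y =
        (\<Sum>k\<in>UNIV. a $ k * pd k (\<lambda>y. G y $ i $ j) y)"
      by (simp add: linear_sum linear_scale pd_def)
    moreover have "(\<Sum>k\<in>UNIV. a $ k *\<^sub>R axis k 1) = a"
      by (simp add: vec_eq_iff axis_nth mult_delta_right)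
    ultimately show ?thesis by simp
  qed
  have 1: "gC (G y) (Gam G y (complexify a) b) c = (\<Sum>i\<in>UNIV. \<Sum>j\<in>UNIV. \<Sum>k\<in>UNIV.
      of_real (\<Sum>m\<in>UNIV. G y $ m $ j * christoffel G y m k i) * of_real (a $ k) * b $ i * c $ j)"
  proof -
    \<comment> \<open>The swaps that follow carry the contracted index \<open>m\<close> to the
      innermost place, where the contraction of \<open>pd_metric\<close> becomes visible.\<close>
    have "gC (G y) (Gam G y (complexify a) b) c = (\<Sum>m\<in>UNIV. \<Sum>j\<in>UNIV. \<Sum>k\<in>UNIV. \<Sum>i\<in>UNIV.
      of_real (G y $ m $ j * christoffel G y m k i) * of_real (a $ k) * b $ i * c $ j)"
      by (simp add: bil_def Gam_def complexify_def sum_distrib_left sum_distrib_right mult_ac)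
    also have "\<dots> = (\<Sum>j\<in>UNIV. \<Sum>m\<in>UNIV. \<Sum>k\<in>UNIV. \<Sum>i\<in>UNIV.
      of_real (G y $ m $ j * christoffel G y m k i) * of_real (a $ k) * b $ i * c $ j)"
      by (rule sum.swap)
    also have "\<dots> = (\<Sum>j\<in>UNIV. \<Sum>k\<in>UNIV. \<Sum>m\<in>UNIV. \<Sum>i\<in>UNIV.
      of_real (G y $ m $ j * christoffel G y m k i) * of_real (a $ k) * b $ i * c $ j)"
      by (rule sum.cong[OF refl], rule sum.swap)
    also have "\<dots> = (\<Sum>j\<in>UNIV. \<Sum>k\<in>UNIV. \<Sum>i\<in>UNIV. \<Sum>m\<in>UNIV.
      of_real (G y $ m $ j * christoffel G y m k i) * of_real (a $ k) * b $ i * c $ j)"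
      by (rule sum.cong[OF refl], rule sum.cong[OF refl], rule sum.swap)
    also have "\<dots> = (\<Sum>j\<in>UNIV. \<Sum>i\<in>UNIV. \<Sum>k\<in>UNIV. \<Sum>m\<in>UNIV.
      of_real (G y $ m $ j * christoffel G y m k i) * of_real (a $ k) * b $ i * c $ j)"
      by (rule sum.cong[OF refl], rule sum.swap)
    also have "\<dots> = (\<Sum>i\<in>UNIV. \<Sum>j\<in>UNIV. \<Sum>k\<in>UNIV. \<Sum>m\<in>UNIV.
      of_real (G y $ m $ j * christoffel G y m k i) * of_real (a $ k) * b $ i * c $ j)"
      by (rule sum.swap)
    finally show ?thesis
      by (simp add: sum_distrib_right)
  qed
  have 2: "gC (G y) b (Gam G y (complexify a) c) = (\<Sum>i\<in>UNIV. \<Sum>j\<in>UNIV. \<Sum>k\<in>UNIV.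
      of_real (\<Sum>m\<in>UNIV. G y $ i $ m * christoffel G y m k j) * of_real (a $ k) * b $ i * c $ j)"
  proof -
    have "gC (G y) b (Gam G y (complexify a) c) = (\<Sum>i\<in>UNIV. \<Sum>m\<in>UNIV. \<Sum>k\<in>UNIV. \<Sum>j\<in>UNIV.
      of_real (G y $ i $ m * christoffel G y m k j) * of_real (a $ k) * b $ i * c $ j)"
      by (simp add: bil_def Gam_def complexify_def sum_distrib_left sum_distrib_right mult_ac)
    also have "\<dots> = (\<Sum>i\<in>UNIV. \<Sum>k\<in>UNIV. \<Sum>m\<in>UNIV. \<Sum>j\<in>UNIV.
      of_real (G y $ i $ m * christoffel G y m k j) * of_real (a $ k) * b $ i * c $ j)"
      by (rule sum.cong[OF refl], rule sum.swap)
    also have "\<dots> = (\<Sum>i\<in>UNIV. \<Sum>k\<in>UNIV. \<Sum>j\<in>UNIV. \<Sum>m\<in>UNIV.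
      of_real (G y $ i $ m * christoffel G y m k j) * of_real (a $ k) * b $ i * c $ j)"
      by (rule sum.cong[OF refl], rule sum.cong[OF refl], rule sum.swap)
    also have "\<dots> = (\<Sum>i\<in>UNIV. \<Sum>j\<in>UNIV. \<Sum>k\<in>UNIV. \<Sum>m\<in>UNIV.
      of_real (G y $ i $ m * christoffel G y m k j) * of_real (a $ k) * b $ i * c $ j)"
      by (rule sum.cong[OF refl], rule sum.swap)
    finally show ?thesis
      by (simp add: sum_distrib_right)
  qed
  have "bil (\<lambda>i j. dird a (\<lambda>y. G y $ i $ j) y) b c = (\<Sum>i\<in>UNIV. \<Sum>j\<in>UNIV. \<Sum>k\<in>UNIV.
      of_real (pd k (\<lambda>y. G y $ i $ j) y) * of_real (a $ k) * b $ i * c $ j)"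
    unfolding bil_def lin by (simp add: sum_distrib_left sum_distrib_right mult_ac)
  then show ?thesis
    unfolding 1 2 pd_metric[OF y] by (simp add: sum.distrib algebra_simps)
qed

lemma dird_christoffel:
  assumes y: "y \<in> V"
  shows "(\<chi> m. bil (\<lambda>j k. dird a (\<lambda>y. christoffel G y m j k) y) b c) = dGam G y (complexify a) b c"
proof -
  have lin: "dird a (\<lambda>y. christoffel G y m i j) y = (\<Sum>k\<in>UNIV. a $ k * pd k (\<lambda>y. christoffel G y m i j) y)" for m i j
  proof -
    have "linear (\<lambda>v. dird v (\<lambda>y. christoffel G y m i j) y)"
      by (rule smooth_on_linear[OF smooth_christoffel y])
    then have "dird (\<Sum>k\<in>UNIV. a $ k *\<^sub>R axis k 1) (\<lambda>y. christoffel G y m i j) y =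
        (\<Sum>k\<in>UNIV. a $ k * pd k (\<lambda>y. christoffel G y m i j) y)"
      by (simp add: linear_sum linear_scale pd_def)
    moreover have "(\<Sum>k\<in>UNIV. a $ k *\<^sub>R axis k 1) = a"
      by (simp add: vec_eq_iff axis_nth mult_delta_right)
    ultimately show ?thesis by simp
  qed
  have "bil (\<lambda>j k. \<Sum>i\<in>UNIV. a $ i * T i j k) b c = (\<Sum>i\<in>UNIV. of_real (a $ i) * bil (T i) b c)"
    for T :: "'n \<Rightarrow> 'n \<Rightarrow> 'n \<Rightarrow> real"
  proof -
    have "bil (\<lambda>j k. \<Sum>i\<in>UNIV. a $ i * T i j k) b c =
        (\<Sum>j\<in>UNIV. \<Sum>k\<in>UNIV. \<Sum>i\<in>UNIV. of_real (a $ i) * of_real (T i j k) * b $ j * c $ k)"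
      by (simp add: bil_def sum_distrib_left sum_distrib_right mult_ac)
    also have "\<dots> = (\<Sum>j\<in>UNIV. \<Sum>i\<in>UNIV. \<Sum>k\<in>UNIV. of_real (a $ i) * of_real (T i j k) * b $ j * c $ k)"
      by (rule sum.cong[OF refl], rule sum.swap)
    also have "\<dots> = (\<Sum>i\<in>UNIV. \<Sum>j\<in>UNIV. \<Sum>k\<in>UNIV. of_real (a $ i) * of_real (T i j k) * b $ j * c $ k)"
      by (rule sum.swap)
    finally show ?thesis by (simp add: bil_def sum_distrib_left mult_ac)
  qed
  then show ?thesis
    by (simp add: dGam_def vec_eq_iff lin complexify_def)
qed

end

text \<open>A pair \<open>(v, w)\<close> of directions stands for the complex direction \<open>v + \<i> w\<close> in the
  complexified tangent space.\<close>

definition dC :: "'a::real_normed_vector \<times> 'a \<Rightarrow> ('a \<Rightarrow> complex) \<Rightarrow> 'a \<Rightarrow> complex" where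
  "dC \<xi> u x = dird (fst \<xi>) u x + \<i> * dird (snd \<xi>) u x"

text \<open>The differential of \<open>F\<close>, extended complex linearly.\<close>

definition FC :: "('a::real_normed_vector \<Rightarrow> real^'n) \<Rightarrow> 'a \<times> 'a \<Rightarrow> 'a \<Rightarrow> complex^'n" where
  "FC F \<xi> x = complexify (dird (fst \<xi>) F x) + \<i> *s complexify (dird (snd \<xi>) F x)"

text \<open>The connection induced on the pullback along \<open>F\<close> of the complexified
  tangent bundle, for a constant direction in the domain.\<close>

definition covd ::
  "(real^'n \<Rightarrow> real^'n^'n) \<Rightarrow> ('a::real_normed_vector \<Rightarrow> real^'n) \<Rightarrow> 'a \<Rightarrow> ('a \<Rightarrow> complex^'n) \<Rightarrow>
    'a \<Rightarrow> complex^'n" where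
  "covd G F v Y x = dird v Y x + Gam G (F x) (complexify (dird v F x)) (Y x)"

definition covC ::
  "(real^'n \<Rightarrow> real^'n^'n) \<Rightarrow> ('a::real_normed_vector \<Rightarrow> real^'n) \<Rightarrow> 'a \<times> 'a \<Rightarrow>
    ('a \<Rightarrow> complex^'n) \<Rightarrow> 'a \<Rightarrow> complex^'n" where
  "covC G F \<xi> Y x = covd G F (fst \<xi>) Y x + \<i> *s covd G F (snd \<xi>) Y x"

definition conj_dir :: "'a \<times> 'a \<Rightarrow> 'a \<times> 'a::real_normed_vector" where
  "conj_dir \<xi> = (fst \<xi>, - snd \<xi>)"

lemma has_derivative_vec:
  fixes f :: "'a::real_normed_vector \<Rightarrow> 'b::euclidean_space^'n"
  assumes "\<And>i. ((\<lambda>x. f x $ i) has_derivative (\<lambda>v. f' v $ i)) (at x)"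
  shows "(f has_derivative f') (at x)"
proof -
  have e: "(\<Sum>i\<in>UNIV. axis i (y $ i)) = y" for y :: "'b^'n"
    by (simp add: vec_eq_iff axis_nth)
  have "((\<lambda>x. \<Sum>i\<in>UNIV. axis i (f x $ i)) has_derivative (\<lambda>v. \<Sum>i\<in>UNIV. axis i (f' v $ i))) (at x)"
    by (rule has_derivative_sum, rule bounded_linear.has_derivative[OF bounded_linear_axis assms])
  then show ?thesis by (simp only: e)
qed

section \<open>The pullback connection along a map\<close>

locale map_chart = metric_chart V G for V :: "(real^'n) set" and G +
  fixes U :: "'a::euclidean_space set" and F :: "'a \<Rightarrow> real^'n"
  assumes open_U: "open U" and smooth_F: "smooth_on U F" and F_in: "x \<in> U \<Longrightarrow> F x \<in> V"
begin

lemma F_image: "F ` U \<subseteq> V"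
  using F_in by blast

lemmas smooth_comp = smooth_on_compose[OF open_U open_V F_image smooth_F]

lemma smooth_FC: "smooth_on U (\<lambda>x. FC F \<xi> x)"
  unfolding FC_def
  by (rule smooth_on_add[OF open_U smooth_on_bounded_linear[OF bounded_linear_complexify open_U smooth_on_dird[OF smooth_F]]
      smooth_on_bounded_linear[OF bounded_linear_scale open_U smooth_on_bounded_linear[OF bounded_linear_complexify open_U smooth_on_dird[OF smooth_F]]]])

lemma smooth_Gam:
  assumes "smooth_on U A" "smooth_on U B"
  shows "smooth_on U (\<lambda>x. Gam G (F x) (A x) (B x))"
proof (rule smooth_on_vec[OF open_U])
  show "smooth_on U (\<lambda>x. Gam G (F x) (A x) (B x) $ i)" for i
    unfolding Gam_def vec_lambda_beta
    by (rule smooth_on_bil[OF open_U smooth_comp[OF smooth_christoffel] assms])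
qed

lemma smooth_gC:
  assumes "smooth_on U A" "smooth_on U B"
  shows "smooth_on U (\<lambda>x. gC (G (F x)) (A x) (B x))"
  by (rule smooth_on_bil[OF open_U smooth_comp[OF smooth_G_component] assms])

lemma smooth_covd: "smooth_on U Y \<Longrightarrow> smooth_on U (\<lambda>x. covd G F v Y x)"
  unfolding covd_def
  by (rule smooth_on_add[OF open_U smooth_on_dird smooth_Gam[OF smooth_on_bounded_linear[OF
            bounded_linear_complexify open_U smooth_on_dird[OF smooth_F]]]])

lemma smooth_covC: "smooth_on U Y \<Longrightarrow> smooth_on U (\<lambda>x. covC G F \<xi> Y x)"
  unfolding covC_def
  by (rule smooth_on_add[OF open_U smooth_covd smooth_on_bounded_linear[OF bounded_linear_scale open_U smooth_covd]])

lemma dC_cong: "x \<in> U \<Longrightarrow> (\<And>y. y \<in> U \<Longrightarrow> u y = w y) \<Longrightarrow> dC \<xi> u x = dC \<xi> w x"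
  unfolding dC_def using frechet_derivative_cong_open[OF open_U, of x u w] by simp

lemma covC_cong: "x \<in> U \<Longrightarrow> (\<And>y. y \<in> U \<Longrightarrow> Y y = Z y) \<Longrightarrow> covC G F \<xi> Y x = covC G F \<xi> Z x"
  unfolding covC_def covd_def using frechet_derivative_cong_open[OF open_U, of x Y Z] by simp

lemma dird_add:
  fixes Y Z :: "'a \<Rightarrow> 'b::real_normed_vector"
  assumes "smooth_on U Y" "smooth_on U Z" "x \<in> U"
  shows "dird v (\<lambda>x. Y x + Z x) x = dird v Y x + dird v Z x"
  by (rule fun_cong[OF has_derivative_frechetD[OF has_derivative_add[OF
            smooth_on_has_derivative[OF assms(1,3)] smooth_on_has_derivative[OF assms(2,3)]]]])

lemma dird_minus:
  "smooth_on U Y \<Longrightarrow> x \<in> U \<Longrightarrow> dird (- v) Y x = - dird v Y x"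
  using linear_neg[OF smooth_on_linear] .

lemma dC_diff:
  assumes "smooth_on U Y" "smooth_on U Z" "x \<in> U"
  shows "dC \<xi> (\<lambda>x. Y x - Z x) x = dC \<xi> Y x - dC \<xi> Z x"
proof -
  have d: "dird v (\<lambda>x. Y x - Z x) x = dird v Y x - dird v Z x" for v
    by (rule fun_cong[OF has_derivative_frechetD[OF has_derivative_diff[OF
            smooth_on_has_derivative[OF assms(1,3)] smooth_on_has_derivative[OF assms(2,3)]]]])
  show ?thesis unfolding dC_def d by (simp add: algebra_simps)
qed

lemma covd_add:
  assumes "smooth_on U Y" "smooth_on U Z" "x \<in> U"
  shows "covd G F v (\<lambda>x. Y x + r *s Z x) x = covd G F v Y x + r *s covd G F v Z x"
  unfolding covd_def
    dird_add[OF assms(1) smooth_on_bounded_linear[OF bounded_linear_scale open_U assms(2)] assms(3)]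
    dird_bounded_linear[OF bounded_linear_scale assms(2,3)]
  by (simp add: Gam_linear vec_eq_iff algebra_simps)

lemma covC_zero: "x \<in> U \<Longrightarrow> covC G F \<xi> (\<lambda>_. 0) x = 0"
proof -
  have "frechet_derivative (\<lambda>_. 0::complex^'n) (at x) = (\<lambda>_. 0)"
    by (rule has_derivative_frechetD) simp
  moreover have "Gam G y a 0 = 0" for y a
    by (simp add: Gam_def vec_eq_iff bil_simps)
  ultimately show ?thesis
    by (simp add: covC_def covd_def vec_eq_iff)
qed

lemma dird_gC:
  assumes Y: "smooth_on U Y" and Z: "smooth_on U Z" and x: "x \<in> U"
  shows "dird v (\<lambda>x. gC (G (F x)) (Y x) (Z x)) x =
    gC (G (F x)) (covd G F v Y x) (Z x) + gC (G (F x)) (Y x) (covd G F v Z x)"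
proof -
  have T: "((\<lambda>x. G (F x) $ i $ j) has_derivative (\<lambda>v. dird (dird v F x) (\<lambda>y. G y $ i $ j) (F x))) (at x)" for i j
    by (rule has_derivative_compose[OF smooth_on_has_derivative[OF smooth_F x]
          smooth_on_has_derivative[OF smooth_G_component F_in[OF x]]])
  show ?thesis
    unfolding has_derivative_frechetD[OF has_derivative_bil[of "\<lambda>x i j. G (F x) $ i $ j", OF T
        smooth_on_has_derivative[OF Y x] smooth_on_has_derivative[OF Z x]]]
    unfolding metric_compatible[OF F_in[OF x]] covd_def bil_simps
    by simp
qed

lemma dC_gC:
  assumes Y: "smooth_on U Y" and Z: "smooth_on U Z" and x: "x \<in> U"
  shows "dC \<xi> (\<lambda>x. gC (G (F x)) (Y x) (Z x)) x =
    gC (G (F x)) (covC G F \<xi> Y x) (Z x) + gC (G (F x)) (Y x) (covC G F \<xi> Z x)"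
  unfolding dC_def dird_gC[OF assms] covC_def bil_simps by (simp add: algebra_simps)

lemma dird_Gam:
  assumes A: "smooth_on U A" and B: "smooth_on U B" and x: "x \<in> U"
  shows "dird v (\<lambda>x. Gam G (F x) (A x) (B x)) x =
    dGam G (F x) (complexify (dird v F x)) (A x) (B x) +
    Gam G (F x) (dird v A x) (B x) + Gam G (F x) (A x) (dird v B x)"
proof -
  have T: "((\<lambda>x. christoffel G (F x) i j k) has_derivative
      (\<lambda>v. dird (dird v F x) (\<lambda>y. christoffel G y i j k) (F x))) (at x)" for i j k
    by (rule has_derivative_compose[OF smooth_on_has_derivative[OF smooth_F x]
          smooth_on_has_derivative[OF smooth_christoffel F_in[OF x]]])
  have "((\<lambda>x. Gam G (F x) (A x) (B x) $ i) has_derivative (\<lambda>v. (dGam G (F x) (complexify (dird v F x)) (A x) (B x) +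
    Gam G (F x) (dird v A x) (B x) + Gam G (F x) (A x) (dird v B x)) $ i)) (at x)" for i
    using has_derivative_bil[of "\<lambda>x. christoffel G (F x) i", OF T
        smooth_on_has_derivative[OF A x] smooth_on_has_derivative[OF B x]]
    unfolding dird_christoffel[OF F_in[OF x], symmetric] Gam_def vector_add_component vec_lambda_beta .
  from has_derivative_frechetD[OF has_derivative_vec[OF this]] show ?thesis
    by (rule fun_cong)
qed

text \<open>The curvature of a pullback connection is the pullback of the curvature; constant
  directions commute, hence no bracket term. The terms with second derivatives of \<open>F\<close>
  or \<open>Y\<close>, and the sum of those pairing a derivative of \<open>F\<close> with one of
  \<open>Y\<close>, are symmetric in \<open>v\<close> and \<open>w\<close> and cancel.\<close>

lemma covd_commutator:
  assumes Y: "smooth_on U Y" and x: "x \<in> U"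
  shows "covd G F v (\<lambda>x. covd G F w Y x) x - covd G F w (\<lambda>x. covd G F v Y x) x =
    RC G (F x) (complexify (dird v F x)) (complexify (dird w F x)) (Y x)"
proof -
  have Fs: "smooth_on U (\<lambda>x. complexify (dird v F x))" for v
    by (rule smooth_on_bounded_linear[OF bounded_linear_complexify open_U smooth_on_dird[OF smooth_F]])
  have e: "covd G F v (\<lambda>x. covd G F w Y x) x =
      dird v (\<lambda>x. dird w Y x) x +
      (dGam G (F x) (complexify (dird v F x)) (complexify (dird w F x)) (Y x) +
        Gam G (F x) (complexify (dird v (\<lambda>x. dird w F x) x)) (Y x) +
        Gam G (F x) (complexify (dird w F x)) (dird v Y x)) +
      (Gam G (F x) (complexify (dird v F x)) (dird w Y x) +
       Gam G (F x) (complexify (dird v F x)) (Gam G (F x) (complexify (dird w F x)) (Y x)))" for v w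
    unfolding covd_def
      dird_add[OF smooth_on_dird[OF Y] smooth_Gam[OF Fs Y] x]
      dird_Gam[OF Fs Y x] dird_bounded_linear[OF bounded_linear_complexify smooth_on_dird[OF smooth_F] x]
      Gam_linear ..
  show ?thesis
    unfolding e RC_def
      dird_commute[OF open_U x Y, of v w] dird_commute[OF open_U x smooth_F, of v w]
    by (simp add: algebra_simps)
qed

lemma covC_commutator:
  assumes Y: "smooth_on U Y" and x: "x \<in> U"
  shows "covC G F \<xi> (\<lambda>x. covC G F \<zeta> Y x) x - covC G F \<zeta> (\<lambda>x. covC G F \<xi> Y x) x =
    RC G (F x) (FC F \<xi> x) (FC F \<zeta> x) (Y x)"
proof -
  note s = smooth_covd[OF Y]
  have e: "covC G F \<xi> (\<lambda>x. covC G F \<zeta> Y x) x =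
     covd G F (fst \<xi>) (covd G F (fst \<zeta>) Y) x + \<i> *s covd G F (fst \<xi>) (covd G F (snd \<zeta>) Y) x +
     \<i> *s covd G F (snd \<xi>) (covd G F (fst \<zeta>) Y) x - covd G F (snd \<xi>) (covd G F (snd \<zeta>) Y) x" for \<xi> \<zeta>
    unfolding covC_def covd_add[OF s s x] by (simp add: vec_eq_iff algebra_simps)
  have R: "RC G (F x) (complexify (dird v F x)) (complexify (dird w F x)) (Y x) =
      covd G F v (covd G F w Y) x - covd G F w (covd G F v Y) x" for v w
    using covd_commutator[OF Y x, of v w] by simp
  show ?thesis
    unfolding e FC_def RC_linear R by (simp add: vec_eq_iff algebra_simps)
qed

lemma covd_FC:
  assumes x: "x \<in> U"
  shows "covd G F v (\<lambda>x. FC F \<zeta> x) x =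
    covd G F v (\<lambda>x. complexify (dird (fst \<zeta>) F x)) x + \<i> *s covd G F v (\<lambda>x. complexify (dird (snd \<zeta>) F x)) x"
proof -
  have Fs: "smooth_on U (\<lambda>x. complexify (dird v F x))" for v
    by (rule smooth_on_bounded_linear[OF bounded_linear_complexify open_U smooth_on_dird[OF smooth_F]])
  show ?thesis unfolding FC_def by (rule covd_add[OF Fs Fs x])
qed

text \<open>Torsion-freeness: second derivatives of \<open>F\<close> commute and the Christoffel
  symbols are symmetric in the lower indices.\<close>

lemma covC_FC_commute:
  assumes x: "x \<in> U"
  shows "covC G F \<xi> (\<lambda>x. FC F \<zeta> x) x = covC G F \<zeta> (\<lambda>x. FC F \<xi> x) x"
proof -
  have s: "covd G F v (\<lambda>x. complexify (dird w F x)) x = covd G F w (\<lambda>x. complexify (dird v F x)) x" for v w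
    unfolding covd_def dird_bounded_linear[OF bounded_linear_complexify smooth_on_dird[OF smooth_F] x]
      dird_commute[OF open_U x smooth_F, of v w] Gam_commute[OF F_in[OF x], of "complexify (dird v F x)"] ..
  show ?thesis
    unfolding covC_def covd_FC[OF x]
    by (simp add: vec_eq_iff algebra_simps s[of "snd \<zeta>"] s[of "fst \<zeta>"])
qed

end

section \<open>The Siu--Sampson formula\<close>

lemma cnj_vec_simps:
  "cnj_vec (a + b) = cnj_vec a + cnj_vec b"
  "cnj_vec (r *s a) = cnj r *s cnj_vec a"
  "cnj_vec (complexify x) = complexify x"
  "cnj_vec (cnj_vec a) = a"
  "cnj_vec (- a) = - cnj_vec a"
  by (simp_all add: cnj_vec_def complexify_def vec_eq_iff)

lemma cnj_vec_Gam: "cnj_vec (Gam G y a b) = Gam G y (cnj_vec a) (cnj_vec b)"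
  by (simp add: Gam_def vec_eq_iff flip: bil_cnj) (simp add: cnj_vec_def)

lemma bounded_linear_cnj_vec: "bounded_linear (cnj_vec :: complex^'n \<Rightarrow> complex^'n)"
proof -
  have "linear (cnj_vec :: complex^'n \<Rightarrow> complex^'n)"
    by (rule linearI) (simp_all add: cnj_vec_def vec_eq_iff)
  then show ?thesis by (simp only: linear_conv_bounded_linear)
qed

lemma conj_dir_conj_dir: "conj_dir (conj_dir \<xi>) = \<xi>"
  by (simp add: conj_dir_def)

lemma gC_complexify: "gC M (complexify a) (complexify b) = complex_of_real (gform M a b)"
  by (simp add: bil_def gform_def complexify_def)

text \<open>Multiplied by \<open>p q\<close>, the quadratic form is a sum of squares.\<close>

lemma trace_free_definite:
  fixes M :: "real^'n^'n" and a b X Y :: "real^'n"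
  assumes sym: "\<And>i j. M $ i $ j = M $ j $ i" and pos: "\<And>v. v \<noteq> 0 \<Longrightarrow> gform M v v > 0"
    and p: "p > 0" and pq: "r1\<^sup>2 + r2\<^sup>2 < p * q"
    and tr: "p *\<^sub>R a + q *\<^sub>R b + 2 *\<^sub>R (r1 *\<^sub>R X - r2 *\<^sub>R Y) = 0"
  shows "gform M X X + gform M Y Y - gform M a b \<ge> 0"
    and "gform M X X + gform M Y Y - gform M a b = 0 \<Longrightarrow> a = 0 \<and> b = 0 \<and> X = 0 \<and> Y = 0"
proof -
  let ?g = "gform M"
  have lin: "?g (u + v) w = ?g u w + ?g v w" "?g w (u + v) = ?g w u + ?g w v"
    "?g (u - v) w = ?g u w - ?g v w" "?g w (u - v) = ?g w u - ?g w v"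
    "?g (c *\<^sub>R u) w = c * ?g u w" "?g w (c *\<^sub>R u) = c * ?g w u" for u v w c
    by (simp_all add: gform_def algebra_simps sum.distrib sum_subtractf sum_distrib_left)
  have comm: "?g u v = ?g v u" for u v
    unfolding gform_def by (subst sum.swap) (simp add: sym mult_ac)
  have nonneg: "?g v v \<ge> 0" for v
    using pos[of v] by (cases "v = 0") (auto simp: gform_def)
  have q: "q > 0"
    using pq p by (metis not_sum_power2_lt_zero less_trans zero_less_mult_pos linorder_neqE_linordered_idom)
  let ?S = "?g X X + ?g Y Y - ?g a b"
  \<comment> \<open>Pairing the trace condition with \<open>a\<close> eliminates the only term of
    \<open>?S\<close> without a sign, the product of \<open>a\<close> and \<open>b\<close>.\<close>
  have "?g a (p *\<^sub>R a + q *\<^sub>R b + 2 *\<^sub>R (r1 *\<^sub>R X - r2 *\<^sub>R Y)) = 0"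
    unfolding tr by (simp add: gform_def)
  then have t: "q * ?g a b = - p * ?g a a - 2 * r1 * ?g a X + 2 * r2 * ?g a Y"
    by (simp add: lin algebra_simps)
  have id: "p * q * ?S = (p * q - (r1\<^sup>2 + r2\<^sup>2)) * (?g X X + ?g Y Y) +
      ?g (r2 *\<^sub>R X + r1 *\<^sub>R Y) (r2 *\<^sub>R X + r1 *\<^sub>R Y) +
      ?g (p *\<^sub>R a + (r1 *\<^sub>R X - r2 *\<^sub>R Y)) (p *\<^sub>R a + (r1 *\<^sub>R X - r2 *\<^sub>R Y))"
  proof -
    have "p * q * ?S = p * q * (?g X X + ?g Y Y) - p * (q * ?g a b)"
      by (simp add: algebra_simps)
    also have "\<dots> = p * q * (?g X X + ?g Y Y) - p * (- p * ?g a a - 2 * r1 * ?g a X + 2 * r2 * ?g a Y)"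
      unfolding t ..
    also have "\<dots> = (p * q - (r1\<^sup>2 + r2\<^sup>2)) * (?g X X + ?g Y Y) +
      ?g (r2 *\<^sub>R X + r1 *\<^sub>R Y) (r2 *\<^sub>R X + r1 *\<^sub>R Y) +
      ?g (p *\<^sub>R a + (r1 *\<^sub>R X - r2 *\<^sub>R Y)) (p *\<^sub>R a + (r1 *\<^sub>R X - r2 *\<^sub>R Y))"
      unfolding lin comm[of X a] comm[of Y a] comm[of Y X] by (simp add: algebra_simps power2_eq_square)
    finally show ?thesis .
  qed
  have S1: "p * q * ?S \<ge> (p * q - (r1\<^sup>2 + r2\<^sup>2)) * (?g X X + ?g Y Y)"
    unfolding id using nonneg by (simp add: add_increasing2)
  have S2: "p * q * ?S \<ge> ?g (p *\<^sub>R a + (r1 *\<^sub>R X - r2 *\<^sub>R Y)) (p *\<^sub>R a + (r1 *\<^sub>R X - r2 *\<^sub>R Y))"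
    unfolding id using nonneg pq by (simp add: add_increasing add_nonneg_nonneg)
  have "0 \<le> p * q * ?S"
    using S2 nonneg order_trans by blast
  then show "?S \<ge> 0"
    using mult_le_cancel_left_pos[OF mult_pos_pos[OF p q], of 0] by simp
  assume S0: "?S = 0"
  have "(p * q - (r1\<^sup>2 + r2\<^sup>2)) * (?g X X + ?g Y Y) \<le> 0"
    using S1 unfolding S0 by simp
  then have "?g X X + ?g Y Y \<le> 0"
    using pq by (simp add: mult_le_0_iff)
  then have "?g X X = 0" "?g Y Y = 0"
    using nonneg[of X] nonneg[of Y] by linarith+
  then have XY: "X = 0" "Y = 0"
    using pos[of X] pos[of Y] by auto
  have "?g (p *\<^sub>R a) (p *\<^sub>R a) \<le> 0"
    using S2 unfolding S0 unfolding XY by simp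
  then have a: "a = 0"
    using pos[of "p *\<^sub>R a"] p by auto
  show "a = 0 \<and> b = 0 \<and> X = 0 \<and> Y = 0"
    using tr q unfolding a XY by simp
qed

definition etaC ::
  "(real^'n \<Rightarrow> real^'n^'n) \<Rightarrow> ('a::real_normed_vector \<Rightarrow> real^'n) \<Rightarrow> 'a \<times> 'a \<Rightarrow> 'a \<times> 'a \<Rightarrow> 'a \<Rightarrow> complex"
  where "etaC G F \<xi> \<zeta> x = gC (G (F x)) (FC F \<xi> x) (FC F \<zeta> x)"

text \<open>The second fundamental form (Hessian) of \<open>F\<close>. The directions are constant
  vectors of a flat domain, so no connection on the domain enters.\<close>

definition HC ::
  "(real^'n \<Rightarrow> real^'n^'n) \<Rightarrow> ('a::real_normed_vector \<Rightarrow> real^'n) \<Rightarrow> 'a \<times> 'a \<Rightarrow> 'a \<times> 'a \<Rightarrow> 'a \<Rightarrow> complex^'n"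
  where "HC G F \<xi> \<zeta> x = covC G F \<xi> (\<lambda>x. FC F \<zeta> x) x"

context map_chart
begin

lemma HC_commute: "x \<in> U \<Longrightarrow> HC G F \<xi> \<zeta> x = HC G F \<zeta> \<xi> x"
  unfolding HC_def by (rule covC_FC_commute)

lemma smooth_HC: "smooth_on U (\<lambda>x. HC G F \<xi> \<zeta> x)"
  unfolding HC_def by (rule smooth_covC[OF smooth_FC])

lemma smooth_etaC: "smooth_on U (\<lambda>x. etaC G F \<xi> \<zeta> x)"
  unfolding etaC_def by (rule smooth_gC[OF smooth_FC smooth_FC])

lemma covC_HC_commutator:
  assumes x: "x \<in> U"
  shows "covC G F \<xi> (\<lambda>x. HC G F \<zeta> \<omega> x) x =
    covC G F \<zeta> (\<lambda>x. HC G F \<xi> \<omega> x) x + RC G (F x) (FC F \<xi> x) (FC F \<zeta> x) (FC F \<omega> x)"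
  using covC_commutator[OF smooth_FC x, of \<xi> \<zeta> \<omega>] unfolding HC_def by (simp add: algebra_simps)

lemma dC_etaC:
  assumes x: "x \<in> U"
  shows "dC \<xi> (\<lambda>x. etaC G F \<zeta> \<omega> x) x =
    gC (G (F x)) (HC G F \<xi> \<zeta> x) (FC F \<omega> x) + gC (G (F x)) (FC F \<zeta> x) (HC G F \<xi> \<omega> x)"
  unfolding etaC_def HC_def by (rule dC_gC[OF smooth_FC smooth_FC x])

text \<open>Antisymmetrizing removes the Hessian in the two directions \<beta>1 and \<beta>2, which
  is symmetric. For holomorphic \<alpha> and antiholomorphic \<beta>1, \<beta>2 only the mixed
  Hessian is left.\<close>

lemma dC_etaC_antisym:
  assumes x: "x \<in> U"
  shows "dC \<beta>1 (\<lambda>x. etaC G F \<alpha> \<beta>2 x) x - dC \<beta>2 (\<lambda>x. etaC G F \<alpha> \<beta>1 x) x =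
    gC (G (F x)) (HC G F \<alpha> \<beta>1 x) (FC F \<beta>2 x) - gC (G (F x)) (HC G F \<alpha> \<beta>2 x) (FC F \<beta>1 x)"
  unfolding dC_etaC[OF x] HC_commute[OF x, of \<beta>1] HC_commute[OF x, of \<beta>2 \<alpha>]
  by simp

text \<open>Differentiating \<open>dC_etaC_antisym\<close> again gives third derivatives of the map.
  The exchange of \<alpha>1 and \<alpha>2 leaves only their commutators, which are curvature by
  \<open>covC_HC_commutator\<close>. The products of two Hessians occur twice because the metric is
  symmetric.\<close>

lemma siu_sampson:
  assumes x: "x \<in> U"
  shows "dC \<alpha>1 (\<lambda>x. dC \<beta>1 (\<lambda>x. etaC G F \<alpha>2 \<beta>2 x) x - dC \<beta>2 (\<lambda>x. etaC G F \<alpha>2 \<beta>1 x) x) x -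
      dC \<alpha>2 (\<lambda>x. dC \<beta>1 (\<lambda>x. etaC G F \<alpha>1 \<beta>2 x) x - dC \<beta>2 (\<lambda>x. etaC G F \<alpha>1 \<beta>1 x) x) x =
    riem_complex G (F x) (FC F \<alpha>1 x) (FC F \<alpha>2 x) (FC F \<beta>1 x) (FC F \<beta>2 x) -
    riem_complex G (F x) (FC F \<alpha>1 x) (FC F \<alpha>2 x) (FC F \<beta>2 x) (FC F \<beta>1 x) +
    2 * (gC (G (F x)) (HC G F \<alpha>1 \<beta>2 x) (HC G F \<alpha>2 \<beta>1 x) -
         gC (G (F x)) (HC G F \<alpha>1 \<beta>1 x) (HC G F \<alpha>2 \<beta>2 x))"
proof -
  have e: "dC \<xi> (\<lambda>x. dC \<beta>1 (\<lambda>x. etaC G F \<alpha> \<beta>2 x) x - dC \<beta>2 (\<lambda>x. etaC G F \<alpha> \<beta>1 x) x) x =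
     (gC (G (F x)) (covC G F \<xi> (\<lambda>x. HC G F \<alpha> \<beta>1 x) x) (FC F \<beta>2 x) + gC (G (F x)) (HC G F \<alpha> \<beta>1 x) (HC G F \<xi> \<beta>2 x)) -
     (gC (G (F x)) (covC G F \<xi> (\<lambda>x. HC G F \<alpha> \<beta>2 x) x) (FC F \<beta>1 x) + gC (G (F x)) (HC G F \<alpha> \<beta>2 x) (HC G F \<xi> \<beta>1 x))"
    for \<xi> \<alpha>
  proof -
    have "dC \<xi> (\<lambda>x. dC \<beta>1 (\<lambda>x. etaC G F \<alpha> \<beta>2 x) x - dC \<beta>2 (\<lambda>x. etaC G F \<alpha> \<beta>1 x) x) x =
      dC \<xi> (\<lambda>x. gC (G (F x)) (HC G F \<alpha> \<beta>1 x) (FC F \<beta>2 x) - gC (G (F x)) (HC G F \<alpha> \<beta>2 x) (FC F \<beta>1 x)) x"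
      by (rule dC_cong[OF x dC_etaC_antisym])
    then show ?thesis
      unfolding dC_diff[OF smooth_gC[OF smooth_HC smooth_FC] smooth_gC[OF smooth_HC smooth_FC] x]
        dC_gC[OF smooth_HC smooth_FC x] HC_def[of G F \<xi>, symmetric] .
  qed
  have c: "gC (G (F x)) (HC G F \<alpha>2 \<beta> x) (HC G F \<alpha>1 \<gamma> x) = gC (G (F x)) (HC G F \<alpha>1 \<gamma> x) (HC G F \<alpha>2 \<beta> x)" for \<beta> \<gamma>
    by (rule gC_commute[OF F_in[OF x]])
  show ?thesis
    unfolding e c covC_HC_commutator[OF x, of \<alpha>1 \<alpha>2] bil_simps gC_RC[of G "F x", symmetric]
    by (simp add: algebra_simps)
qed

lemma FC_conj: "x \<in> U \<Longrightarrow> FC F (conj_dir \<xi>) x = cnj_vec (FC F \<xi> x)"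
  using linear_neg[OF bounded_linear.linear[OF bounded_linear_complexify], of "dird (snd \<xi>) F x"]
  by (simp add: FC_def conj_dir_def cnj_vec_simps dird_minus[OF smooth_F] vec_eq_iff)

lemma covC_conj:
  assumes Y: "smooth_on U Y" and x: "x \<in> U"
  shows "covC G F (conj_dir \<xi>) (\<lambda>x. cnj_vec (Y x)) x = cnj_vec (covC G F \<xi> Y x)"
proof -
  have 1: "covd G F v (\<lambda>x. cnj_vec (Y x)) x = cnj_vec (covd G F v Y x)" for v
    unfolding covd_def dird_bounded_linear[OF bounded_linear_cnj_vec Y x] cnj_vec_simps cnj_vec_Gam ..
  have 2: "covd G F (- v) Y x = - covd G F v Y x" for v
    using linear_neg[OF bounded_linear.linear[OF bounded_linear_complexify], of "dird v F x"]
      Gam_linear(3)[of G "F x" "-1" "complexify (dird v F x)" "Y x"]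
    by (simp add: covd_def dird_minus[OF Y x] dird_minus[OF smooth_F x])
  show ?thesis
    by (simp add: covC_def 1 conj_dir_def 2 cnj_vec_simps vec_eq_iff)
qed

lemma HC_conj:
  assumes x: "x \<in> U"
  shows "HC G F (conj_dir \<xi>) (conj_dir \<zeta>) x = cnj_vec (HC G F \<xi> \<zeta> x)"
proof -
  have "HC G F (conj_dir \<xi>) (conj_dir \<zeta>) x = covC G F (conj_dir \<xi>) (\<lambda>x. cnj_vec (FC F \<zeta> x)) x"
    unfolding HC_def by (rule covC_cong[OF x FC_conj])
  then show ?thesis unfolding covC_conj[OF smooth_FC x] HC_def .
qed

lemma gC_cnj_nonneg:
  assumes "y \<in> V"
  shows "Re (gC (G y) a (cnj_vec a)) \<ge> 0" "Re (gC (G y) a (cnj_vec a)) = 0 \<Longrightarrow> a = 0"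
proof -
  define X Y where "X = (\<chi> i. Re (a $ i))" and "Y = (\<chi> i. Im (a $ i))"
  have a: "a = complexify X + \<i> *s complexify Y"
    by (simp add: X_def Y_def complexify_def vec_eq_iff complex_eq)
  have e: "Re (gC (G y) a (cnj_vec a)) = gform (G y) X X + gform (G y) Y Y"
    unfolding a cnj_vec_simps bil_simps gC_complexify by simp
  have nonneg: "gform (G y) v v \<ge> 0" for v
    using pos_G[OF assms, of v] by (cases "v = 0") (auto simp: gform_def)
  show "Re (gC (G y) a (cnj_vec a)) \<ge> 0"
    unfolding e using nonneg by simp
  assume "Re (gC (G y) a (cnj_vec a)) = 0"
  then have "gform (G y) X X = 0" "gform (G y) Y Y = 0"
    using nonneg[of X] nonneg[of Y] unfolding e by linarith+
  then have "X = 0" "Y = 0"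
    using pos_G[OF assms, of X] pos_G[OF assms, of Y] by auto
  then show "a = 0"
    unfolding a by (simp add: complexify_def vec_eq_iff)
qed

end

section \<open>Signs of the curvature and Hessian terms\<close>

context map_chart
begin

text \<open>After swapping the first two arguments of the first summand, the summands are minus the
  curvatures for (Z, W) equal to (b, conjugate of a) and (a, conjugate of b). These are genuinely
  complex pairs, which is why real sectional curvature is not the right condition here.\<close>

lemma curvature_term_nonneg:
  assumes K: "\<And>Z W. Re (riem_complex G y Z (cnj_vec W) W (cnj_vec Z)) \<le> 0"
  shows "0 \<le> Re (riem_complex G y a b (cnj_vec a) (cnj_vec b) - riem_complex G y a b (cnj_vec b) (cnj_vec a))"
proof -
  have "riem_complex G y a b (cnj_vec a) (cnj_vec b) = - riem_complex G y b a (cnj_vec a) (cnj_vec b)"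
    unfolding gC_RC[symmetric] by (subst RC_swap) (simp add: bil_def sum_negf)
  then show ?thesis
    using K[of a "cnj_vec b"] K[of b "cnj_vec a"] by (simp add: cnj_vec_simps)
qed

text \<open>Conjugation exchanges the two indices of the mixed Hessian, so its diagonal entries are
  real vectors \<open>a\<close>, \<open>b\<close> and its off-diagonal entries are conjugate, with
  parts \<open>X\<close> and \<open>Y\<close>. This reduces the claim to
  \<open>trace_free_definite\<close>. The conditions on \<open>p\<close>, \<open>q\<close>,
  \<open>r\<close> say that the Hermitian coefficient matrix is positive definite.\<close>

lemma hessian_term:
  fixes p q :: real and r :: complex
  assumes x: "x \<in> U" and p: "p > 0" and pq: "(cmod r)\<^sup>2 < p * q"
    and tr: "of_real p *s HC G F \<alpha>1 (conj_dir \<alpha>1) x + of_real q *s HC G F \<alpha>2 (conj_dir \<alpha>2) x +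
      r *s HC G F \<alpha>1 (conj_dir \<alpha>2) x + cnj r *s HC G F \<alpha>2 (conj_dir \<alpha>1) x = 0"
  defines "S \<equiv> Re (gC (G (F x)) (HC G F \<alpha>1 (conj_dir \<alpha>2) x) (HC G F \<alpha>2 (conj_dir \<alpha>1) x) -
         gC (G (F x)) (HC G F \<alpha>1 (conj_dir \<alpha>1) x) (HC G F \<alpha>2 (conj_dir \<alpha>2) x))"
  shows "S \<ge> 0"
    and "S = 0 \<Longrightarrow> HC G F \<alpha>1 (conj_dir \<alpha>1) x = 0 \<and> HC G F \<alpha>2 (conj_dir \<alpha>2) x = 0"
proof -
  have sw: "HC G F \<zeta> (conj_dir \<xi>) x = cnj_vec (HC G F \<xi> (conj_dir \<zeta>) x)" for \<xi> \<zeta>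
    using HC_conj[OF x, of \<xi> "conj_dir \<zeta>"] unfolding conj_dir_conj_dir HC_commute[OF x, of "conj_dir \<xi>"] .
  have real: "\<exists>a. HC G F \<xi> (conj_dir \<xi>) x = complexify a" for \<xi>
  proof
    show "HC G F \<xi> (conj_dir \<xi>) x = complexify (\<chi> i. Re (HC G F \<xi> (conj_dir \<xi>) x $ i))"
      using sw[of \<xi> \<xi>] by (auto simp: vec_eq_iff cnj_vec_def complexify_def complex_eq_iff)
  qed
  obtain a where a: "HC G F \<alpha>1 (conj_dir \<alpha>1) x = complexify a" using real by blast
  obtain b where b: "HC G F \<alpha>2 (conj_dir \<alpha>2) x = complexify b" using real by blast
  define X Y where "X = (\<chi> i. Re (HC G F \<alpha>1 (conj_dir \<alpha>2) x $ i))"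
    and "Y = (\<chi> i. Im (HC G F \<alpha>1 (conj_dir \<alpha>2) x $ i))"
  have c: "HC G F \<alpha>1 (conj_dir \<alpha>2) x = complexify X + \<i> *s complexify Y"
    by (simp add: X_def Y_def complexify_def vec_eq_iff complex_eq)
  have c': "HC G F \<alpha>2 (conj_dir \<alpha>1) x = complexify X + (- \<i>) *s complexify Y"
    unfolding sw[of \<alpha>2 \<alpha>1] c cnj_vec_simps by simp
  have S: "S = gform (G (F x)) X X + gform (G (F x)) Y Y - gform (G (F x)) a b"
    unfolding S_def a b c c' bil_simps gC_complexify by simp
  have tr': "p *\<^sub>R a + q *\<^sub>R b + 2 *\<^sub>R (Re r *\<^sub>R X - Im r *\<^sub>R Y) = 0"
  proof (rule vec_eq_iff[THEN iffD2], rule allI)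
    fix i
    have "Re ((of_real p *s complexify a + of_real q *s complexify b +
      r *s (complexify X + \<i> *s complexify Y) + cnj r *s (complexify X + (- \<i>) *s complexify Y)) $ i) = 0"
      using tr unfolding a b c c' by simp
    then show "(p *\<^sub>R a + q *\<^sub>R b + 2 *\<^sub>R (Re r *\<^sub>R X - Im r *\<^sub>R Y)) $ i = 0 $ i"
      by (simp add: complexify_def algebra_simps)
  qed
  have pq': "(Re r)\<^sup>2 + (Im r)\<^sup>2 < p * q"
    using pq by (simp add: cmod_power2)
  note T = trace_free_definite[of "G (F x)", OF sym_G[OF F_in[OF x]] pos_G[OF F_in[OF x]] p pq' tr']
  show "S \<ge> 0"
    unfolding S by (rule T(1))
  show "HC G F \<alpha>1 (conj_dir \<alpha>1) x = 0 \<and> HC G F \<alpha>2 (conj_dir \<alpha>2) x = 0" if "S = 0"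
    using T(2) that unfolding S a b by (simp add: complexify_def vec_eq_iff)
qed

text \<open>With the mixed Hessian zero on all of \<open>U\<close>, only the second factor of the
  energy contributes to its conjugate derivative. The next derivative yields the squared norm of the
  Hessian in (\<alpha>, \<alpha>) and a third derivative of the map; commuting the latter turns it
  into curvature, nonnegative by the case Z = W of the assumption.\<close>

lemma Re_dC_dC_energy_nonneg:
  assumes x: "x \<in> U" and K: "\<And>Z W. Re (riem_complex G (F x) Z (cnj_vec W) W (cnj_vec Z)) \<le> 0"
    and H: "\<And>x. x \<in> U \<Longrightarrow> HC G F \<alpha> (conj_dir \<alpha>) x = 0"
  shows "0 \<le> Re (dC \<alpha> (\<lambda>x. dC (conj_dir \<alpha>) (\<lambda>x. etaC G F \<alpha> (conj_dir \<alpha>) x) x) x)"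
proof -
  let ?\<beta> = "conj_dir \<alpha>"
  have H': "HC G F ?\<beta> \<alpha> x = 0" if "x \<in> U" for x
    using H[OF that] HC_commute[OF that] by metis
  have "dC \<alpha> (\<lambda>x. dC ?\<beta> (\<lambda>x. etaC G F \<alpha> ?\<beta> x) x) x = dC \<alpha> (\<lambda>x. gC (G (F x)) (FC F \<alpha> x) (HC G F ?\<beta> ?\<beta> x)) x"
    by (rule dC_cong[OF x]) (simp add: dC_etaC H' bil_simps)
  also have "\<dots> = gC (G (F x)) (HC G F \<alpha> \<alpha> x) (HC G F ?\<beta> ?\<beta> x) +
      gC (G (F x)) (FC F \<alpha> x) (covC G F \<alpha> (\<lambda>x. HC G F ?\<beta> ?\<beta> x) x)"
    unfolding dC_gC[OF smooth_FC smooth_HC x] HC_def[of G F \<alpha> \<alpha>] ..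
  also have "covC G F \<alpha> (\<lambda>x. HC G F ?\<beta> ?\<beta> x) x = RC G (F x) (FC F \<alpha> x) (FC F ?\<beta> x) (FC F ?\<beta> x)"
    using covC_cong[OF x, of "\<lambda>x. HC G F \<alpha> ?\<beta> x" "\<lambda>_. 0" ?\<beta>] H covC_zero[OF x]
    unfolding covC_HC_commutator[OF x, of \<alpha>] by simp
  also have "gC (G (F x)) (FC F \<alpha> x) \<dots> = riem_complex G (F x) (FC F \<alpha> x) (FC F ?\<beta> x) (FC F ?\<beta> x) (FC F \<alpha> x)"
    unfolding gC_RC[symmetric] by (rule gC_commute[OF F_in[OF x]])
  also have "\<dots> = - riem_complex G (F x) (FC F ?\<beta> x) (FC F \<alpha> x) (FC F ?\<beta> x) (FC F \<alpha> x)"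
    unfolding gC_RC[symmetric] by (subst RC_swap) (simp add: bil_def sum_negf)
  finally show ?thesis
    using gC_cnj_nonneg(1)[OF F_in[OF x], of "HC G F \<alpha> \<alpha> x"] K[of "FC F ?\<beta> x" "FC F ?\<beta> x"]
    unfolding HC_conj[OF x] FC_conj[OF x] cnj_vec_simps by simp
qed

text \<open>Both the curvature part and the Hessian part are nonnegative, so the vanishing of their
  sum forces the Hessian part to vanish.\<close>

lemma siu_sampson_nonneg:
  fixes p q :: real and r :: complex
  assumes x: "x \<in> U" and K: "\<And>Z W. Re (riem_complex G (F x) Z (cnj_vec W) W (cnj_vec Z)) \<le> 0"
    and p: "p > 0" and pq: "(cmod r)\<^sup>2 < p * q"
    and tr: "of_real p *s HC G F \<alpha>1 (conj_dir \<alpha>1) x + of_real q *s HC G F \<alpha>2 (conj_dir \<alpha>2) x +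
      r *s HC G F \<alpha>1 (conj_dir \<alpha>2) x + cnj r *s HC G F \<alpha>2 (conj_dir \<alpha>1) x = 0"
  defines "Q \<equiv> Re (dC \<alpha>1 (\<lambda>x. dC (conj_dir \<alpha>1) (\<lambda>x. etaC G F \<alpha>2 (conj_dir \<alpha>2) x) x -
        dC (conj_dir \<alpha>2) (\<lambda>x. etaC G F \<alpha>2 (conj_dir \<alpha>1) x) x) x -
      dC \<alpha>2 (\<lambda>x. dC (conj_dir \<alpha>1) (\<lambda>x. etaC G F \<alpha>1 (conj_dir \<alpha>2) x) x -
        dC (conj_dir \<alpha>2) (\<lambda>x. etaC G F \<alpha>1 (conj_dir \<alpha>1) x) x) x)"
  shows "Q \<ge> 0"
    and "Q = 0 \<Longrightarrow> HC G F \<alpha>1 (conj_dir \<alpha>1) x = 0 \<and> HC G F \<alpha>2 (conj_dir \<alpha>2) x = 0"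
proof -
  note h = hessian_term[OF x p pq tr]
  note c = curvature_term_nonneg[of "F x", OF K, of "FC F \<alpha>1 x" "FC F \<alpha>2 x"]
  show "Q \<ge> 0"
    using h(1) c unfolding Q_def siu_sampson[OF x] FC_conj[OF x] by simp
  have "Q = 0 \<Longrightarrow> Re (gC (G (F x)) (HC G F \<alpha>1 (conj_dir \<alpha>2) x) (HC G F \<alpha>2 (conj_dir \<alpha>1) x) -
         gC (G (F x)) (HC G F \<alpha>1 (conj_dir \<alpha>1) x) (HC G F \<alpha>2 (conj_dir \<alpha>2) x)) = 0"
    using h(1) c unfolding Q_def siu_sampson[OF x] FC_conj[OF x] by simp
  then show "Q = 0 \<Longrightarrow> HC G F \<alpha>1 (conj_dir \<alpha>1) x = 0 \<and> HC G F \<alpha>2 (conj_dir \<alpha>2) x = 0"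
    using h(2) by blast
qed

text \<open>The shape in which the terms of the harmonic map equation can be recognized component by
  component.\<close>

lemma covC_alt:
  assumes Y: "smooth_on U Y" and x: "x \<in> U"
  shows "covC G F \<xi> Y x = (\<chi> i. dC \<xi> (\<lambda>x. Y x $ i) x) + Gam G (F x) (FC F \<xi> x) (Y x)"
  unfolding covC_def covd_def FC_def Gam_linear dC_def
    dird_bounded_linear[OF bounded_linear_vec_nth Y x]
  by (simp add: vec_eq_iff algebra_simps)

end

section \<open>Divergences of homogeneous vector fields\<close>

lemma continuous_on_extend_zero:
  fixes f :: "'a::real_normed_vector \<Rightarrow> 'b::real_normed_vector"
  assumes "continuous_on (- {0}) f" "d > 0" "\<And>x. norm x < d \<Longrightarrow> f x = 0"
  shows "continuous_on UNIV f"
proof -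
  have "continuous_on (ball 0 d) f"
    using assms(3) by (subst continuous_on_cong[of _ "ball 0 d" f "\<lambda>_. 0"]) auto
  then have "continuous_on (- {0} \<union> ball 0 d) f"
    using assms(1) by (intro continuous_on_open_Un) auto
  moreover have "- {0} \<union> ball 0 d = (UNIV :: 'a set)"
    using assms(2) by auto
  ultimately show ?thesis by simp
qed

lemma integrable_compact_support:
  fixes f :: "'a::euclidean_space \<Rightarrow> real"
  assumes "continuous_on UNIV f" "\<And>x. R < norm x \<Longrightarrow> f x = 0"
  shows "integrable lborel f"
proof -
  have "integrable lborel (\<lambda>x. indicator (cball 0 R) x *\<^sub>R f x)"
    by (intro borel_integrable_compact continuous_on_subset[OF assms(1)]) auto
  moreover have "(\<lambda>x. indicator (cball 0 R) x *\<^sub>R f x) = f"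
    using assms(2) by (auto simp: indicator_def fun_eq_iff)
  ultimately show ?thesis by simp
qed

lemma integral_lborel_translation:
  fixes f :: "'a::euclidean_space \<Rightarrow> real"
  assumes "f \<in> borel_measurable borel"
  shows "integral\<^sup>L lborel (\<lambda>x. f (c + x)) = integral\<^sup>L lborel f"
proof -
  have "integral\<^sup>L lborel f = integral\<^sup>L (distr lborel borel ((+) c)) f"
    by (simp add: lborel_distr_plus)
  also have "\<dots> = integral\<^sup>L lborel (\<lambda>x. f (c + x))"
    using assms by (intro integral_distr) auto
  finally show ?thesis by simp
qed

lemma integral_lborel_scale:
  fixes f :: "'a::euclidean_space \<Rightarrow> real"
  assumes [measurable]: "f \<in> borel_measurable borel" and c: "c \<noteq> 0"
  shows "integral\<^sup>L lborel f = \<bar>c\<bar> ^ DIM('a) * integral\<^sup>L lborel (\<lambda>x. f (c *\<^sub>R x))"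
proof -
  have "integral\<^sup>L lborel f = integral\<^sup>L (density (distr lborel borel (\<lambda>x. 0 + c *\<^sub>R x)) (\<lambda>_. ennreal (\<bar>c\<bar> ^ DIM('a)))) f"
    using lborel_affine[OF c, of "0::'a"] by simp
  also have "\<dots> = integral\<^sup>L (distr lborel borel (\<lambda>x. 0 + c *\<^sub>R x)) (\<lambda>x. \<bar>c\<bar> ^ DIM('a) *\<^sub>R f x)"
    by (subst integral_density) auto
  also have "\<dots> = \<bar>c\<bar> ^ DIM('a) * integral\<^sup>L lborel (\<lambda>x. f (c *\<^sub>R x))"
    by (subst integral_distr) auto
  finally show ?thesis .
qed

text \<open>Translation invariance makes the integral of every difference quotient vanish; dominated
  convergence passes to the derivative.\<close>

lemma integral_directional_derivative_zero:
  fixes f :: "'a::euclidean_space \<Rightarrow> real"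
  assumes f: "\<And>x. (f has_derivative f' x) (at x)"
    and cont: "continuous_on UNIV (\<lambda>x. f' x v)"
    and supp: "\<And>x. R < norm x \<Longrightarrow> f x = 0"
  shows "integral\<^sup>L lborel (\<lambda>x. f' x v) = 0"
proof -
  have cf: "continuous_on UNIV f"
    using f by (meson continuous_at_imp_continuous_on has_derivative_continuous)
  have [measurable]: "f \<in> borel_measurable borel"
    using cf by (rule borel_measurable_continuous_onI)
  have [measurable]: "(\<lambda>x. f' x v) \<in> borel_measurable borel"
    using cont by (rule borel_measurable_continuous_onI)
  have f'0: "f' x v = 0" if "R < norm x" for x
  proof -
    have "(f has_derivative (\<lambda>_. 0)) (at x)"
      by (rule has_derivative_transform_within_open[of "\<lambda>_. 0" _ _ _ "- cball 0 R"])
        (use that supp in auto)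
    then show ?thesis using has_derivative_unique[OF f] by metis
  qed
  have "compact ((\<lambda>x. f' x v) ` cball 0 R)"
    by (intro compact_continuous_image continuous_on_subset[OF cont]) auto
  then have "bounded ((\<lambda>x. f' x v) ` cball 0 R)"
    by (rule compact_imp_bounded)
  then obtain B0 where "\<forall>x\<in>cball 0 R. \<bar>f' x v\<bar> \<le> B0"
    unfolding bounded_iff by auto
  then have B0: "\<bar>f' x v\<bar> \<le> B0" if "norm x \<le> R" for x
    using that by simp
  \<comment> \<open>For negative \<open>R\<close> the ball is empty and \<open>B0\<close> is
    unconstrained, hence the maximum with 0.\<close>
  define B where "B = max B0 0"
  have B: "\<bar>f' x v\<bar> \<le> B" for x
    using B0[of x] f'0[of x] by (cases "norm x \<le> R") (auto simp: B_def)
  define s where "s n = (\<lambda>x. (f (inverse (real (Suc n)) *\<^sub>R v + x) - f x) * real (Suc n))" for n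
  \<comment> \<open>All steps have length at most \<open>norm v\<close>, so outside the enlarged
    ball the quotients vanish; inside it, the mean value theorem bounds them by
    \<open>B\<close>.\<close>
  define w where "w = (\<lambda>x::'a. B * indicator (cball 0 (R + norm v)) x)"
  have line: "((\<lambda>t. f (t *\<^sub>R v + x)) has_real_derivative f' (t *\<^sub>R v + x) v) (at t)" for t x
  proof -
    have "((\<lambda>t. t *\<^sub>R v + x) has_derivative (\<lambda>h. h *\<^sub>R v)) (at t)"
      by (auto intro!: derivative_eq_intros)
    from has_derivative_compose[OF this f]
    have "((\<lambda>t. f (t *\<^sub>R v + x)) has_derivative (\<lambda>h. f' (t *\<^sub>R v + x) (h *\<^sub>R v))) (at t)" .
    moreover have "f' (t *\<^sub>R v + x) (h *\<^sub>R v) = f' (t *\<^sub>R v + x) v * h" for h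
      using linear_scale[OF has_derivative_linear[OF f]] by (simp add: mult.commute)
    ultimately show ?thesis
      by (simp add: has_field_derivative_def)
  qed
  have s0: "integral\<^sup>L lborel (s n) = 0" for n
  proof -
    have i: "integrable lborel f"
      by (rule integrable_compact_support[OF cf supp])
    have "integrable lborel (\<lambda>x. f (inverse (real (Suc n)) *\<^sub>R v + x))"
    proof (rule integrable_compact_support)
      show "continuous_on UNIV (\<lambda>x. f (inverse (real (Suc n)) *\<^sub>R v + x))"
        by (rule continuous_on_compose2[OF cf]) (auto intro!: continuous_intros)
      show "f (inverse (real (Suc n)) *\<^sub>R v + x) = 0" if "R + norm (inverse (real (Suc n)) *\<^sub>R v) < norm x" for x
        using that norm_triangle_ineq2[of x "- (inverse (real (Suc n)) *\<^sub>R v)"]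
        by (intro supp) (simp add: add.commute)
    qed
    then show ?thesis
      unfolding s_def using i integral_lborel_translation[of f "inverse (real (Suc n)) *\<^sub>R v"] by simp
  qed
  have lim: "(\<lambda>n. s n x) \<longlonglongrightarrow> f' x v" for x
  proof -
    have "((\<lambda>h. (f (h *\<^sub>R v + x) - f (0 *\<^sub>R v + x)) / h) \<longlongrightarrow> f' (0 *\<^sub>R v + x) v) (at 0)"
      using line[of x 0] by (simp add: DERIV_def)
    from filterlim_compose[OF this filterlim_atI[OF LIMSEQ_inverse_real_of_nat]]
    have "(\<lambda>n. (f (inverse (real (Suc n)) *\<^sub>R v + x) - f (0 *\<^sub>R v + x)) / inverse (real (Suc n)))
        \<longlonglongrightarrow> f' (0 *\<^sub>R v + x) v"
      by simp
    then show ?thesis by (simp add: s_def divide_inverse)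
  qed
  have bound: "norm (s n x) \<le> w x" for n x
  proof -
    let ?h = "inverse (real (Suc n))"
    have h: "0 < ?h" "?h \<le> 1" by (auto simp: inverse_le_1_iff)
    obtain z where z: "f (?h *\<^sub>R v + x) - f (0 *\<^sub>R v + x) = (?h - 0) * f' (z *\<^sub>R v + x) v"
      using MVT2[OF h(1) line, of x] by blast
    have e: "s n x = f' (z *\<^sub>R v + x) v"
      using z by (simp add: s_def)
    show ?thesis
    proof (cases "norm x \<le> R + norm v")
      case True
      then show ?thesis using B by (simp add: e w_def)
    next
      case False
      have "norm (?h *\<^sub>R v) \<le> norm v"
        using h by (simp add: mult_left_le_one_le)
      then have "R < norm (?h *\<^sub>R v + x)"
        using False norm_triangle_ineq2[of x "- (?h *\<^sub>R v)"] by (simp add: add.commute)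
      moreover have "R < norm x" using False norm_ge_zero[of v] by linarith
      ultimately have "s n x = 0" using supp by (simp add: s_def)
      then show ?thesis by (simp add: w_def B_def)
    qed
  qed
  have w: "integrable lborel w"
    unfolding w_def
    using emeasure_lborel_cball_finite[of 0 "R + norm v"]
    by (intro integrable_mult_right integrable_real_indicator) (simp_all add: less_top)
  have "(\<lambda>n. integral\<^sup>L lborel (s n)) \<longlonglongrightarrow> integral\<^sup>L lborel (\<lambda>x. f' x v)"
  proof (rule integral_dominated_convergence[OF _ _ w])
    show "s n \<in> borel_measurable lborel" for n
      unfolding s_def by measurable
  qed (use lim bound in auto)
  then show ?thesis
    unfolding s0 by (simp add: LIMSEQ_const_iff)
qed

text \<open>A building block for a cutoff of class C^1, which is enough because the cutoff is
  differentiated only once.\<close>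

lemma has_real_derivative_pos_square:
  "((\<lambda>t. (max 0 t)\<^sup>2) has_real_derivative 2 * max 0 t) (at t)"
proof (cases "t = 0")
  case True
  have "((\<lambda>h::real. (max 0 h)\<^sup>2 / h) \<longlongrightarrow> 0) (at 0)"
  proof (rule Lim_null_comparison)
    show "\<forall>\<^sub>F h in at 0. norm ((max 0 h)\<^sup>2 / h) \<le> \<bar>h::real\<bar>"
      by (rule always_eventually) (auto simp: max_def power2_eq_square)
    show "((\<lambda>h. \<bar>h::real\<bar>) \<longlongrightarrow> 0) (at 0)"
      using tendsto_rabs_zero[OF tendsto_ident_at] .
  qed
  then show ?thesis using True by (simp add: DERIV_def)
next
  case False
  then consider "t > 0" | "t < 0" by linarith
  then show ?thesis
  proof cases
    case 1
    have "((\<lambda>t. t\<^sup>2) has_real_derivative 2 * max 0 t) (at t)"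
      using 1 by (auto intro!: derivative_eq_intros)
    then show ?thesis
      by (rule has_field_derivative_transform_within_open[of _ _ _ "{0<..}"]) (use 1 in auto)
  next
    case 2
    have "((\<lambda>t. 0) has_real_derivative 2 * max 0 t) (at t)"
      using 2 by (auto intro!: derivative_eq_intros)
    then show ?thesis
      by (rule has_field_derivative_transform_within_open[of _ _ _ "{..<0}"]) (use 2 in auto)
  qed
qed

text \<open>The thresholds 1 and 4 are the squares of 1 and 2, since \<open>s\<close> is evaluated
  at squared norms and the dilation factor is 2. The last property makes the weight of
  \<open>integral_shell_divergence\<close> nonnegative.\<close>

lemma cutoff_exists:
  obtains s s' :: "real \<Rightarrow> real" where
    "\<And>t. (s has_real_derivative s' t) (at t)" "continuous_on UNIV s'"
    "\<And>t. t \<le> 1 \<Longrightarrow> s t = 1" "\<And>t. t \<ge> 4 \<Longrightarrow> s t = 0"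
    "\<And>t. t \<le> 1 \<Longrightarrow> s' t = 0" "\<And>t. t \<ge> 4 \<Longrightarrow> s' t = 0"
    "\<And>t. t \<ge> 0 \<Longrightarrow> s (4 * t) \<le> s t"
proof -
  define a where "a t = (max 0 t)\<^sup>2" for t :: real
  define D where "D t = a (4 - t) + a (t - 1)" for t
  define s where "s t = a (4 - t) / D t" for t
  define a' where "a' t = 2 * max 0 t" for t :: real
  define s' where "s' t = (- a' (4 - t) * D t - a (4 - t) * (- a' (4 - t) + a' (t - 1))) / (D t)\<^sup>2" for t
  \<comment> \<open>\<open>4 - t\<close> and \<open>t - 1\<close> are never both
    nonpositive.\<close>
  have Dpos: "D t > 0" for t
    by (cases "t < 4") (auto simp: D_def a_def add_pos_nonneg)
  have da: "(a has_real_derivative a' t) (at t)" for t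
    unfolding a_def a'_def by (rule has_real_derivative_pos_square)
  have d1: "((\<lambda>t. a (4 - t)) has_real_derivative - a' (4 - t)) (at t)" for t
  proof -
    have "((\<lambda>t. 4 - t) has_real_derivative - 1) (at t)"
      by (auto intro!: derivative_eq_intros)
    from DERIV_chain2[OF da this] show ?thesis by simp
  qed
  have d2: "((\<lambda>t. a (t - 1)) has_real_derivative a' (t - 1)) (at t)" for t
  proof -
    have "((\<lambda>t. t - 1) has_real_derivative 1) (at t)"
      by (auto intro!: derivative_eq_intros)
    from DERIV_chain2[OF da this] show ?thesis by simp
  qed
  have dD: "(D has_real_derivative - a' (4 - t) + a' (t - 1)) (at t)" for t
    unfolding D_def by (intro DERIV_add d1 d2)
  have ds: "(s has_real_derivative s' t) (at t)" for t
    unfolding s_def s'_def power2_eq_square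
    by (rule DERIV_divide[OF d1 dD]) (use Dpos[of t] in simp)
  have ca: "continuous_on UNIV a" "continuous_on UNIV a'"
    unfolding a_def a'_def by (intro continuous_intros)+
  have cs: "continuous_on UNIV s'"
    unfolding s'_def D_def using Dpos
    by (intro continuous_intros continuous_on_compose2[OF ca(1)] continuous_on_compose2[OF ca(2)])
      (auto simp: D_def less_le)
  show ?thesis
  proof (rule that[OF ds cs])
    show "s t = 1" "s' t = 0" if "t \<le> 1" for t
      using Dpos[of t] that by (auto simp: s_def s'_def D_def a_def a'_def)
    show "s t = 0" "s' t = 0" if "t \<ge> 4" for t
      using that by (auto simp: s_def s'_def a_def a'_def)
    fix t :: real assume t: "t \<ge> 0"
    have "a (4 - 4 * t) \<le> a (4 - t)" "a (t - 1) \<le> a (4 * t - 1)"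
      unfolding a_def using t by (auto intro!: power_mono)
    moreover have "a u \<ge> 0" for u by (simp add: a_def)
    ultimately have "a (4 - 4 * t) * a (t - 1) \<le> a (4 - t) * a (4 * t - 1)"
      by (intro mult_mono) auto
    then show "s (4 * t) \<le> s t"
      unfolding s_def using Dpos[of t] Dpos[of "4 * t"]
      by (simp add: divide_simps D_def algebra_simps)
  qed
qed


text \<open>The values of the weight \<phi> at the dilates of a point by powers of 2 telescope to 1,
  so integrating against \<phi> means integrating over the quotient. Integration by parts leaves two
  boundary terms, \<open>g\<close> and \<open>g2\<close>. The degree of \<open>F\<close> is the one
  for which \<open>g2\<close> is the pullback of \<open>g\<close> under doubling, Jacobian included,
  so their integrals cancel.\<close>

lemma integral_shell_divergence:
  fixes F :: "'a::euclidean_space \<Rightarrow> real"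
  assumes dF: "\<And>x. x \<noteq> 0 \<Longrightarrow> (F has_derivative F' x) (at x)"
    and cF': "continuous_on (- {0}) (\<lambda>x. F' x v)"
    and hom: "\<And>x. x \<noteq> 0 \<Longrightarrow> F ((1/2) *\<^sub>R x) = 2 ^ (DIM('a) - 1) * F x"
    and ds: "\<And>t. (s has_real_derivative s' t) (at t)" and cs': "continuous_on UNIV s'"
    and s: "\<And>t. t \<le> 1 \<Longrightarrow> s t = 1" "\<And>t. t \<ge> 4 \<Longrightarrow> s t = 0"
    and s': "\<And>t. t \<le> 1 \<Longrightarrow> s' t = 0" "\<And>t. t \<ge> 4 \<Longrightarrow> s' t = 0"
    and k: "k > 0"
  defines "\<phi> \<equiv> \<lambda>z::'a. s (k\<^sup>2 * (z \<bullet> z)) - s (4 * (k\<^sup>2 * (z \<bullet> z)))"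
  shows "continuous_on UNIV (\<lambda>z. \<phi> z * F' z v)"
    and "integrable lborel (\<lambda>z. \<phi> z * F' z v)"
    and "integral\<^sup>L lborel (\<lambda>z. \<phi> z * F' z v) = 0"
proof -
  have cs: "continuous_on UNIV s"
    using ds by (meson DERIV_isCont continuous_at_imp_continuous_on)
  have cF: "continuous_on (- {0}) F"
    using dF by (metis Compl_iff continuous_at_imp_continuous_on has_derivative_continuous insertI1)
  have sq: "k\<^sup>2 * (z \<bullet> z) = (k * norm z)\<^sup>2" for z :: 'a
    by (simp add: power_mult_distrib power2_norm_eq_inner)
  \<comment> \<open>The bounds \<open>small\<close> and \<open>large\<close> confine \<phi> and the
    derivatives of the cutoffs to a shell, so every integrand extends by 0 over the origin and has
    compact support.\<close>
  have small: "4 * (k\<^sup>2 * (z \<bullet> z)) \<le> 1" "k\<^sup>2 * (z \<bullet> z) \<le> 1" if "norm z < 1 / (2 * k)" for z :: 'a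
  proof -
    have "2 * (k * norm z) \<le> 1" using that k by (simp add: field_simps)
    then have "(2 * (k * norm z))\<^sup>2 \<le> 1" using k by (intro power_le_one) auto
    then show "4 * (k\<^sup>2 * (z \<bullet> z)) \<le> 1" unfolding sq by (simp add: power_mult_distrib)
    then show "k\<^sup>2 * (z \<bullet> z) \<le> 1"
      using mult_nonneg_nonneg[of "k\<^sup>2" "z \<bullet> z"] by simp
  qed
  have large: "k\<^sup>2 * (z \<bullet> z) \<ge> 4" "4 * (k\<^sup>2 * (z \<bullet> z)) \<ge> 4" if "2 / k < norm z" for z :: 'a
  proof -
    have "2 \<le> k * norm z" using that k by (simp add: field_simps)
    then have "2\<^sup>2 \<le> (k * norm z)\<^sup>2" by (intro power_mono) auto
    then show "k\<^sup>2 * (z \<bullet> z) \<ge> 4" unfolding sq by simp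
    then show "4 * (k\<^sup>2 * (z \<bullet> z)) \<ge> 4" by simp
  qed
  define g where "g z = s' (k\<^sup>2 * (z \<bullet> z)) * (2 * k\<^sup>2 * (z \<bullet> v)) * F z" for z
  define g2 where "g2 z = s' (4 * (k\<^sup>2 * (z \<bullet> z))) * (8 * k\<^sup>2 * (z \<bullet> v)) * F z" for z
  let ?p = "\<lambda>z. \<phi> z * F' z v"
  have d: "0 < 1 / (2 * k)" using k by simp
  have cp: "continuous_on UNIV ?p"
    by (rule continuous_on_extend_zero[OF _ d])
      (auto simp: \<phi>_def small s intro!: continuous_intros continuous_on_compose2[OF cs] cF')
  have cg: "continuous_on UNIV g"
    by (rule continuous_on_extend_zero[OF _ d])
      (auto simp: g_def small s' intro!: continuous_intros continuous_on_compose2[OF cs'] cF)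
  have cg2: "continuous_on UNIV g2"
    by (rule continuous_on_extend_zero[OF _ d])
      (auto simp: g2_def small s' intro!: continuous_intros continuous_on_compose2[OF cs'] cF)
  have ip: "integrable lborel ?p"
    by (rule integrable_compact_support[OF cp, of "2 / k"]) (simp add: \<phi>_def large s)
  have ig: "integrable lborel g"
    by (rule integrable_compact_support[OF cg, of "2 / k"]) (simp add: g_def large s')
  have ig2: "integrable lborel g2"
    by (rule integrable_compact_support[OF cg2, of "2 / k"]) (simp add: g2_def large s')
  have dphi: "(\<phi> has_derivative (\<lambda>h. s' (k\<^sup>2 * (z \<bullet> z)) * (2 * k\<^sup>2 * (z \<bullet> h)) -
      s' (4 * (k\<^sup>2 * (z \<bullet> z))) * (8 * k\<^sup>2 * (z \<bullet> h)))) (at z)" for z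
  proof -
    have ds': "(s has_derivative (\<lambda>h. s' t * h)) (at t)" for t
      using ds[of t] by (simp add: has_field_derivative_def)
    have q: "((\<lambda>z. z \<bullet> z) has_derivative (\<lambda>h. 2 * (z \<bullet> h))) (at z)"
      by (auto intro!: derivative_eq_intros simp: inner_commute)
    have 1: "((\<lambda>z. k\<^sup>2 * (z \<bullet> z)) has_derivative (\<lambda>h. k\<^sup>2 * (2 * (z \<bullet> h)))) (at z)"
      by (rule has_derivative_mult_right[OF q])
    have 2: "((\<lambda>z. 4 * (k\<^sup>2 * (z \<bullet> z))) has_derivative (\<lambda>h. 4 * (k\<^sup>2 * (2 * (z \<bullet> h))))) (at z)"
      by (rule has_derivative_mult_right[OF 1])
    show ?thesis
      unfolding \<phi>_def
      using has_derivative_diff[OF has_derivative_compose[OF 1 ds'] has_derivative_compose[OF 2 ds']]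
      by (simp add: mult_ac)
  qed
  define H' where "H' z h = \<phi> z * F' z h + (s' (k\<^sup>2 * (z \<bullet> z)) * (2 * k\<^sup>2 * (z \<bullet> h)) -
      s' (4 * (k\<^sup>2 * (z \<bullet> z))) * (8 * k\<^sup>2 * (z \<bullet> h))) * F z" for z h
  have dH: "((\<lambda>z. \<phi> z * F z) has_derivative H' z) (at z)" for z
  proof (cases "z = 0")
    case True
    have "((\<lambda>z. \<phi> z * F z) has_derivative (\<lambda>_. 0)) (at z)"
      by (rule has_derivative_transform_within_open[of "\<lambda>_. 0" _ _ _ "ball 0 (1 / (2 * k))"])
        (use k True in \<open>auto simp: \<phi>_def small s\<close>)
    moreover have "H' z = (\<lambda>_. 0)"
      using True s(1)[of 0] s'(1)[of 0] by (auto simp: H'_def \<phi>_def)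
    ultimately show ?thesis by simp
  next
    case False
    show ?thesis
      unfolding H'_def by (rule has_derivative_mult[OF dphi dF[OF False]])
  qed
  have H'v: "H' z v = ?p z + (g z - g2 z)" for z
    by (simp add: H'_def g_def g2_def algebra_simps)
  have "integral\<^sup>L lborel (\<lambda>z. H' z v) = 0"
  proof (rule integral_directional_derivative_zero[OF dH])
    show "continuous_on UNIV (\<lambda>z. H' z v)"
      unfolding H'v by (intro continuous_intros cp cg cg2)
    show "\<phi> z * F z = 0" if "2 / k < norm z" for z
      using large[OF that] s by (simp add: \<phi>_def)
  qed
  moreover have "integral\<^sup>L lborel g = integral\<^sup>L lborel g2"
  proof -
    have e: "2 ^ DIM('a) * g (2 *\<^sub>R z) = g2 z" for z
    proof (cases "z = 0")
      case False
      have n: "2 * 2 ^ (DIM('a) - 1) = (2::real) ^ DIM('a)"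
        using power_minus_mult[OF DIM_positive[where 'a='a], of "2::real"] by (simp add: mult.commute)
      have "F z = 2 ^ (DIM('a) - 1) * F (2 *\<^sub>R z)"
        using hom[of "2 *\<^sub>R z"] False by simp
      then have "g2 z = 2 * 2 ^ (DIM('a) - 1) * g (2 *\<^sub>R z)"
        by (simp add: g_def g2_def mult_ac)
      then show ?thesis unfolding n by simp
    qed (simp add: g_def g2_def)
    have "integral\<^sup>L lborel g = 2 ^ DIM('a) * integral\<^sup>L lborel (\<lambda>z. g (2 *\<^sub>R z))"
      using integral_lborel_scale[OF borel_measurable_continuous_onI[OF cg], of 2] by simp
    then show ?thesis
      by (simp only: e flip: integral_mult_right_zero)
  qed
  ultimately show "integral\<^sup>L lborel ?p = 0"
    unfolding H'v using ip ig ig2 by simp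
  show "continuous_on UNIV ?p" by (rule cp)
  show "integrable lborel ?p" by (rule ip)
qed

text \<open>Weighted by \<phi>, the divergence is continuous and nonnegative with integral zero,
  hence zero everywhere; it remains to choose \<phi> nonzero at \<open>x\<close>.\<close>

lemma homogeneous_divergence_zero:
  fixes F :: "'i \<Rightarrow> 'a::euclidean_space \<Rightarrow> real"
  assumes dF: "\<And>i x. i \<in> I \<Longrightarrow> x \<noteq> 0 \<Longrightarrow> (F i has_derivative F' i x) (at x)"
    and cF': "\<And>i. i \<in> I \<Longrightarrow> continuous_on (- {0}) (\<lambda>x. F' i x (v i))"
    and hom: "\<And>i x. i \<in> I \<Longrightarrow> x \<noteq> 0 \<Longrightarrow> F i ((1/2) *\<^sub>R x) = 2 ^ (DIM('a) - 1) * F i x"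
    and nonneg: "\<And>x. x \<noteq> 0 \<Longrightarrow> 0 \<le> (\<Sum>i\<in>I. F' i x (v i))"
    and x: "x \<noteq> 0"
  shows "(\<Sum>i\<in>I. F' i x (v i)) = 0"
proof -
  obtain s s' :: "real \<Rightarrow> real" where
    ds: "\<And>t. (s has_real_derivative s' t) (at t)" and cs': "continuous_on UNIV s'"
    and s: "\<And>t. t \<le> 1 \<Longrightarrow> s t = 1" "\<And>t. t \<ge> 4 \<Longrightarrow> s t = 0"
    and s': "\<And>t. t \<le> 1 \<Longrightarrow> s' t = 0" "\<And>t. t \<ge> 4 \<Longrightarrow> s' t = 0"
    and mono: "\<And>t. t \<ge> 0 \<Longrightarrow> s (4 * t) \<le> s t"
    using cutoff_exists by metis
  \<comment> \<open>This scaling gives \<phi> the value \<open>s 1 - s 4 = 1\<close> at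
    \<open>x\<close>.\<close>
  define k where "k = 1 / norm x"
  have k: "k > 0" using x by (simp add: k_def)
  define \<phi> where "\<phi> z = s (k\<^sup>2 * (z \<bullet> z)) - s (4 * (k\<^sup>2 * (z \<bullet> z)))" for z :: 'a
  have phi_nonneg: "0 \<le> \<phi> z" for z
    unfolding \<phi>_def using mono[of "k\<^sup>2 * (z \<bullet> z)"] by simp
  note shell = integral_shell_divergence[OF dF cF' hom ds cs' s s' k, folded \<phi>_def]
  define q where "q z = \<phi> z * (\<Sum>i\<in>I. F' i z (v i))" for z
  have q: "q = (\<lambda>z. \<Sum>i\<in>I. \<phi> z * F' i z (v i))"
    by (simp add: q_def sum_distrib_left fun_eq_iff)
  have cq: "continuous_on UNIV q"
    unfolding q by (intro continuous_on_sum shell(1))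
  have iq: "integrable lborel q"
    unfolding q by (intro Bochner_Integration.integrable_sum shell(2))
  have "integral\<^sup>L lborel q = 0"
    unfolding q by (subst Bochner_Integration.integral_sum) (simp_all add: shell)
  then have hi: "(q has_integral 0) UNIV"
    using has_integral_integral_lborel[OF iq] by simp
  have q_nonneg: "0 \<le> q z" for z
  proof (cases "z = 0")
    case True
    then show ?thesis using s(1)[of 0] by (simp add: q_def \<phi>_def)
  next
    case False
    then show ?thesis unfolding q_def by (intro mult_nonneg_nonneg phi_nonneg nonneg)
  qed
  let ?B = "cbox (x - One) (x + One)"
  have xB: "x \<in> ?B" by (simp add: mem_box algebra_simps)
  have ne: "box (x - One) (x + One) \<noteq> {}" by (simp add: box_ne_empty algebra_simps)
  have int: "q integrable_on ?B"
    by (intro integrable_continuous continuous_on_subset[OF cq]) auto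
  have "integral ?B q \<le> 0"
    using integral_subset_le[of ?B UNIV q] int hi q_nonneg by (auto simp: integral_unique)
  moreover have "integral ?B q \<ge> 0"
    by (rule integral_nonneg[OF int]) (rule q_nonneg)
  ultimately have "integral ?B q = 0" by simp
  then have "q x = 0"
    using integral_cbox_eq_0_iff[OF continuous_on_subset[OF cq] ne] xB q_nonneg by auto
  moreover have "\<phi> x = 1"
  proof -
    have "k\<^sup>2 * (x \<bullet> x) = 1"
      using x by (simp add: k_def power_divide power2_norm_eq_inner)
    then show ?thesis using s by (simp add: \<phi>_def)
  qed
  ultimately show ?thesis by (simp add: q_def)
qed

section \<open>Subharmonic functions on complex lines\<close>

lemma local_max_second_derivative:
  fixes f f' :: "real \<Rightarrow> real"
  assumes r: "r > 0" and max: "\<And>t. \<bar>t\<bar> < r \<Longrightarrow> f t \<le> f 0"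
    and d1: "\<And>t. \<bar>t\<bar> < r \<Longrightarrow> (f has_real_derivative f' t) (at t)"
    and d2: "(f' has_real_derivative l) (at 0)"
  shows "l \<le> 0"
proof (rule ccontr)
  assume "\<not> l \<le> 0"
  then have l: "l > 0" by simp
  have "f' 0 = 0"
    by (rule DERIV_local_max[OF d1 r]) (use max r in auto)
  obtain d where d: "d > 0" "\<And>h. 0 < h \<Longrightarrow> h < d \<Longrightarrow> f' 0 < f' (0 + h)"
    using DERIV_pos_inc_right[OF d2 l] by blast
  define h where "h = min r d / 2"
  have h: "0 < h" "h < r" "h < d" using r d by (auto simp: h_def)
  obtain z where z: "0 < z" "z < h" "f h - f 0 = (h - 0) * f' z"
    using MVT2[OF h(1), of f f'] d1 h by auto
  have "f' z > 0" using d(2)[of z] z h \<open>f' 0 = 0\<close> by simp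
  then have "f h > f 0" using z h by (simp add: algebra_simps)
  then show False using max[of h] h by simp
qed

text \<open>The classical maximum principle: a small multiple of the squared modulus makes the
  Laplacian strictly positive, which is incompatible with an interior maximum on a large
  disc.\<close>

lemma subharmonic_plane_le_zero:
  fixes u :: "complex \<Rightarrow> real" and ux uxx uy uyy :: "complex \<Rightarrow> real"
  assumes cont: "continuous_on UNIV u"
    and x1: "\<And>z. ((\<lambda>t. u (z + of_real t)) has_real_derivative ux z) (at 0)"
    and x2: "\<And>z. ((\<lambda>t. ux (z + of_real t)) has_real_derivative uxx z) (at 0)"
    and y1: "\<And>z. ((\<lambda>t. u (z + \<i> * of_real t)) has_real_derivative uy z) (at 0)"
    and y2: "\<And>z. ((\<lambda>t. uy (z + \<i> * of_real t)) has_real_derivative uyy z) (at 0)"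
    and sub: "\<And>z. uxx z + uyy z \<ge> 0"
    and inf: "(u \<longlongrightarrow> 0) at_infinity"
  shows "u z0 \<le> 0"
proof (rule ccontr)
  assume "\<not> u z0 \<le> 0"
  then have pos: "u z0 > 0" by simp
  have "\<forall>\<^sub>F z in at_infinity. dist (u z) 0 < u z0 / 2"
    using inf pos by (intro tendstoD) auto
  then obtain R0 where R0: "\<And>z. cmod z \<ge> R0 \<Longrightarrow> \<bar>u z\<bar> < u z0 / 2"
    unfolding eventually_at_infinity by (auto simp: dist_real_def)
  define R where "R = max (max R0 (cmod z0)) 1"
  have R: "R \<ge> R0" "R \<ge> cmod z0" "R > 0" by (auto simp: R_def)
  \<comment> \<open>Makes the perturbation at radius \<open>R\<close> equal to
    \<open>u z0 / 4\<close>. On the boundary circle \<open>w\<close> then stays below 3/4 of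
    \<open>u z0\<close>, so its maximum over the disc lies inside.\<close>
  define e where "e = u z0 / (4 * R\<^sup>2)"
  have e: "e > 0" using pos R by (simp add: e_def)
  define w where "w z = u z + e * (cmod z)\<^sup>2" for z
  have "continuous_on (cball 0 R) w"
    unfolding w_def by (intro continuous_intros continuous_on_subset[OF cont]) auto
  moreover have "cball 0 R \<noteq> ({} :: complex set)" using R by simp
  ultimately have "\<exists>m\<in>cball 0 R. \<forall>z\<in>cball 0 R. w z \<le> w m"
    by (intro continuous_attains_sup) auto
  then obtain m where m: "m \<in> cball 0 R" "\<And>z. z \<in> cball 0 R \<Longrightarrow> w z \<le> w m"
    by blast
  have "cmod m < R"
  proof (rule ccontr)
    assume "\<not> cmod m < R"
    then have mR: "cmod m = R" using m(1) by simp
    have "w m < u z0 / 2 + e * R\<^sup>2"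
      using R0[of m] mR R by (simp add: w_def)
    also have "\<dots> = 3 / 4 * u z0" using R by (simp add: e_def)
    also have "\<dots> < u z0" using pos by simp
    also have "\<dots> \<le> w z0" using e by (simp add: w_def)
    finally show False using m(2)[of z0] R by simp
  qed
  then have r: "R - cmod m > 0" by simp
  have le: "w (m + d) \<le> w m" if "cmod d < R - cmod m" for d
    using that norm_triangle_ineq[of m d] by (intro m(2)) simp
  \<comment> \<open>The hypotheses speak of derivatives at parameter 0 for every base point; moving
    the base point gives them at every parameter.\<close>
  have shift: "((\<lambda>t. g (z + c * of_real t)) has_real_derivative g' (z + c * of_real t0)) (at t0)"
    if "\<And>z. ((\<lambda>t. g (z + c * of_real t)) has_real_derivative g' z) (at 0)" for g g' :: "complex \<Rightarrow> real" and c z t0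
    using that[of "z + c * of_real t0"] DERIV_shift[of "\<lambda>t. g (z + c * of_real t)" "g' (z + c * of_real t0)" 0 t0]
    by (simp add: algebra_simps)
  have xd: "((\<lambda>t. e * (cmod (m + of_real t))\<^sup>2) has_real_derivative e * (2 * (Re m + t))) (at t)" for t
    unfolding cmod_power2 by (auto intro!: derivative_eq_intros simp: algebra_simps)
  have yd: "((\<lambda>t. e * (cmod (m + \<i> * of_real t))\<^sup>2) has_real_derivative e * (2 * (Im m + t))) (at t)" for t
    unfolding cmod_power2 by (auto intro!: derivative_eq_intros simp: algebra_simps)
  have "uxx m + e * 2 \<le> 0"
  proof (rule local_max_second_derivative[OF r])
    show "w (m + of_real t) \<le> w (m + of_real 0)" if "\<bar>t\<bar> < R - cmod m" for t
      using le[of "of_real t"] that by simp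
    show "((\<lambda>t. w (m + of_real t)) has_real_derivative ux (m + of_real t) + e * (2 * (Re m + t))) (at t)" for t
      unfolding w_def using shift[of u 1 ux m t] x1 by (intro DERIV_add xd) simp
    show "((\<lambda>t. ux (m + of_real t) + e * (2 * (Re m + t))) has_real_derivative uxx m + e * 2) (at 0)"
      by (intro DERIV_add x2) (auto intro!: derivative_eq_intros)
  qed
  moreover have "uyy m + e * 2 \<le> 0"
  proof (rule local_max_second_derivative[OF r])
    show "w (m + \<i> * of_real t) \<le> w (m + \<i> * of_real 0)" if "\<bar>t\<bar> < R - cmod m" for t
      using le[of "\<i> * of_real t"] that by (simp add: norm_mult)
    show "((\<lambda>t. w (m + \<i> * of_real t)) has_real_derivative uy (m + \<i> * of_real t) + e * (2 * (Im m + t))) (at t)" for t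
      unfolding w_def using shift[of u \<i> uy m t] y1 by (intro DERIV_add yd) simp
    show "((\<lambda>t. uy (m + \<i> * of_real t) + e * (2 * (Im m + t))) has_real_derivative uyy m + e * 2) (at 0)"
      by (intro DERIV_add y2) (auto intro!: derivative_eq_intros)
  qed
  ultimately show False using sub[of m] e by simp
qed

text \<open>The product of \<open>u\<close> with the squared norm is unchanged by halving, so its
  bound on the compact shell between radii 1 and 2 propagates outwards.\<close>

lemma homogeneous_bound:
  fixes u :: "'a::euclidean_space \<Rightarrow> real"
  assumes cont: "continuous_on (- {0}) u"
    and hom: "\<And>x. x \<noteq> 0 \<Longrightarrow> u ((1/2) *\<^sub>R x) = 4 * u x"
  obtains C where "\<And>x. 1 \<le> norm x \<Longrightarrow> \<bar>u x\<bar> \<le> C / (norm x)\<^sup>2"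
proof -
  let ?K = "cball 0 2 - ball (0::'a) 1"
  have "compact (u ` ?K)"
    by (intro compact_continuous_image continuous_on_subset[OF cont] compact_diff) auto
  then have "bounded (u ` ?K)" by (rule compact_imp_bounded)
  then obtain B where B: "\<forall>x\<in>?K. \<bar>u x\<bar> \<le> B"
    unfolding bounded_iff by auto
  have B': "\<bar>u x\<bar> \<le> B" if "1 \<le> norm x" "norm x \<le> 2" for x
    using B that by auto
  have main: "\<bar>u x\<bar> * (norm x)\<^sup>2 \<le> 4 * \<bar>B\<bar>" if "1 \<le> norm x" "norm x \<le> 2 ^ Suc n" for x n
    using that
  proof (induction n arbitrary: x)
    case 0
    have "\<bar>u x\<bar> * (norm x)\<^sup>2 \<le> \<bar>B\<bar> * 2\<^sup>2"
      using 0 B'[of x] by (intro mult_mono power_mono) auto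
    then show ?case by simp
  next
    case (Suc n)
    show ?case
    proof (cases "norm x \<le> 2")
      case True
      have "\<bar>u x\<bar> * (norm x)\<^sup>2 \<le> \<bar>B\<bar> * 2\<^sup>2"
        using True Suc.prems B'[of x] by (intro mult_mono power_mono) auto
      then show ?thesis by simp
    next
      case False
      have "\<bar>u ((1/2) *\<^sub>R x)\<bar> * (norm ((1/2) *\<^sub>R x))\<^sup>2 \<le> 4 * \<bar>B\<bar>"
        using False Suc.prems by (intro Suc.IH) auto
      moreover have "x \<noteq> 0" using False by auto
      ultimately show ?thesis using hom[of x] by (simp add: power_divide abs_mult)
    qed
  qed
  show ?thesis
  proof (rule that)
    fix x :: 'a assume x: "1 \<le> norm x"
    obtain n where "norm x < 2 ^ n"
      using real_arch_pow[of 2 "norm x"] by auto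
    then have "norm x \<le> 2 ^ Suc n" by (simp add: less_imp_le order_trans[of _ "2 ^ n"])
    from main[OF x this] show "\<bar>u x\<bar> \<le> 4 * \<bar>B\<bar> / (norm x)\<^sup>2"
      using x by (subst pos_le_divide_eq) auto
  qed
qed

section \<open>Charts of the Hopf surface\<close>

lemma hopf_proj_half: "hopf_proj ((1/2) *\<^sub>R z) = hopf_proj z"
proof -
  have e: "((1/2::real) powi k) *\<^sub>R ((1/2) *\<^sub>R z) = ((1/2) powi (k + 1)) *\<^sub>R z" for k :: int
    by (simp add: power_int_add)
  have "surj (\<lambda>k::int. k + 1)" by (metis diff_add_cancel surj_def)
  then have "range ((\<lambda>k::int. ((1/2::real) powi k) *\<^sub>R z) \<circ> (\<lambda>k. k + 1)) = range (\<lambda>k::int. ((1/2::real) powi k) *\<^sub>R z)"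
    by (metis image_comp)
  then show ?thesis
    unfolding hopf_proj_def e by (simp only: o_def)
qed

lemma hopf_proj_eqD: "hopf_proj w = hopf_proj z \<Longrightarrow> \<exists>k::int. w = ((1/2::real) powi k) *\<^sub>R z"
proof -
  assume "hopf_proj w = hopf_proj z"
  moreover have "w \<in> hopf_proj w"
    unfolding hopf_proj_def by (rule range_eqI[of _ _ 0]) simp
  ultimately show ?thesis unfolding hopf_proj_def by auto
qed

text \<open>Norms in the ball lie between 3/4 and 5/4 of \<open>norm z\<close>. Their ratios stay
  below 2, so no nontrivial power of the generator relates two points.\<close>

lemma hopf_proj_inj_ball:
  assumes "z \<noteq> 0"
  shows "inj_on hopf_proj (ball z (norm z / 4))"
proof (rule inj_onI)
  fix w w' assume w: "w \<in> ball z (norm z / 4)" and w': "w' \<in> ball z (norm z / 4)"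
    and "hopf_proj w = hopf_proj w'"
  then obtain k :: int where k: "w = ((1/2::real) powi k) *\<^sub>R w'"
    using hopf_proj_eqD by blast
  have n: "norm w = (1/2) powi k * norm w'"
    unfolding k by simp
  have b: "3 / 4 * norm z < norm u" "norm u < 5 / 4 * norm z" if "u \<in> ball z (norm z / 4)" for u
    using that norm_triangle_ineq2[of z u] norm_triangle_ineq2[of u z]
    by (simp_all add: dist_norm norm_minus_commute)
  have z: "norm z > 0" using assms by simp
  consider "k \<ge> 1" | "k \<le> -1" | "k = 0" by linarith
  then show "w = w'"
  proof cases
    case 1
    have "(1/2::real) powi k \<le> (1/2) powi 1"
      by (rule power_int_decreasing[OF 1]) auto
    then have "norm w \<le> 1 / 2 * norm w'"
      unfolding n by (intro mult_right_mono) auto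
    then show ?thesis using b[OF w] b[OF w'] z by linarith
  next
    case 2
    have "(1/2::real) powi (-1) \<le> (1/2) powi k"
      by (rule power_int_decreasing[OF 2]) auto
    then have "2 * norm w' \<le> norm w"
      unfolding n by (intro mult_right_mono) auto
    then show ?thesis using b[OF w] b[OF w'] z by linarith
  next
    case 3
    then show ?thesis using k by simp
  qed
qed

definition hopf_chart :: "(complex^2) set \<Rightarrow> ((complex^2) set, complex^2) chart" where
  "hopf_chart W = (hopf_proj ` W, inv_into W hopf_proj)"

lemma hopf_chart_at:
  assumes "z \<noteq> 0"
  obtains W where "open W" "z \<in> W" "0 \<notin> W" "inj_on hopf_proj W" "hopf_chart W \<in> hopf_atlas"
proof (rule that[of "ball z (norm z / 4)"])
  show "hopf_chart (ball z (norm z / 4)) \<in> hopf_atlas"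
    unfolding hopf_atlas_def hopf_chart_def using hopf_proj_inj_ball[OF assms] assms
    by (intro CollectI exI[of _ "ball z (norm z / 4)"]) auto
qed (use assms hopf_proj_inj_ball in auto)

context
  fixes W assumes inj: "inj_on hopf_proj W"
begin

lemma hopf_chart_coord: "z \<in> W \<Longrightarrow> snd (hopf_chart W) (hopf_proj z) = z"
  using inj by (simp add: hopf_chart_def)

lemma hopf_chart_image: "chart_image (hopf_chart W) = W"
  using inj by (auto simp: chart_image_def hopf_chart_def image_iff)

lemma hopf_chart_inv: "z \<in> W \<Longrightarrow> chart_inv (hopf_chart W) z = hopf_proj z"
  unfolding chart_inv_def hopf_chart_def fst_conv snd_conv
  by (rule inv_into_inv_into_eq) (use inj in \<open>auto simp: bij_betw_def\<close>)

end

text \<open>The inverse is the adjugate over the determinant \<open>D\<close>. The positive factor 1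
  / \<open>D\<close> is kept apart because it drops out of the trace equation.\<close>

lemma hinv_2:
  fixes H :: "complex^2^2"
  assumes herm: "\<And>\<alpha> \<beta>. H $ \<beta> $ \<alpha> = cnj (H $ \<alpha> $ \<beta>)"
    and pos: "\<And>v. v \<noteq> 0 \<Longrightarrow> Re (hform H v v) > 0"
  obtains p q D :: real and r :: complex where "p > 0" "(cmod r)\<^sup>2 < p * q" "D > 0"
    "hinv H 1 1 = of_real (p / D)" "hinv H 2 2 = of_real (q / D)"
    "hinv H 1 2 = r / of_real D" "hinv H 2 1 = cnj r / of_real D"
proof -
  have real: "H $ k $ k = of_real (Re (H $ k $ k))" for k
    using herm[of k k] by (simp add: complex_eq_iff)
  have h21: "H $ 2 $ 1 = cnj (H $ 1 $ 2)" by (rule herm)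
  define q where "q = Re (H $ 1 $ 1)"
  define p where "p = Re (H $ 2 $ 2)"
  define r where "r = - (H $ 2 $ 1)"
  define D where "D = p * q - (cmod r)\<^sup>2"
  have H: "H $ 1 $ 1 = of_real q" "H $ 2 $ 2 = of_real p" "H $ 2 $ 1 = - r" "H $ 1 $ 2 = - cnj r"
    using real[of 1] real[of 2] h21 by (simp_all add: q_def p_def r_def)
  have form: "hform H v v = of_real q * (v $ 1 * cnj (v $ 1)) + - cnj r * v $ 1 * cnj (v $ 2) +
      - r * v $ 2 * cnj (v $ 1) + of_real p * (v $ 2 * cnj (v $ 2))" for v
    by (simp add: hform_def sum_2 H algebra_simps)
  have ax: "axis k (1::complex) $ j = (if j = k then 1 else 0)" for k j :: 2
    by (simp add: axis_def)
  have q: "q > 0"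
    using pos[of "axis 1 1"] by (simp add: form ax)
  have p: "p > 0"
    using pos[of "axis 2 1"] by (simp add: form ax)
  have rr: "r * cnj r = of_real ((cmod r)\<^sup>2)"
    by (rule complex_norm_square[symmetric])
  \<comment> \<open>On this vector the Hermitian form equals \<open>q * D\<close>, so its positivity
    yields that of the determinant.\<close>
  define v :: "complex^2" where "v = (\<chi> k. if k = 1 then r else of_real q)"
  have v12: "v $ 1 = r" "v $ 2 = of_real q" by (simp_all add: v_def)
  have "v \<noteq> 0" using v12 q by auto
  then have "0 < Re (hform H v v)" by (rule pos)
  also have "hform H v v = of_real q * (of_real p * of_real q - r * cnj r)"
    unfolding form v12 by (simp add: algebra_simps)
  also have "\<dots> = of_real (q * D)"
    unfolding rr by (simp add: D_def)
  finally have D: "D > 0" using q by (simp add: zero_less_mult_iff)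
  define M :: "complex^2^2" where "M = (\<chi> i j. (if i = j then (if i = 1 then of_real p else of_real q)
      else if i = 1 then cnj r else r) / of_real D)"
  have M: "M $ 1 $ 1 = of_real p / of_real D" "M $ 2 $ 2 = of_real q / of_real D"
    "M $ 1 $ 2 = cnj r / of_real D" "M $ 2 $ 1 = r / of_real D"
    by (simp_all add: M_def)
  have D': "of_real p * of_real q - r * cnj r = complex_of_real D"
    unfolding rr by (simp add: D_def)
  have HM: "H ** M = mat 1"
    using D D' by (simp add: vec_eq_iff forall_2 matrix_matrix_mult_def sum_2 mat_def H M field_simps)
  have inv: "invertible H"
    using HM by (simp add: invertible_right_inverse) blast
  have "matrix_inv H = matrix_inv H ** (H ** M)"
    unfolding HM by simp
  also have "\<dots> = M"
    unfolding matrix_mul_assoc matrix_inv_left[OF inv] by simp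
  finally have "matrix_inv H = M" .
  then show ?thesis
    using p D by (intro that[of p r q D]) (simp_all add: hinv_def M D_def)
qed

text \<open>Twice the Wirtinger derivative in the \<open>k\<close>-th variable; the factor 1/2 of
  \<open>d_z\<close> is left out.\<close>

definition hol_dir :: "2 \<Rightarrow> (complex^2) \<times> (complex^2)" where
  "hol_dir k = (axis k 1, - axis k \<i>)"

lemma conj_hol_dir: "conj_dir (hol_dir k) = (axis k 1, axis k \<i>)"
  by (simp add: hol_dir_def conj_dir_def)

lemma d_zbar_eq_dC: "d_zbar k u z = dC (conj_dir (hol_dir k)) u z / 2"
  by (simp add: d_zbar_def dC_def conj_hol_dir)

lemma d_z_eq_dC:
  assumes "u differentiable (at z)"
  shows "d_z k u z = dC (hol_dir k) u z / 2"
  using linear_neg[OF linear_frechet_derivative[OF assms], of "axis k \<i>"]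
  by (simp add: d_z_def dC_def hol_dir_def)

text \<open>Differentiating the homogeneity relation, the chain rule puts a factor 1/2 on one side,
  so the multiplier doubles.\<close>

lemma dird_homogeneous:
  fixes u :: "'a::euclidean_space \<Rightarrow> 'b::real_normed_vector"
  assumes S: "open S" and half: "\<And>z. z \<in> S \<Longrightarrow> (1/2) *\<^sub>R z \<in> S" and u: "smooth_on S u"
    and hom: "\<And>z. z \<in> S \<Longrightarrow> u ((1/2) *\<^sub>R z) = k *\<^sub>R u z" and z: "z \<in> S"
  shows "dird v u ((1/2) *\<^sub>R z) = (2 * k) *\<^sub>R dird v u z"
proof -
  have "((\<lambda>z. (1/2::real) *\<^sub>R z) has_derivative (\<lambda>h. (1/2) *\<^sub>R h)) (at z)"
    by (auto intro!: derivative_eq_intros)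
  from has_derivative_compose[OF this smooth_on_has_derivative[OF u half[OF z]]]
  have "((\<lambda>z. u ((1/2) *\<^sub>R z)) has_derivative (\<lambda>h. dird ((1/2) *\<^sub>R h) u ((1/2) *\<^sub>R z))) (at z)" .
  moreover have "((\<lambda>z. k *\<^sub>R u z) has_derivative (\<lambda>h. k *\<^sub>R dird h u z)) (at z)"
    by (intro has_derivative_scaleR_right smooth_on_has_derivative[OF u z])
  then have "((\<lambda>z. u ((1/2) *\<^sub>R z)) has_derivative (\<lambda>h. k *\<^sub>R dird h u z)) (at z)"
    by (rule has_derivative_transform_within_open[OF _ S z]) (simp add: hom)
  ultimately have "(\<lambda>h. dird ((1/2) *\<^sub>R h) u ((1/2) *\<^sub>R z)) = (\<lambda>h. k *\<^sub>R dird h u z)"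
    by (rule has_derivative_unique)
  from fun_cong[OF this, of v] have "(1/2) *\<^sub>R dird v u ((1/2) *\<^sub>R z) = k *\<^sub>R dird v u z"
    using linear_scale[OF smooth_on_linear[OF u half[OF z]], of "1/2" v] by simp
  then have "2 *\<^sub>R ((1/2) *\<^sub>R dird v u ((1/2) *\<^sub>R z)) = 2 *\<^sub>R (k *\<^sub>R dird v u z)"
    by (rule arg_cong)
  then show ?thesis by simp
qed

section \<open>Hermitian harmonic maps from the Hopf surface\<close>

lemma etaC_gform:
  "etaC G F \<xi> \<zeta> x =
    of_real (gform (G (F x)) (dird (fst \<xi>) F x) (dird (fst \<zeta>) F x) -
             gform (G (F x)) (dird (snd \<xi>) F x) (dird (snd \<zeta>) F x)) +
    \<i> * of_real (gform (G (F x)) (dird (fst \<xi>) F x) (dird (snd \<zeta>) F x) +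
                 gform (G (F x)) (dird (snd \<xi>) F x) (dird (fst \<zeta>) F x))"
  unfolding etaC_def FC_def bil_simps gC_complexify by (simp add: algebra_simps)

locale hopf_harmonic_map =
  fixes h :: "((complex^2) set, complex^2) chart \<Rightarrow> complex^2 \<Rightarrow> complex^2^2"
    and N :: "'q topology"
    and B :: "('q, real^'n) chart set"
    and g :: "('q, real^'n) chart \<Rightarrow> real^'n \<Rightarrow> real^'n^'n"
    and f :: "(complex^2) set \<Rightarrow> 'q"
  assumes h: "hermitian_metric hopf_atlas h"
    and N: "smooth_manifold N B"
    and g: "riemannian_metric B g"
    and K: "nonpos_complex_sectional_curvature B g"
    and f: "hermitian_harmonic hopf_topology hopf_atlas h N B g f"
begin

section \<open>The lift to the punctured plane\<close>

definition lift :: "complex^2 \<Rightarrow> 'q" where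
  "lift z = f (hopf_proj z)"

definition cdom :: "('q, real^'n) chart \<Rightarrow> (complex^2) set" where
  "cdom d = {z. z \<noteq> 0 \<and> lift z \<in> fst d}"

definition rep :: "('q, real^'n) chart \<Rightarrow> complex^2 \<Rightarrow> real^'n" where
  "rep d z = snd d (lift z)"

lemma lift_half: "lift ((1/2) *\<^sub>R z) = lift z"
  by (simp only: lift_def hopf_proj_half)

lemma cdom_half: "z \<in> cdom d \<Longrightarrow> (1/2) *\<^sub>R z \<in> cdom d"
  unfolding cdom_def mem_Collect_eq lift_half by simp

lemma rep_half: "rep d ((1/2) *\<^sub>R z) = rep d z"
  by (simp only: rep_def lift_half)

lemma smooth_map: "smooth_map hopf_topology hopf_atlas N B f"
  using f by (simp add: hermitian_harmonic_def)

lemma continuous_map: "continuous_map hopf_topology N f"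
  using smooth_map by (simp add: smooth_map_def)

lemma cdom_cover:
  assumes "z \<noteq> 0"
  obtains d where "d \<in> B" "z \<in> cdom d"
proof -
  have "hopf_proj z \<in> topspace hopf_topology"
    using assms by (auto simp: topspace_hopf_topology)
  then have "lift z \<in> topspace N"
    unfolding lift_def using continuous_map by (rule continuous_map_image_subset_topspace[THEN subsetD, OF _ imageI, rotated])
  then have "lift z \<in> \<Union> (fst ` B)"
    using N by (simp add: smooth_manifold_def)
  then obtain d where "d \<in> B" "lift z \<in> fst d" by blast
  then show ?thesis
    using assms by (intro that) (simp_all add: cdom_def)
qed

lemma is_chart: "d \<in> B \<Longrightarrow> is_chart N d"
  using N by (simp add: smooth_manifold_def)

lemma inj_chart: "d \<in> B \<Longrightarrow> inj_on (snd d) (fst d)"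
proof -
  assume d: "d \<in> B"
  have "topspace (subtopology N (fst d)) = fst d"
    using openin_subset[of N "fst d"] is_chart[OF d] by (auto simp: is_chart_def)
  then show ?thesis
    using homeomorphic_imp_injective_map[of "subtopology N (fst d)" _ "snd d"] is_chart[OF d]
    by (auto simp: is_chart_def)
qed

lemma open_cdom:
  assumes d: "d \<in> B"
  shows "open (cdom d)"
proof -
  have "openin hopf_topology {p \<in> topspace hopf_topology. f p \<in> fst d}"
    using continuous_map is_chart[OF d] by (auto simp: is_chart_def intro: openin_continuous_map_preimage)
  then have "open {z. z \<noteq> 0 \<and> hopf_proj z \<in> {p \<in> topspace hopf_topology. f p \<in> fst d}}"
    by (simp add: openin_hopf_topology)
  moreover have "{z. z \<noteq> 0 \<and> hopf_proj z \<in> {p \<in> topspace hopf_topology. f p \<in> fst d}} = cdom d"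
    by (auto simp: cdom_def lift_def topspace_hopf_topology)
  ultimately show ?thesis by simp
qed

text \<open>Hopf charts are local inverses of the projection, so \<open>rep d\<close> is locally a
  coordinate representation of \<open>f\<close>.\<close>

lemma smooth_rep:
  assumes d: "d \<in> B"
  shows "smooth_on (cdom d) (rep d)"
proof (rule smooth_on_local)
  fix z assume z: "z \<in> cdom d"
  then have "z \<noteq> 0" by (simp add: cdom_def)
  then obtain W where W: "open W" "z \<in> W" "0 \<notin> W" "inj_on hopf_proj W" "hopf_chart W \<in> hopf_atlas"
    by (rule hopf_chart_at)
  have o: "open (W \<inter> cdom d)" using W(1) open_cdom[OF d] by blast
  have "W \<inter> cdom d \<subseteq> snd (hopf_chart W) ` {p \<in> fst (hopf_chart W). f p \<in> fst d}"
  proof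
    fix w assume w: "w \<in> W \<inter> cdom d"
    then show "w \<in> snd (hopf_chart W) ` {p \<in> fst (hopf_chart W). f p \<in> fst d}"
      using hopf_chart_coord[OF W(4), of w]
      by (intro image_eqI[of _ _ "hopf_proj w"]) (auto simp: hopf_chart_def cdom_def lift_def)
  qed
  moreover have "smooth_on (snd (hopf_chart W) ` {p \<in> fst (hopf_chart W). f p \<in> fst d}) (local_rep (hopf_chart W) d f)"
    using smooth_map W(5) d by (simp add: smooth_map_def)
  ultimately have s: "smooth_on (W \<inter> cdom d) (local_rep (hopf_chart W) d f)"
    by (rule smooth_on_subset[rotated])
  have "smooth_on (W \<inter> cdom d) (rep d)"
    by (rule smooth_on_cong[OF o _ s]) (simp add: local_rep_def hopf_chart_inv[OF W(4)] rep_def lift_def)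
  then show "\<exists>T. open T \<and> z \<in> T \<and> smooth_on T (rep d)"
    using o z W(2) by blast
qed

lemma rep_in: "z \<in> cdom d \<Longrightarrow> rep d z \<in> chart_image d"
  by (simp add: rep_def cdom_def chart_image_def)

lemma map_chart:
  assumes d: "d \<in> B"
  shows "map_chart (chart_image d) (g d) (cdom d) (rep d)"
proof
  show "open (chart_image d)" using is_chart[OF d] by (simp add: is_chart_def)
  show "smooth_on (chart_image d) (g d)" using g d by (simp add: riemannian_metric_def)
  show "g d y $ i $ j = g d y $ j $ i" if "y \<in> chart_image d" for y i j
  proof -
    have "transpose (g d y) = g d y" using g d that by (simp add: riemannian_metric_def)
    then have "transpose (g d y) $ j $ i = g d y $ j $ i" by simp
    then show ?thesis by (simp add: transpose_def)
  qed
  show "gform (g d y) v v > 0" if "y \<in> chart_image d" "v \<noteq> 0" for y v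
    using g d that by (simp add: riemannian_metric_def)
  show "open (cdom d)" by (rule open_cdom[OF d])
  show "smooth_on (cdom d) (rep d)" by (rule smooth_rep[OF d])
  show "rep d z \<in> chart_image d" if "z \<in> cdom d" for z by (rule rep_in[OF that])
qed

lemma curvature:
  assumes "d \<in> B" "z \<in> cdom d"
  shows "Re (riem_complex (g d) (rep d z) Z (cnj_vec W) W (cnj_vec Z)) \<le> 0"
  using K assms rep_in by (simp add: nonpos_complex_sectional_curvature_def)

text \<open>The derivative of the transition map carries the derivatives of \<open>rep c\<close> to
  those of \<open>rep d\<close> and is an isometry between the two coefficient matrices. Thus \<eta>
  is a global function although the image of \<open>f\<close> need not lie in one chart, as the
  integration demands.\<close>

lemma etaC_chart_independent:
  assumes c: "c \<in> B" and d: "d \<in> B" and z: "z \<in> cdom c" "z \<in> cdom d"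
  shows "etaC (g c) (rep c) \<xi> \<zeta> z = etaC (g d) (rep d) \<xi> \<zeta> z"
proof -
  let ?q = "lift z"
  have q: "?q \<in> fst c \<inter> fst d" using z by (simp add: cdom_def)
  let ?T = "frechet_derivative (transition c d) (at (rep c z))"
  have "smooth_on (snd c ` (fst c \<inter> fst d)) (transition c d)"
    using N c d by (simp add: smooth_manifold_def)
  then have T: "(transition c d has_derivative ?T) (at (rep c z))"
    by (rule smooth_on_has_derivative) (use q in \<open>simp add: rep_def\<close>)
  have eq: "transition c d (rep c w) = rep d w" if "w \<in> cdom c \<inter> cdom d" for w
  proof -
    have "lift w \<in> fst c" using that by (simp add: cdom_def)
    then show ?thesis
      unfolding transition_def o_def chart_inv_def rep_def by (simp add: inv_into_f_f[OF inj_chart[OF c]])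
  qed
  have rep: "dird v (rep d) z = ?T (dird v (rep c) z)" for v
  proof -
    have "((\<lambda>w. transition c d (rep c w)) has_derivative (\<lambda>v. ?T (dird v (rep c) z))) (at z)"
      by (rule has_derivative_compose[OF smooth_on_has_derivative[OF smooth_rep[OF c] z(1)] T])
    then have "(rep d has_derivative (\<lambda>v. ?T (dird v (rep c) z))) (at z)"
      by (rule has_derivative_transform_within_open[where s="cdom c \<inter> cdom d"])
        (use open_Int[OF open_cdom[OF c] open_cdom[OF d]] z eq in auto)
    then show ?thesis by (simp add: has_derivative_frechetD)
  qed
  have "gform (g c (rep c z)) v w = gform (g d (rep d z)) (?T v) (?T w)" for v w
    using g c d q unfolding riemannian_metric_def rep_def by blast
  then show ?thesis
    unfolding etaC_gform rep by simp
qed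

definition chart_at :: "complex^2 \<Rightarrow> ('q, real^'n) chart" where
  "chart_at z = (SOME d. d \<in> B \<and> z \<in> cdom d)"

text \<open>The chart is chosen pointwise and without any regularity; by \<open>eta_eq\<close> the
  choice is immaterial, and smoothness is then seen in a fixed chart.\<close>

definition eta :: "(complex^2) \<times> (complex^2) \<Rightarrow> (complex^2) \<times> (complex^2) \<Rightarrow> complex^2 \<Rightarrow> complex" where
  "eta \<xi> \<zeta> z = etaC (g (chart_at z)) (rep (chart_at z)) \<xi> \<zeta> z"

lemma eta_eq:
  assumes d: "d \<in> B" "z \<in> cdom d"
  shows "eta \<xi> \<zeta> z = etaC (g d) (rep d) \<xi> \<zeta> z"
proof -
  have "chart_at z \<in> B \<and> z \<in> cdom (chart_at z)"
    unfolding chart_at_def by (rule someI[of "\<lambda>d. d \<in> B \<and> z \<in> cdom d" d]) (use d in blast)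
  then show ?thesis
    unfolding eta_def using etaC_chart_independent d by blast
qed

lemma smooth_eta: "smooth_on (- {0}) (eta \<xi> \<zeta>)"
proof (rule smooth_on_local)
  fix z :: "complex^2" assume "z \<in> - {0}"
  then obtain d where d: "d \<in> B" "z \<in> cdom d"
    using cdom_cover[of z] by blast
  interpret map_chart "chart_image d" "g d" "cdom d" "rep d" by (rule map_chart[OF d(1)])
  have "smooth_on (cdom d) (eta \<xi> \<zeta>)"
    by (rule smooth_on_cong[OF open_U _ smooth_etaC]) (simp add: eta_eq[OF d(1)])
  then show "\<exists>T. open T \<and> z \<in> T \<and> smooth_on T (eta \<xi> \<zeta>)"
    using open_U d(2) by blast
qed

lemma eta_half:
  assumes "z \<noteq> 0"
  shows "eta \<xi> \<zeta> ((1/2) *\<^sub>R z) = 4 *\<^sub>R eta \<xi> \<zeta> z"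
proof -
  obtain d where d: "d \<in> B" "z \<in> cdom d" using cdom_cover[OF assms] .
  interpret map_chart "chart_image d" "g d" "cdom d" "rep d" by (rule map_chart[OF d(1)])
  have D: "dird v (rep d) ((1/2) *\<^sub>R z) = 2 *\<^sub>R dird v (rep d) z" for v
    using dird_homogeneous[OF open_U cdom_half smooth_F, of "1" z v] d(2) by (simp add: rep_half del: scaleR_half_double)
  have C: "complexify (2 *\<^sub>R a) = 2 *s complexify a" for a :: "real^'n"
    by (simp add: complexify_def vec_eq_iff)
  have F: "FC (rep d) \<xi> ((1/2) *\<^sub>R z) = 2 *s FC (rep d) \<xi> z" for \<xi>
    unfolding FC_def D C by (simp add: vec_eq_iff algebra_simps)
  show ?thesis
    unfolding eta_eq[OF d] eta_eq[OF d(1) cdom_half[OF d(2)]] etaC_def rep_half F bil_simps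
    by (simp add: scaleR_conv_of_real)
qed

end

lemma dC_complexify:
  fixes F :: "'a::euclidean_space \<Rightarrow> real^'n"
  assumes "smooth_on S F" "x \<in> S"
  shows "dC \<xi> (\<lambda>x. complex_of_real (F x $ i)) x = FC F \<xi> x $ i"
proof -
  have "bounded_linear (\<lambda>y::real^'n. complex_of_real (y $ i))"
    by (rule bounded_linear_compose[OF bounded_linear_of_real bounded_linear_vec_nth])
  from dird_bounded_linear[OF this assms] show ?thesis
    by (simp add: dC_def FC_def complexify_def)
qed

lemma dC_cong_open:
  assumes "open S" "x \<in> S" "\<And>y. y \<in> S \<Longrightarrow> u y = w y"
  shows "dC \<xi> u x = dC \<xi> w x"
  using frechet_derivative_cong_open[OF assms] by (simp add: dC_def)

lemma smooth_dC: "open S \<Longrightarrow> smooth_on S u \<Longrightarrow> smooth_on S (dC \<xi> u)"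
  unfolding dC_def[abs_def]
  by (intro smooth_on_add smooth_on_mult smooth_on_const smooth_on_dird)

lemma dC_homogeneous:
  fixes u :: "'a::euclidean_space \<Rightarrow> complex"
  assumes "open S" "\<And>z. z \<in> S \<Longrightarrow> (1/2) *\<^sub>R z \<in> S" "smooth_on S u"
    and "\<And>z. z \<in> S \<Longrightarrow> u ((1/2) *\<^sub>R z) = k *\<^sub>R u z" "z \<in> S"
  shows "dC \<xi> u ((1/2) *\<^sub>R z) = (2 * k) *\<^sub>R dC \<xi> u z"
  using dird_homogeneous[OF assms, of "fst \<xi>"] dird_homogeneous[OF assms, of "snd \<xi>"]
  by (simp add: dC_def scaleR_conv_of_real algebra_simps)

abbreviation (input) conj_hol :: "2 \<Rightarrow> (complex^2) \<times> (complex^2)" where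
  "conj_hol k \<equiv> conj_dir (hol_dir k)"

section \<open>The trace condition and the vanishing divergence\<close>

context hopf_harmonic_map
begin

text \<open>The harmonic map equation in a Hopf chart around \<open>z\<close>, freed of positive
  factors. About \<open>h\<close> it retains only that \<open>p\<close>, \<open>q\<close>,
  \<open>r\<close> form a positive definite matrix, which may vary with \<open>z\<close>.\<close>

lemma harmonic_trace:
  assumes d: "d \<in> B" and z: "z \<in> cdom d"
  obtains p q :: real and r :: complex where "p > 0" "(cmod r)\<^sup>2 < p * q"
    "of_real p *s HC (g d) (rep d) (hol_dir 1) (conj_hol 1) z +
     of_real q *s HC (g d) (rep d) (hol_dir 2) (conj_hol 2) z +
     r *s HC (g d) (rep d) (hol_dir 1) (conj_hol 2) z +
     cnj r *s HC (g d) (rep d) (hol_dir 2) (conj_hol 1) z = 0"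
proof -
  interpret map_chart "chart_image d" "g d" "cdom d" "rep d" by (rule map_chart[OF d])
  let ?F = "rep d" and ?G = "g d"
  have "z \<noteq> 0" using z by (simp add: cdom_def)
  then obtain W where W: "open W" "z \<in> W" "0 \<notin> W" "inj_on hopf_proj W" "hopf_chart W \<in> hopf_atlas"
    by (rule hopf_chart_at)
  define c where "c = hopf_chart W"
  define Fl where "Fl = local_rep c d f"
  define Z where "Z = W \<inter> cdom d"
  have Z: "open Z" "z \<in> Z" "\<And>w. w \<in> Z \<Longrightarrow> w \<in> cdom d"
    using W open_U z by (auto simp: Z_def)
  have Fl: "Fl w = ?F w" if "w \<in> Z" for w
    using that by (simp add: Fl_def local_rep_def c_def hopf_chart_inv[OF W(4)] rep_def lift_def Z_def)
  have smF: "smooth_on (cdom d) (\<lambda>x. complex_of_real (?F x $ i))" for i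
    by (rule smooth_on_bounded_linear[OF bounded_linear_of_real open_U smooth_on_component[OF open_U smooth_F]])
  have smFC: "smooth_on (cdom d) (\<lambda>x. FC ?F \<xi> x $ i)" for \<xi> i
    by (rule smooth_on_component[OF open_U smooth_FC])
  \<comment> \<open>Needed on the whole neighbourhood \<open>Z\<close>, as \<open>zab\<close>
    differentiates it once more.\<close>
  have zb: "d_zbar b (\<lambda>x. complex_of_real (Fl x $ i)) w = FC ?F (conj_hol b) w $ i / 2" if w: "w \<in> Z" for b i w
  proof -
    have "dC (conj_hol b) (\<lambda>x. complex_of_real (Fl x $ i)) w = dC (conj_hol b) (\<lambda>x. complex_of_real (?F x $ i)) w"
      by (rule dC_cong_open[OF Z(1) w]) (simp add: Fl)
    then show ?thesis
      unfolding d_zbar_eq_dC dC_complexify[OF smooth_F Z(3)[OF w]] by simp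
  qed
  have za: "d_z a (\<lambda>x. complex_of_real (Fl x $ i)) z = FC ?F (hol_dir a) z $ i / 2" for a i
  proof -
    have "d_z a (\<lambda>x. complex_of_real (Fl x $ i)) z = d_z a (\<lambda>x. complex_of_real (?F x $ i)) z"
      using frechet_derivative_cong_open[OF Z(1,2), of "\<lambda>x. complex_of_real (Fl x $ i)" "\<lambda>x. complex_of_real (?F x $ i)"] Fl
      by (simp add: d_z_def)
    then show ?thesis
      unfolding d_z_eq_dC[OF smooth_on_differentiable[OF smF z]] dC_complexify[OF smooth_F z] .
  qed
  have zab: "d_z a (d_zbar b (\<lambda>x. complex_of_real (Fl x $ i))) z = dC (hol_dir a) (\<lambda>x. FC ?F (conj_hol b) x $ i) z / 4" for a b i
  proof -
    have s: "smooth_on (cdom d) (\<lambda>x. FC ?F (conj_hol b) x $ i / 2)"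
      by (rule smooth_on_bounded_linear[OF bounded_linear_divide open_U smFC])
    have "d_z a (d_zbar b (\<lambda>x. complex_of_real (Fl x $ i))) z = d_z a (\<lambda>x. FC ?F (conj_hol b) x $ i / 2) z"
      using frechet_derivative_cong_open[OF Z(1,2), of "d_zbar b (\<lambda>x. complex_of_real (Fl x $ i))" "\<lambda>x. FC ?F (conj_hol b) x $ i / 2"] zb
      by (simp add: d_z_def)
    also have "\<dots> = dC (hol_dir a) (\<lambda>x. FC ?F (conj_hol b) x $ i / 2) z / 2"
      by (rule d_z_eq_dC[OF smooth_on_differentiable[OF s z]])
    also have "dC (hol_dir a) (\<lambda>x. FC ?F (conj_hol b) x $ i / 2) z = dC (hol_dir a) (\<lambda>x. FC ?F (conj_hol b) x $ i) z / 2"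
      unfolding dC_def dird_bounded_linear[OF bounded_linear_divide smFC z] by (simp add: add_divide_distrib)
    finally show ?thesis by simp
  qed
  \<comment> \<open>The factor 4 comes from the halves in \<open>d_z\<close> and
    \<open>d_zbar\<close>, absent from \<open>hol_dir\<close>.\<close>
  have H: "HC ?G ?F (hol_dir a) (conj_hol b) z $ i = 4 *
      (d_z a (d_zbar b (\<lambda>x. complex_of_real (Fl x $ i))) z +
       (\<Sum>j\<in>UNIV. \<Sum>k\<in>UNIV. complex_of_real (christoffel ?G (Fl z) i j k) *
          d_zbar b (\<lambda>x. complex_of_real (Fl x $ j)) z * d_z a (\<lambda>x. complex_of_real (Fl x $ k)) z))" for a b i
  proof -
    have "HC ?G ?F (hol_dir a) (conj_hol b) z $ i = dC (hol_dir a) (\<lambda>x. FC ?F (conj_hol b) x $ i) z +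
        bil (christoffel ?G (?F z) i) (FC ?F (conj_hol b) z) (FC ?F (hol_dir a) z)"
      unfolding HC_def covC_alt[OF smooth_FC z] Gam_commute[OF F_in[OF z], of "FC ?F (hol_dir a) z"]
      by (simp add: Gam_def)
    then show ?thesis
      unfolding zab zb[OF Z(2)] za Fl[OF Z(2)]
      by (simp add: bil_def sum_distrib_left algebra_simps)
  qed
  have hz: "\<And>\<alpha> \<beta>. h c z $ \<beta> $ \<alpha> = cnj (h c z $ \<alpha> $ \<beta>)" "\<And>v. v \<noteq> 0 \<Longrightarrow> Re (hform (h c z) v v) > 0"
    using h W(2,5) hopf_chart_image[OF W(4)] unfolding hermitian_metric_def c_def by blast+
  obtain p q D r where pq: "p > 0" "(cmod r)\<^sup>2 < p * q" and D: "D > 0"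
    and hinv: "hinv (h c z) 1 1 = of_real (p / D)" "hinv (h c z) 2 2 = of_real (q / D)"
    "hinv (h c z) 1 2 = r / of_real D" "hinv (h c z) 2 1 = cnj r / of_real D"
    by (rule hinv_2[OF hz])
  have "hopf_proj z \<in> fst c" "f (hopf_proj z) \<in> fst d" "snd c (hopf_proj z) = z"
    using W(2) z hopf_chart_coord[OF W(4)] by (auto simp: c_def hopf_chart_def cdom_def lift_def)
  then have harm: "(\<Sum>a\<in>UNIV. \<Sum>b\<in>UNIV. hinv (h c z) a b * (d_z a (d_zbar b (\<lambda>x. complex_of_real (Fl x $ i))) z +
       (\<Sum>j\<in>UNIV. \<Sum>k\<in>UNIV. complex_of_real (christoffel ?G (Fl z) i j k) *
          d_zbar b (\<lambda>x. complex_of_real (Fl x $ j)) z * d_z a (\<lambda>x. complex_of_real (Fl x $ k)) z))) = 0" for i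
    using f d W(5) unfolding hermitian_harmonic_def Let_def Fl_def c_def by force
  have "(\<Sum>a\<in>UNIV. \<Sum>b\<in>UNIV. hinv (h c z) a b * HC ?G ?F (hol_dir a) (conj_hol b) z $ i) = 0" for i
  proof -
    have "(\<Sum>a\<in>UNIV. \<Sum>b\<in>UNIV. hinv (h c z) a b * HC ?G ?F (hol_dir a) (conj_hol b) z $ i) =
      4 * (\<Sum>a\<in>UNIV. \<Sum>b\<in>UNIV. hinv (h c z) a b * (d_z a (d_zbar b (\<lambda>x. complex_of_real (Fl x $ i))) z +
       (\<Sum>j\<in>UNIV. \<Sum>k\<in>UNIV. complex_of_real (christoffel ?G (Fl z) i j k) *
          d_zbar b (\<lambda>x. complex_of_real (Fl x $ j)) z * d_z a (\<lambda>x. complex_of_real (Fl x $ k)) z)))"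
      unfolding H by (simp only: sum_distrib_left mult.left_commute)
    then show ?thesis unfolding harm by simp
  qed
  then have "of_real D * (\<Sum>a\<in>UNIV. \<Sum>b\<in>UNIV. hinv (h c z) a b * HC ?G ?F (hol_dir a) (conj_hol b) z $ i) = 0" for i
    by simp
  moreover have e: "of_real D * (of_real (a / D) * x) = of_real a * x"
    "of_real D * (w / of_real D * x) = w * x" for a and w x :: complex
    using D by simp_all
  ultimately have "of_real p * HC ?G ?F (hol_dir 1) (conj_hol 1) z $ i + of_real q * HC ?G ?F (hol_dir 2) (conj_hol 2) z $ i +
     r * HC ?G ?F (hol_dir 1) (conj_hol 2) z $ i + cnj r * HC ?G ?F (hol_dir 2) (conj_hol 1) z $ i = 0" for i
    unfolding sum_2 hinv distrib_left e by (simp add: algebra_simps)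
  then show ?thesis
    by (intro that[OF pq]) (simp add: vec_eq_iff)
qed

text \<open>The coefficients, up to sign and constant factors, of the form obtained from \<eta> by
  the conjugate exterior derivative; \<open>divQ\<close> applies the holomorphic one and so is the
  coefficient of the top degree form.\<close>

definition divP :: "2 \<Rightarrow> complex^2 \<Rightarrow> complex" where
  "divP k z = dC (conj_hol 1) (eta (hol_dir k) (conj_hol 2)) z - dC (conj_hol 2) (eta (hol_dir k) (conj_hol 1)) z"

lemma open_punctured: "open (- {0 :: complex^2})"
  by (simp add: open_Compl)

lemma smooth_divP: "smooth_on (- {0}) (divP k)"
  unfolding divP_def[abs_def]
  by (intro smooth_on_diff[OF open_punctured] smooth_dC[OF open_punctured] smooth_eta)

lemma divP_half:
  assumes "z \<noteq> 0"
  shows "divP k ((1/2) *\<^sub>R z) = 8 *\<^sub>R divP k z"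
proof -
  have "dC \<xi> (eta \<zeta> \<omega>) ((1/2) *\<^sub>R z) = (2 * 4) *\<^sub>R dC \<xi> (eta \<zeta> \<omega>) z" for \<xi> \<zeta> \<omega>
    by (rule dC_homogeneous[OF open_punctured _ smooth_eta]) (use assms eta_half in auto)
  then show ?thesis
    unfolding divP_def by (simp add: scaleR_conv_of_real algebra_simps)
qed

definition divQ :: "complex^2 \<Rightarrow> complex" where
  "divQ z = dC (hol_dir 1) (divP 2) z - dC (hol_dir 2) (divP 1) z"

lemma divQ_local:
  assumes d: "d \<in> B" and z: "z \<in> cdom d"
  shows "Re (divQ z) \<ge> 0"
    and "Re (divQ z) = 0 \<Longrightarrow>
      HC (g d) (rep d) (hol_dir 1) (conj_hol 1) z = 0 \<and> HC (g d) (rep d) (hol_dir 2) (conj_hol 2) z = 0"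
proof -
  interpret map_chart "chart_image d" "g d" "cdom d" "rep d" by (rule map_chart[OF d])
  obtain p q r where pqr: "p > 0" "(cmod r)\<^sup>2 < p * q"
    "of_real p *s HC (g d) (rep d) (hol_dir 1) (conj_hol 1) z +
     of_real q *s HC (g d) (rep d) (hol_dir 2) (conj_hol 2) z +
     r *s HC (g d) (rep d) (hol_dir 1) (conj_hol 2) z +
     cnj r *s HC (g d) (rep d) (hol_dir 2) (conj_hol 1) z = 0"
    by (rule harmonic_trace[OF d z])
  have P: "divP k w = dC (conj_hol 1) (\<lambda>x. etaC (g d) (rep d) (hol_dir k) (conj_hol 2) x) w -
      dC (conj_hol 2) (\<lambda>x. etaC (g d) (rep d) (hol_dir k) (conj_hol 1) x) w" if w: "w \<in> cdom d" for k w
  proof -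
    have "dC \<xi> (eta \<zeta> \<omega>) w = dC \<xi> (\<lambda>x. etaC (g d) (rep d) \<zeta> \<omega> x) w" for \<xi> \<zeta> \<omega>
      by (rule dC_cong[OF w]) (rule eta_eq[OF d])
    then show ?thesis unfolding divP_def by simp
  qed
  have Q: "dC (hol_dir a) (divP k) z = dC (hol_dir a) (\<lambda>w. dC (conj_hol 1) (\<lambda>x. etaC (g d) (rep d) (hol_dir k) (conj_hol 2) x) w -
      dC (conj_hol 2) (\<lambda>x. etaC (g d) (rep d) (hol_dir k) (conj_hol 1) x) w) z" for a k
    by (rule dC_cong[OF z P])
  note S = siu_sampson_nonneg[OF z curvature[OF d z] pqr, folded Q divQ_def]
  show "Re (divQ z) \<ge> 0" by (rule S(1))
  show "Re (divQ z) = 0 \<Longrightarrow>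
      HC (g d) (rep d) (hol_dir 1) (conj_hol 1) z = 0 \<and> HC (g d) (rep d) (hol_dir 2) (conj_hol 2) z = 0"
    by (rule S(2))
qed

text \<open>\<open>Re (divQ z)\<close> is a real divergence of functions of degree -3, and it is
  nonnegative by \<open>divQ_local\<close>, so \<open>homogeneous_divergence_zero\<close>
  applies.\<close>

lemma Re_divQ_zero:
  assumes z: "z \<noteq> 0"
  shows "Re (divQ z) = 0"
proof -
  \<comment> \<open>The real part of \<open>divQ\<close> splits into four real directional
    derivatives: \<open>L\<close> selects the signed real or imaginary part, \<open>a\<close> the
    component of \<open>divP\<close>, and \<open>v\<close> the direction.\<close>
  define L :: "nat \<Rightarrow> complex \<Rightarrow> real" where
    "L i = (if i = 0 then Re else if i = 1 then (\<lambda>w. - Im w) else if i = 2 then (\<lambda>w. - Re w) else Im)" for i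
  define a :: "nat \<Rightarrow> 2" where "a i = (if i < 2 then 2 else 1)" for i
  define v :: "nat \<Rightarrow> complex^2" where
    "v i = (if i = 0 then fst (hol_dir 1) else if i = 1 then snd (hol_dir 1) else
      if i = 2 then fst (hol_dir 2) else snd (hol_dir 2))" for i
  have L: "bounded_linear (L i)" for i
    by (simp add: L_def bounded_linear_Re bounded_linear_Im bounded_linear_minus)
  let ?F' = "\<lambda>i x h. L i (dird h (divP (a i)) x)"
  have Q: "Re (divQ x) = (\<Sum>i\<in>{0,1,2,3}. ?F' i x (v i))" for x
    by (simp add: divQ_def dC_def L_def a_def v_def)
  have "(\<Sum>i\<in>{0,1,2,3}. ?F' i z (v i)) = 0"
  proof (rule homogeneous_divergence_zero[where F="\<lambda>i x. L i (divP (a i) x)"])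
    show "((\<lambda>x. L i (divP (a i) x)) has_derivative ?F' i x) (at x)" if "x \<noteq> 0" for i x
      by (rule bounded_linear.has_derivative[OF L smooth_on_has_derivative[OF smooth_divP]]) (use that in simp)
    show "continuous_on (- {0}) (\<lambda>x. ?F' i x (v i))" for i
      by (rule bounded_linear.continuous_on[OF L smooth_on_continuous[OF smooth_on_dird[OF smooth_divP]]])
    \<comment> \<open>Real dimension 4 requires the factor 2^3, the 8 of
      \<open>divP_half\<close>.\<close>
    show "L i (divP (a i) ((1/2) *\<^sub>R x)) = 2 ^ (DIM(complex^2) - 1) * L i (divP (a i) x)" if "x \<noteq> 0" for i x
      unfolding divP_half[OF that] linear_scale[OF bounded_linear.linear[OF L]] by simp
    show "0 \<le> (\<Sum>i\<in>{0,1,2,3}. ?F' i x (v i))" if x: "x \<noteq> 0" for x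
    proof -
      obtain d where "d \<in> B" "x \<in> cdom d" using cdom_cover[OF x] .
      then show ?thesis unfolding Q[symmetric] by (rule divQ_local(1))
    qed
  qed (fact z)
  then show ?thesis unfolding Q .
qed

lemma pluriharmonic:
  assumes d: "d \<in> B" and z: "z \<in> cdom d"
  shows "HC (g d) (rep d) (hol_dir k) (conj_hol k) z = 0"
proof -
  have "z \<noteq> 0" using z by (simp add: cdom_def)
  from divQ_local(2)[OF d z Re_divQ_zero[OF this]] show ?thesis
    using exhaust_2[of k] by auto
qed

end

text \<open>Formally (v - iw)(v + iw) = v^2 + w^2, the mixed terms cancelling by symmetry. For the
  coordinate directions this is the Laplacian along a complex line.\<close>

lemma dC_conj_dC:
  fixes u :: "'a::euclidean_space \<Rightarrow> complex"
  assumes S: "open S" and u: "smooth_on S u" and x: "x \<in> S"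
  shows "dC (v, - w) (dC (v, w) u) x = dird v (dird v u) x + dird w (dird w u) x"
proof -
  note su = smooth_on_dird[OF u]
  have "smooth_on S (dC (v, w) u)" by (rule smooth_dC[OF S u])
  from linear_neg[OF smooth_on_linear[OF this x], of w]
  have n: "dird (- w) (dC (v, w) u) x = - dird w (dC (v, w) u) x" .
  have "(dC (v, w) u has_derivative (\<lambda>k. dird k (dird v u) x + \<i> * dird k (dird w u) x)) (at x)"
    unfolding dC_def[abs_def] fst_conv snd_conv
    by (intro has_derivative_add has_derivative_mult_right smooth_on_has_derivative[OF su x])
  then have k: "dird k (dC (v, w) u) x = dird k (dird v u) x + \<i> * dird k (dird w u) x" for k
    by (simp add: has_derivative_frechetD)
  show ?thesis
    unfolding dC_def[of "(v, - w)"] fst_conv snd_conv n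
    unfolding k dird_commute[OF S x u, of v w]
    by (simp add: algebra_simps)
qed

text \<open>On a complex line missing the origin \<open>u\<close> is smooth and decays like the
  inverse square of the parameter, so the maximum principle on the plane applies.\<close>

lemma subharmonic_line_le_zero:
  fixes u :: "complex^'n \<Rightarrow> real"
  assumes u: "smooth_on (- {0}) u"
    and hom: "\<And>x. x \<noteq> 0 \<Longrightarrow> u ((1/2) *\<^sub>R x) = 4 * u x"
    and sub: "\<And>x. x \<noteq> 0 \<Longrightarrow>
      0 \<le> dird (axis k 1) (dird (axis k 1) u) x + dird (axis k \<i>) (dird (axis k \<i>) u) x"
    and p: "\<And>c. p + axis k c \<noteq> 0"
  shows "u p \<le> 0"
proof -
  define l where "l = (\<lambda>c. p + axis k c)"
  have l0: "l c \<noteq> 0" for c using p by (simp add: l_def)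
  have lx: "l (c + of_real t) = l c + t *\<^sub>R axis k 1" for c t
    by (simp add: l_def vec_eq_iff axis_def complex_eq_iff)
  have ly: "l (c + \<i> * of_real t) = l c + t *\<^sub>R axis k \<i>" for c t
    by (simp add: l_def vec_eq_iff axis_def complex_eq_iff)
  have der: "((\<lambda>t. g (l c + t *\<^sub>R v)) has_real_derivative dird v g (l c)) (at 0)"
    if "smooth_on (- {0}) g" for g :: "complex^'n \<Rightarrow> real" and c v
    using has_vector_derivative_line[OF that, of "l c" 0 v] l0
    by (simp add: has_real_derivative_iff_has_vector_derivative)
  have cont: "continuous_on UNIV (\<lambda>c. u (l c))"
  proof (rule continuous_on_compose2[OF smooth_on_continuous[OF u]])
    show "continuous_on UNIV l"
      unfolding l_def by (intro continuous_intros linear_continuous_on[OF bounded_linear_axis])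
  qed (use l0 in auto)
  obtain C where C: "\<And>x. 1 \<le> norm x \<Longrightarrow> \<bar>u x\<bar> \<le> C / (norm x)\<^sup>2"
    using homogeneous_bound[OF smooth_on_continuous[OF u] hom] by blast
  have nl: "norm (l c) \<ge> norm c - norm p" for c
  proof -
    have "norm c \<le> norm (axis k c :: complex^'n)"
      using Finite_Cartesian_Product.norm_nth_le[of "axis k c :: complex^'n" k] by (simp add: axis_nth)
    also have "\<dots> \<le> norm (l c) + norm p"
      using norm_triangle_ineq4[of "l c" p] by (simp add: l_def)
    finally show ?thesis by simp
  qed
  have lim: "filterlim (\<lambda>c. norm (l c)) at_top at_infinity"
  proof (rule filterlim_at_top_mono)
    show "filterlim (\<lambda>c. - norm p + norm c) at_top at_infinity"
      by (rule filterlim_tendsto_add_at_top[OF tendsto_const filterlim_norm_at_top])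
    show "\<forall>\<^sub>F c in at_infinity. - norm p + norm c \<le> norm (l c)"
      using nl by (intro always_eventually) (simp add: algebra_simps)
  qed
  have inf: "((\<lambda>c. u (l c)) \<longlongrightarrow> 0) at_infinity"
  proof (rule Lim_null_comparison)
    show "\<forall>\<^sub>F c in at_infinity. norm (u (l c)) \<le> C / (norm (l c))\<^sup>2"
      using lim unfolding filterlim_at_top by (auto elim!: allE[of _ 1] eventually_mono intro: C)
    show "((\<lambda>c. C / (norm (l c))\<^sup>2) \<longlongrightarrow> 0) at_infinity"
      by (intro tendsto_divide_0[OF tendsto_const] filterlim_at_top_imp_at_infinity
          filterlim_pow_at_top lim) simp
  qed
  have "u (l 0) \<le> 0"
  proof (rule subharmonic_plane_le_zero[OF cont _ _ _ _ _ inf])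
    show "((\<lambda>t. u (l (c + of_real t))) has_real_derivative dird (axis k 1) u (l c)) (at 0)" for c
      unfolding lx by (rule der[OF u])
    show "((\<lambda>t. dird (axis k 1) u (l (c + of_real t))) has_real_derivative
        dird (axis k 1) (dird (axis k 1) u) (l c)) (at 0)" for c
      unfolding lx by (rule der[OF smooth_on_dird[OF u]])
    show "((\<lambda>t. u (l (c + \<i> * of_real t))) has_real_derivative dird (axis k \<i>) u (l c)) (at 0)" for c
      unfolding ly by (rule der[OF u])
    show "((\<lambda>t. dird (axis k \<i>) u (l (c + \<i> * of_real t))) has_real_derivative
        dird (axis k \<i>) (dird (axis k \<i>) u) (l c)) (at 0)" for c
      unfolding ly by (rule der[OF smooth_on_dird[OF u]])
    show "0 \<le> dird (axis k 1) (dird (axis k 1) u) (l c) + dird (axis k \<i>) (dird (axis k \<i>) u) (l c)" for c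
      by (rule sub[OF l0])
  qed
  then show ?thesis by (simp add: l_def axis_def vec_eq_iff zero_vec_def[symmetric])
qed

section \<open>The energy along coordinate lines\<close>

context hopf_harmonic_map
begin

definition energy :: "2 \<Rightarrow> complex^2 \<Rightarrow> real" where
  "energy k z = Re (eta (hol_dir k) (conj_hol k) z)"

lemma smooth_energy: "smooth_on (- {0}) (energy k)"
  unfolding energy_def[abs_def]
  by (rule smooth_on_bounded_linear[OF bounded_linear_Re open_punctured smooth_eta])

lemma energy_local:
  assumes d: "d \<in> B" and z: "z \<in> cdom d"
  shows "energy k z \<ge> 0" and "energy k z = 0 \<Longrightarrow> FC (rep d) (hol_dir k) z = 0"
proof -
  interpret map_chart "chart_image d" "g d" "cdom d" "rep d" by (rule map_chart[OF d])
  have e: "energy k z = Re (gC (g d (rep d z)) (FC (rep d) (hol_dir k) z) (cnj_vec (FC (rep d) (hol_dir k) z)))"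
    unfolding energy_def eta_eq[OF d z] etaC_def FC_conj[OF z] ..
  show "energy k z \<ge> 0"
    unfolding e by (rule gC_cnj_nonneg(1)[OF F_in[OF z]])
  show "energy k z = 0 \<Longrightarrow> FC (rep d) (hol_dir k) z = 0"
    unfolding e by (rule gC_cnj_nonneg(2)[OF F_in[OF z]])
qed

lemma energy_nonneg: "z \<noteq> 0 \<Longrightarrow> energy k z \<ge> 0"
  using cdom_cover[of z] energy_local(1) by metis

lemma energy_subharmonic:
  assumes z: "z \<noteq> 0"
  shows "0 \<le> dird (axis k 1) (dird (axis k 1) (energy k)) z + dird (axis k \<i>) (dird (axis k \<i>) (energy k)) z"
proof -
  obtain d where d: "d \<in> B" "z \<in> cdom d" using cdom_cover[OF z] .
  interpret map_chart "chart_image d" "g d" "cdom d" "rep d" by (rule map_chart[OF d(1)])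
  let ?u = "eta (hol_dir k) (conj_hol k)"
  have z': "z \<in> - {0}" using z by simp
  have R: "dird v (dird v (energy k)) z = Re (dird v (dird v ?u) z)" for v
  proof -
    have "dird v (dird v (energy k)) z = dird v (\<lambda>x. Re (dird v ?u x)) z"
      unfolding energy_def[abs_def]
      by (rule fun_cong[OF frechet_derivative_cong_open[OF open_punctured z']])
        (rule dird_bounded_linear[OF bounded_linear_Re smooth_eta])
    then show ?thesis
      unfolding dird_bounded_linear[OF bounded_linear_Re smooth_on_dird[OF smooth_eta] z'] .
  qed
  have i: "dC (conj_hol k) ?u w = dC (conj_hol k) (\<lambda>x. etaC (g d) (rep d) (hol_dir k) (conj_hol k) x) w"
    if "w \<in> cdom d" for w
    by (rule dC_cong[OF that]) (rule eta_eq[OF d(1)])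
  have "0 \<le> Re (dC (hol_dir k) (\<lambda>x. dC (conj_hol k) (\<lambda>x. etaC (g d) (rep d) (hol_dir k) (conj_hol k) x) x) z)"
    by (rule Re_dC_dC_energy_nonneg[OF d(2) curvature[OF d] pluriharmonic[OF d(1)]])
  also have "dC (hol_dir k) (\<lambda>x. dC (conj_hol k) (\<lambda>x. etaC (g d) (rep d) (hol_dir k) (conj_hol k) x) x) z =
      dC (hol_dir k) (dC (conj_hol k) ?u) z"
    by (rule dC_cong[OF d(2)]) (rule i[symmetric])
  also have "\<dots> = dird (axis k 1) (dird (axis k 1) ?u) z + dird (axis k \<i>) (dird (axis k \<i>) ?u) z"
    using dC_conj_dC[OF open_punctured smooth_eta z', of "axis k 1" "axis k \<i>" "hol_dir k" "conj_hol k"]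
    unfolding conj_hol_dir by (simp add: hol_dir_def)
  finally show ?thesis unfolding R by simp
qed

lemma energy_half:
  assumes "z \<noteq> 0"
  shows "energy k ((1/2) *\<^sub>R z) = 4 * energy k z"
  unfolding energy_def eta_half[OF assms] by simp

text \<open>A line in direction \<open>k\<close> avoids the origin exactly when the other coordinate
  is nonzero. On such lines the energy is both nonnegative and nonpositive; the remaining points are
  limits of these.\<close>

lemma energy_zero:
  assumes z: "z \<noteq> 0"
  shows "energy k z = 0"
proof -
  obtain j :: 2 where j: "j \<noteq> k" using exhaust_2[of k] by (metis one_neq_zero zero_neq_one num1_eq_iff)
  have off: "energy k x = 0" if x: "x $ j \<noteq> 0" for x
  proof -
    have nz: "x + axis k c \<noteq> 0" for c
    proof
      assume "x + axis k c = 0"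
      then have "(x + axis k c) $ j = 0" by simp
      then show False using x j by (simp add: axis_def)
    qed
    have "energy k x \<le> 0"
      by (rule subharmonic_line_le_zero[OF smooth_energy energy_half energy_subharmonic nz])
    moreover have "x \<noteq> 0" using x by auto
    ultimately show ?thesis using energy_nonneg[of x k] by simp
  qed
  show ?thesis
  proof (cases "z $ j = 0")
    case False
    then show ?thesis by (rule off)
  next
    case True
    \<comment> \<open>Points with nonzero \<open>j\<close>-th coordinate that approach
      \<open>z\<close>.\<close>
    define s where "s n = z + inverse (real (Suc n)) *\<^sub>R axis j 1" for n
    have "s \<longlonglongrightarrow> z + 0 *\<^sub>R axis j 1"
      unfolding s_def by (intro tendsto_intros LIMSEQ_inverse_real_of_nat)
    then have "s \<longlonglongrightarrow> z" by simp
    moreover have "isCont (energy k) z"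
      using smooth_on_continuous[OF smooth_energy] z open_punctured by (simp add: continuous_on_eq_continuous_at)
    ultimately have "(\<lambda>n. energy k (s n)) \<longlonglongrightarrow> energy k z"
      by (rule isCont_tendsto_compose[rotated])
    moreover have "energy k (s n) = 0" for n
      by (rule off) (use True in \<open>simp add: s_def\<close>)
    ultimately show ?thesis by (simp add: LIMSEQ_const_iff)
  qed
qed

text \<open>The real and imaginary parts of the vanishing complex derivative are, up to sign, the
  derivatives along \<open>axis k 1\<close> and \<open>axis k \<i>\<close>, and these vectors span
  the domain over the reals.\<close>

lemma dird_rep_zero:
  assumes d: "d \<in> B" and z: "z \<in> cdom d"
  shows "dird v (rep d) z = 0"
proof -
  have z0: "z \<noteq> 0" using z by (simp add: cdom_def)
  have lin: "linear (\<lambda>v. dird v (rep d) z)" by (rule smooth_on_linear[OF smooth_rep[OF d] z])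
  have "dird (axis k 1) (rep d) z = 0" "dird (axis k \<i>) (rep d) z = 0" for k
    using energy_local(2)[OF d z energy_zero[OF z0], of k] linear_neg[OF lin, of "axis k \<i>"]
    by (simp_all add: FC_def hol_dir_def complexify_def vec_eq_iff complex_eq_iff)
  moreover have "v = (\<Sum>k\<in>UNIV. Re (v $ k) *\<^sub>R axis k 1 + Im (v $ k) *\<^sub>R axis k \<i>)"
    by (simp add: vec_eq_iff axis_def sum_2 forall_2 complex_eq_iff)
  then have "dird v (rep d) z = dird (\<Sum>k\<in>UNIV. Re (v $ k) *\<^sub>R axis k 1 + Im (v $ k) *\<^sub>R axis k \<i>) (rep d) z"
    by simp
  moreover have "\<dots> = (\<Sum>k\<in>UNIV. Re (v $ k) *\<^sub>R dird (axis k 1) (rep d) z + Im (v $ k) *\<^sub>R dird (axis k \<i>) (rep d) z)"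
    by (simp only: linear_sum[OF lin] linear_add[OF lin] linear_scale[OF lin])
  ultimately show ?thesis by simp
qed

lemma lift_locally_constant:
  assumes z: "z \<noteq> 0"
  shows "\<forall>\<^sub>F w in at z within - {0}. lift z = lift w"
proof -
  obtain d where d: "d \<in> B" "z \<in> cdom d" using cdom_cover[OF z] .
  obtain e where e: "e > 0" "ball z e \<subseteq> cdom d"
    using open_cdom[OF d(1)] d(2) open_contains_ball by blast
  have const: "lift z = lift w" if w: "w \<in> ball z e" for w
  proof -
    have "\<exists>c. \<forall>x\<in>ball z e. rep d x = c"
    proof (rule has_derivative_zero_constant[OF convex_ball])
      fix x assume "x \<in> ball z e"
      then have x: "x \<in> cdom d" using e(2) by blast
      have "(rep d has_derivative (\<lambda>v. dird v (rep d) x)) (at x)"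
        by (rule smooth_on_has_derivative[OF smooth_rep[OF d(1)] x])
      then have "(rep d has_derivative (\<lambda>h. 0)) (at x)"
        unfolding dird_rep_zero[OF d(1) x] .
      then show "(rep d has_derivative (\<lambda>h. 0)) (at x within ball z e)"
        by (rule has_derivative_at_withinI)
    qed
    then have "rep d z = rep d w" using w e(1) by (metis centre_in_ball)
    moreover have "lift z \<in> fst d" "lift w \<in> fst d"
      using d(2) w e(2) by (auto simp: cdom_def)
    ultimately show ?thesis
      using inj_onD[OF inj_chart[OF d(1)]] by (simp add: rep_def)
  qed
  show ?thesis
    unfolding eventually_at using e(1) const by (intro exI[of _ e]) (auto simp: dist_commute)
qed

lemma lift_constant:
  assumes "z \<noteq> 0" "w \<noteq> 0"
  shows "lift z = lift w"
proof (rule connected_local_const)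
  show "connected (- {0 :: complex^2})"
    by (rule connected_punctured_universe) simp
qed (use assms lift_locally_constant in auto)

lemma map_constant: "f constant_on topspace hopf_topology"
  unfolding constant_on_def topspace_hopf_topology
proof (intro exI ballI)
  fix p assume "p \<in> hopf_proj ` (- {0 :: complex^2})"
  then obtain z where "z \<noteq> 0" "p = hopf_proj z" by auto
  then show "f p = lift (axis 1 1)"
    using lift_constant[of z "axis 1 1"] by (simp add: lift_def axis_eq_0_iff)
qed

end

theorem corollary1p11:
  fixes h :: "((complex^2) set, complex^2) chart \<Rightarrow> complex^2 \<Rightarrow> complex^2^2"
    and N :: "'q topology"
    and B :: "('q, real^'n) chart set"
    and g :: "('q, real^'n) chart \<Rightarrow> real^'n \<Rightarrow> real^'n^'n"
  assumes "hermitian_metric hopf_atlas h"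
    and "smooth_manifold N B"
    and "riemannian_metric B g"
    and "nonpos_complex_sectional_curvature B g"
  shows "\<not> (\<exists>f. hermitian_harmonic hopf_topology hopf_atlas h N B g f \<and>
               \<not> f constant_on topspace hopf_topology)"
  using hopf_harmonic_map.map_constant[OF hopf_harmonic_map.intro[OF assms]] by blast

end
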